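(* Assume that $\mu^{\rm per}_j\in L^1(T_3)\cap L^2(T_3)$ for $j=1,\dots,N$ (and $Z>0$). Then: (i) There exists $(\psi^0,\overline{\mathbf x}^0)\in\mathcal M$ with $$E(\psi^0,\overline{\mathbf x}^0)=E^0:=\inf_{(\psi,\overline{\mathbf x})\in\mathcal M}E(\psi,\overline{\mathbf x}).$$ (ii) Moreover, $\psi^0\in H^2$, and there exist a real-valued $\phi^0\in H^2$ and $\omega^0\in\mathbb R$ such that, with $\overline{\mathbf x}^0=(\mathbf x^0_1,\dots,\mathbf x^0_N)$ and $\sigma^0(\mathbf x)=\sum_{j=1}^N\mu_j^{\rm per}(\mathbf x-\mathbf x_j^0)$, the following equations hold on $T_3$: $$\hbar\omega^0\psi^0=-\frac{\hbar^2}{2{\rm m}}\Delta\psi^0+e\phi^0\psi^0,\qquad -\Delta\phi^0=\sigma^0+e|\psi^0|^2,$$ $$\int_{T_3}\nabla\phi^0(\mathbf x)\,\mu_j^{\rm per}(\mathbf x-\mathbf x_j^0)\,d\mathbf x=0,\qquad j=1,\dots,N.$$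
   Context: Constants: $\hbar>0$, ${\rm m}>0$, $e<0$; $N\ge1$ is an integer. $\Gamma_3=\{n_1\mathbf a_1+n_2\mathbf a_2+n_3\mathbf a_3:\ n_k\in\mathbb Z\}$ with $\mathbf a_1,\mathbf a_2,\mathbf a_3\in\mathbb R^3$ linearly independent; $T_3=\mathbb R^3/\Gamma_3$; $|T_3|$ is its volume. $L^p$ and $H^s$ are the complex Lebesgue and Sobolev spaces on $T_3$. Derivatives are in the sense of distributions. $\mu_j^{\rm per}:T_3\to\mathbb R$, $j=1,\dots,N$, are given (real) ion charge densities. $Z_j:=|e|^{-1}\int_{T_3}\mu_j^{\rm per}\,d\mathbf x$ (arbitrary real numbers), $Z:=\sum_jZ_j$, and it is assumed throughout that $Z>0$. $M=\{\psi\in H^1:\int_{T_3}|\psi|^2d\mathbf x=Z\}$ and $\mathcal M=M\times T_3^N$. For $(\psi,\overline{\mathbf x})\in\mathcal M$, $\overline{\mathbf x}=(\mathbf x_1,\dots,\mathbf x_N)$, put $\rho(\mathbf x)=\sum_{j=1}^N\mu_j^{\rm per}(\mathbf x-\mathbf x_j)+e|\psi(\mathbf x)|^2$, so that $\rho\in L^2$ and $\int_{T_3}\rho=0$. The energy per cell is $$E(\psi,\overline{\mathbf x})=\int_{T_3}\Big[\frac{\hbar^2}{2{\rm m}}|\nabla\psi|^2+\frac12\phi\,\rho\Big]d\mathbf x,\qquad \phi=(-\Delta)^{-1}\rho,$$ where, with $\Gamma_3^*$ the dual lattice generated by $\mathbf b_1,\mathbf b_2,\mathbf b_3$ with $\mathbf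 b_k\cdot\mathbf a_{k'}=2\pi\delta_{kk'}$ and $\hat\rho(\mathbf k)=|T_3|^{-1/2}\int_{T_3} e^{i\mathbf k\mathbf x}\rho(\mathbf x)d\mathbf x$, $$(-\Delta)^{-1}\rho(\mathbf x)=|T_3|^{-1/2}\sum_{\mathbf k\in\Gamma_3^*\setminus0}\frac{\hat\rho(\mathbf k)}{\mathbf k^2}e^{-i\mathbf k\mathbf x}.$$ *)

theory Defs
  imports "HOL-Analysis.Analysis"
begin

(* The torus T = R^3 / Gamma, Gamma = lattice a, is handled through periodic functions on R^3
   and the half-open fundamental cell, which contains exactly one representative of each point
   of T. Elements of the function spaces are functions, not classes modulo null sets. *)

definition lattice :: "(3 \<Rightarrow> real^3) \<Rightarrow> (real^3) set" where
  "lattice a = {(\<Sum>k\<in>UNIV. of_int (n k) *\<^sub>R a k) | n :: 3 \<Rightarrow> int. True}"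

definition cell :: "(3 \<Rightarrow> real^3) \<Rightarrow> (real^3) set" where
  "cell a = {(\<Sum>k\<in>UNIV. t k *\<^sub>R a k) | t :: 3 \<Rightarrow> real. \<forall>k. 0 \<le> t k \<and> t k < 1}"

definition dual_basis :: "(3 \<Rightarrow> real^3) \<Rightarrow> 3 \<Rightarrow> real^3" where
  "dual_basis a = (THE b. \<forall>k k'. b k \<bullet> a k' = (if k = k' then 2 * pi else 0))"

definition periodic :: "(3 \<Rightarrow> real^3) \<Rightarrow> (real^3 \<Rightarrow> 'b) \<Rightarrow> bool" where
  "periodic a f \<longleftrightarrow> (\<forall>g\<in>lattice a. \<forall>x. f (x + g) = f x)"

definition Lp :: "(3 \<Rightarrow> real^3) \<Rightarrow> nat \<Rightarrow> (real^3 \<Rightarrow> 'b::real_normed_vector) set" where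
  "Lp a p = {f. periodic a f \<and> f \<in> borel_measurable lebesgue \<and>
                integrable (lebesgue_on (cell a)) (\<lambda>x. norm (f x) ^ p)}"

definition partial_deriv :: "3 \<Rightarrow> (real^3 \<Rightarrow> complex) \<Rightarrow> real^3 \<Rightarrow> complex" where
  "partial_deriv k f x = frechet_derivative f (at x) (axis k 1)"

primrec continuously_diff :: "nat \<Rightarrow> (real^3 \<Rightarrow> complex) \<Rightarrow> bool" where
  "continuously_diff 0 f \<longleftrightarrow> continuous_on UNIV f"
| "continuously_diff (Suc n) f \<longleftrightarrow>
     (\<forall>x. f differentiable (at x)) \<and> (\<forall>k. continuously_diff n (partial_deriv k f))"

definition test_functions :: "(3 \<Rightarrow> real^3) \<Rightarrow> (real^3 \<Rightarrow> complex) set" where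
  "test_functions a = {u. periodic a u \<and> (\<forall>n. continuously_diff n u)}"

definition has_weak_deriv ::
  "(3 \<Rightarrow> real^3) \<Rightarrow> 3 \<Rightarrow> (real^3 \<Rightarrow> complex) \<Rightarrow> (real^3 \<Rightarrow> complex) \<Rightarrow> bool" where
  "has_weak_deriv a k f g \<longleftrightarrow> f \<in> Lp a 1 \<and> g \<in> Lp a 1 \<and>
     (\<forall>u\<in>test_functions a.
        (LINT x|lebesgue_on (cell a). f x * partial_deriv k u x) =
        - (LINT x|lebesgue_on (cell a). g x * u x))"

(* The weak derivative is unique up to a null set, so only statements that are insensitive to
   null sets may be made about the chosen representative. *)
definition weak_deriv :: "(3 \<Rightarrow> real^3) \<Rightarrow> 3 \<Rightarrow> (real^3 \<Rightarrow> complex) \<Rightarrow> real^3 \<Rightarrow> complex" where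
  "weak_deriv a k f = (SOME g. has_weak_deriv a k f g)"

definition weak_grad :: "(3 \<Rightarrow> real^3) \<Rightarrow> (real^3 \<Rightarrow> complex) \<Rightarrow> real^3 \<Rightarrow> complex^3" where
  "weak_grad a f x = (\<chi> k. weak_deriv a k f x)"

definition weak_laplacian :: "(3 \<Rightarrow> real^3) \<Rightarrow> (real^3 \<Rightarrow> complex) \<Rightarrow> real^3 \<Rightarrow> complex" where
  "weak_laplacian a f x = (\<Sum>k\<in>UNIV. weak_deriv a k (weak_deriv a k f) x)"

primrec Sobolev :: "(3 \<Rightarrow> real^3) \<Rightarrow> nat \<Rightarrow> (real^3 \<Rightarrow> complex) set" where
  "Sobolev a 0 = Lp a 2"
| "Sobolev a (Suc s) = {f \<in> Lp a 2. \<forall>k. \<exists>g\<in>Sobolev a s. has_weak_deriv a k f g}"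

definition fourier_coeff :: "(3 \<Rightarrow> real^3) \<Rightarrow> (real^3 \<Rightarrow> complex) \<Rightarrow> real^3 \<Rightarrow> complex" where
  "fourier_coeff a f k = 1 / complex_of_real (sqrt (measure lebesgue (cell a))) *
     (LINT x|lebesgue_on (cell a). cis (k \<bullet> x) * f x)"

(* For f in L^2 the series converges absolutely at every point, since the sum of |k|^(-4) over
   the nonzero dual lattice vectors is finite in dimension 3. *)
definition inv_laplacian :: "(3 \<Rightarrow> real^3) \<Rightarrow> (real^3 \<Rightarrow> complex) \<Rightarrow> real^3 \<Rightarrow> complex" where
  "inv_laplacian a f x = 1 / complex_of_real (sqrt (measure lebesgue (cell a))) *
     (\<Sum>\<^sub>\<infinity>k\<in>lattice (dual_basis a) - {0}.
        fourier_coeff a f k / complex_of_real (k \<bullet> k) * cis (- (k \<bullet> x)))"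

definition total_ion_number ::
  "(3 \<Rightarrow> real^3) \<Rightarrow> real \<Rightarrow> nat \<Rightarrow> (nat \<Rightarrow> real^3 \<Rightarrow> real) \<Rightarrow> real" where
  "total_ion_number a e N \<mu> =
     (\<Sum>j\<in>{1..N}. (LINT x|lebesgue_on (cell a). \<mu> j x) / \<bar>e\<bar>)"

definition configurations ::
  "(3 \<Rightarrow> real^3) \<Rightarrow> real \<Rightarrow> nat \<Rightarrow> (nat \<Rightarrow> real^3 \<Rightarrow> real) \<Rightarrow>
   ((real^3 \<Rightarrow> complex) \<times> (nat \<Rightarrow> real^3)) set" where
  "configurations a e N \<mu> =
     {\<psi> \<in> Sobolev a 1.
        (LINT x|lebesgue_on (cell a). (cmod (\<psi> x))\<^sup>2) = total_ion_number a e N \<mu>}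
     \<times> ({1..N} \<rightarrow>\<^sub>E cell a)"

definition ion_density ::
  "nat \<Rightarrow> (nat \<Rightarrow> real^3 \<Rightarrow> real) \<Rightarrow> (nat \<Rightarrow> real^3) \<Rightarrow> real^3 \<Rightarrow> real" where
  "ion_density N \<mu> X x = (\<Sum>j\<in>{1..N}. \<mu> j (x - X j))"

definition charge_density ::
  "real \<Rightarrow> nat \<Rightarrow> (nat \<Rightarrow> real^3 \<Rightarrow> real) \<Rightarrow> (real^3 \<Rightarrow> complex) \<Rightarrow> (nat \<Rightarrow> real^3) \<Rightarrow>
   real^3 \<Rightarrow> real" where
  "charge_density e N \<mu> \<psi> X x = ion_density N \<mu> X x + e * (cmod (\<psi> x))\<^sup>2"

(* The charge density is real, so the terms for k and -k in its inverse Laplacian are complex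
   conjugate and the potential is real; Re only adjusts the type. *)
definition energy ::
  "(3 \<Rightarrow> real^3) \<Rightarrow> real \<Rightarrow> real \<Rightarrow> real \<Rightarrow> nat \<Rightarrow> (nat \<Rightarrow> real^3 \<Rightarrow> real) \<Rightarrow>
   (real^3 \<Rightarrow> complex) \<Rightarrow> (nat \<Rightarrow> real^3) \<Rightarrow> real" where
  "energy a hbar m e N \<mu> \<psi> X =
     (let \<rho> = charge_density e N \<mu> \<psi> X;
          \<phi> = (\<lambda>x. Re (inv_laplacian a (\<lambda>y. complex_of_real (\<rho> y)) x))
      in LINT x|lebesgue_on (cell a).
           hbar\<^sup>2 / (2 * m) * (norm (weak_grad a \<psi> x))\<^sup>2 + 1 / 2 * \<phi> x * \<rho> x)"

end

theory Submission
  imports Defs "HOL-Complex_Analysis.Great_Picard"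
begin

text \<open>Everything is expressed through Fourier coefficients. By Parseval the energy is
  \<open>\<Sum>k. A |k|\<^sup>2 |\<psi>\<^sub>k|\<^sup>2 + |\<rho>\<^sub>k|\<^sup>2 / (2 |k|\<^sup>2)\<close> with \<open>A = hbar\<^sup>2 / (2 m)\<close>, a sum of nonnegative terms.
  Along a minimizing sequence a diagonal argument makes all coefficients and the ion positions
  converge. The bound on \<open>\<Sum>k. (1 + |k|\<^sup>2) |\<psi>\<^sub>k|\<^sup>2\<close> controls the high frequencies uniformly, so the wave
  functions converge in \<open>L\<^sup>2\<close>: the constraint survives, the coefficients of the charge density
  converge, and Fatou's lemma for sums shows that the limit is a minimizer.

  The Euler--Lagrange equations come from varying a single Fourier mode of \<open>\<psi>\<close>, normalised, and
  the position of a single ion. The Fourier form of the Schroedinger equation bounds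
  \<open>|k|\<^sup>2 \<psi>\<^sub>k\<close> by the coefficients of an \<open>L\<^sup>2\<close> function, since the potential is bounded; this gives
  \<open>\<psi> \<in> H\<^sup>2\<close>.\<close>

section \<open>Lattice and fundamental cell\<close>

text \<open>Coefficients must first determine a function. This is proved in L^1, because the density
  and a chosen weak derivative are at first only integrable; square integrability is then recovered
  by comparison with a Riesz--Fischer function.

  Both variations avoid differentiating an infinite series. Along one Fourier mode the energy is an
  explicit rational function of the step with finitely many constants, and arbitrary complex
  amplitudes turn the real stationarity condition into a complex equation. Moving an ion only
  multiplies its coefficients by phases, and the Coulomb weight 1/|k|^2 absorbs both powers of k in
  the second-order Taylor remainder, so square-integrable ion densities suffice.

  The zero mode is special: division by zero drops it from the Coulomb energy and from the
  potential, and charge neutrality, contained in the definition of \<open>Z\<close>, makes the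
  Poisson equation hold there. The eigenvalue \<open>\<Lambda>\<close> arises from the derivative of
  the normalising factor.\<close>

lemma mult_le_sum_squares: "s * t \<le> s\<^sup>2 + t\<^sup>2" if "s \<ge> 0" "t \<ge> 0" for s t :: real
  using sum_squares_bound[of s t] that mult_nonneg_nonneg[of s t] by linarith

lemma le_one_plus_square: "t \<le> 1 + t\<^sup>2" for t :: real
  using zero_le_power2[of "t - 1/2"] by (simp add: power2_eq_square algebra_simps)

locale torus =
  fixes a :: "3 \<Rightarrow> real^3"
  assumes inj_a: "inj a" and indep_a: "independent (range a)"
begin

abbreviation b :: "3 \<Rightarrow> real^3" where "b \<equiv> dual_basis a"
abbreviation Q :: "(real^3) set" where "Q \<equiv> lattice (dual_basis a)"

section \<open>Dual basis and lattice coordinates\<close>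

lemma span_a: "\<exists>c. x = (\<Sum>k\<in>UNIV. c k *\<^sub>R a k)"
proof -
  have "card (range a) = DIM(real^3)"
    using inj_a by (simp add: card_image)
  then have "span (range a) = UNIV"
    using card_eq_dim[of "range a" UNIV] indep_a by auto
  then have "x \<in> range (\<lambda>u. \<Sum>v\<in>range a. u v *\<^sub>R v)"
    using span_finite[of "range a"] by auto
  then obtain u where "x = (\<Sum>v\<in>range a. u v *\<^sub>R v)" by auto
  also have "\<dots> = (\<Sum>k\<in>UNIV. u (a k) *\<^sub>R a k)"
    using inj_a by (simp add: sum.reindex)
  finally show ?thesis by (intro exI[of _ "\<lambda>k. u (a k)"])
qed

lemma inner_a_eq_0_imp:
  assumes "\<And>k. y \<bullet> a k = 0" shows "y = 0"
proof -
  obtain c where c: "y = (\<Sum>k\<in>UNIV. c k *\<^sub>R a k)" using span_a by blast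
  have "y \<bullet> (\<Sum>k\<in>UNIV. c k *\<^sub>R a k) = 0" by (simp add: inner_sum_right assms)
  then show ?thesis using c by simp
qed

text \<open>The definite description is meaningful: prescribed values on the basis extend to a
  linear functional, which its adjoint represents by a vector, and a vector orthogonal to every
  \<open>a k\<close> is zero.\<close>

lemma dual_inner: "b k \<bullet> a k' = (if k = k' then 2 * pi else 0)"
proof -
  have "\<exists>v. \<forall>k'. v \<bullet> a k' = (if k = k' then 2 * pi else 0)" for k
  proof -
    obtain g :: "real^3 \<Rightarrow> real" where g: "linear g" "\<forall>x\<in>range a. g x = (if x = a k then 2 * pi else 0)"
      using linear_independent_extend[OF indep_a, of "\<lambda>x. if x = a k then 2 * pi else (0::real)"] by blast
    have "adjoint g 1 \<bullet> a k' = g (a k')" for k'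
      using adjoint_works[OF g(1), of "a k'" 1] by (simp add: inner_commute)
    then show ?thesis using g(2) inj_a by (intro exI[of _ "adjoint g 1"]) (auto simp: inj_eq)
  qed
  then obtain v where v: "\<forall>k k'. v k \<bullet> a k' = (if k = k' then 2 * pi else 0)" by metis
  have uniq: "w = v" if "\<forall>k k'. w k \<bullet> a k' = (if k = k' then 2 * pi else 0)" for w
  proof
    fix k
    have "w k - v k = 0" by (rule inner_a_eq_0_imp) (use that v in \<open>auto simp: inner_diff_left\<close>)
    then show "w k = v k" by simp
  qed
  have "dual_basis a = v" unfolding dual_basis_def
    by (rule the_equality) (rule v, erule uniq)
  then show ?thesis using v by simp
qed

text \<open>The coordinate of \<open>x\<close> along \<open>a j\<close>. Going through the dual
  basis makes linearity and continuity immediate; \<open>2 * pi\<close> cancels the normalisation of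
  \<open>b\<close>.\<close>

definition coord :: "3 \<Rightarrow> real^3 \<Rightarrow> real" where "coord j x = (b j \<bullet> x) / (2 * pi)"

lemma coord_sum [simp]: "coord j (\<Sum>k\<in>UNIV. c k *\<^sub>R a k) = c j"
  by (simp add: coord_def inner_sum_right dual_inner if_distrib sum.If_cases mult.commute cong: if_cong)

lemma coord_expand: "x = (\<Sum>k\<in>UNIV. coord k x *\<^sub>R a k)"
proof -
  obtain c where c: "x = (\<Sum>k\<in>UNIV. c k *\<^sub>R a k)" using span_a by blast
  then have "coord k x = c k" for k by simp
  show ?thesis unfolding \<open>\<And>k. coord k x = c k\<close> by (rule c)
qed

lemma coord_simps [simp]: "coord j (x + y) = coord j x + coord j y"
  "coord j (x - y) = coord j x - coord j y" "coord j 0 = 0" "coord j (- x) = - coord j x"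
  "coord j (c *\<^sub>R x) = c * coord j x"
  by (auto simp: coord_def inner_add_right inner_diff_right field_simps)

lemma coord_eqI:
  assumes "\<And>k. coord k x = coord k y" shows "x = y"
proof -
  have "x = (\<Sum>k\<in>UNIV. coord k x *\<^sub>R a k)" by (rule coord_expand)
  also have "\<dots> = (\<Sum>k\<in>UNIV. coord k y *\<^sub>R a k)" by (simp only: assms)
  also have "\<dots> = y" by (rule coord_expand[symmetric])
  finally show ?thesis .
qed

lemma continuous_coord [continuous_intros]: "continuous_on S (coord j)"
  unfolding coord_def by (intro continuous_intros) auto

lemma lattice_iff: "x \<in> lattice a \<longleftrightarrow> (\<forall>j. coord j x \<in> \<int>)"
proof
  assume "x \<in> lattice a"
  then obtain n :: "3 \<Rightarrow> int" where "x = (\<Sum>k\<in>UNIV. of_int (n k) *\<^sub>R a k)" unfolding lattice_def by blast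
  then show "\<forall>j. coord j x \<in> \<int>" by simp
next
  assume *: "\<forall>j. coord j x \<in> \<int>"
  then have "\<forall>j. \<exists>n::int. coord j x = of_int n" by (meson Ints_cases)
  then obtain n :: "3 \<Rightarrow> int" where n: "\<And>j. coord j x = of_int (n j)" by metis
  have "x = (\<Sum>k\<in>UNIV. of_int (n k) *\<^sub>R a k)"
    by (rule coord_eqI) (simp add: n)
  then show "x \<in> lattice a" unfolding lattice_def by blast
qed

lemma cell_iff: "x \<in> cell a \<longleftrightarrow> (\<forall>j. 0 \<le> coord j x \<and> coord j x < 1)"
proof
  assume "x \<in> cell a"
  then show "\<forall>j. 0 \<le> coord j x \<and> coord j x < 1" unfolding cell_def by auto
next
  assume *: "\<forall>j. 0 \<le> coord j x \<and> coord j x < 1"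
  then show "x \<in> cell a" unfolding cell_def
    by (intro CollectI exI[of _ "\<lambda>k. coord k x"] conjI coord_expand) auto
qed

lemma lattice_closed: "0 \<in> lattice a" "g \<in> lattice a \<Longrightarrow> h \<in> lattice a \<Longrightarrow> g + h \<in> lattice a"
  "g \<in> lattice a \<Longrightarrow> h \<in> lattice a \<Longrightarrow> g - h \<in> lattice a" "g \<in> lattice a \<Longrightarrow> - g \<in> lattice a"
  by (auto simp: lattice_iff)

lemma countable_lattice: "countable (lattice (c :: 3 \<Rightarrow> real^3))"
proof -
  have "countable (UNIV :: (3 \<Rightarrow> int) set)"
    using countable_PiE[of "UNIV :: 3 set" "\<lambda>_. UNIV :: int set"] by (simp add: PiE_UNIV_domain Pi_def)
  moreover have "lattice c = (\<lambda>n. \<Sum>k\<in>UNIV. of_int (n k) *\<^sub>R c k) ` UNIV" unfolding lattice_def by auto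
  ultimately show ?thesis by simp
qed

definition reduce :: "real^3 \<Rightarrow> real^3" where
  "reduce x = (\<Sum>k\<in>UNIV. frac (coord k x) *\<^sub>R a k)"

lemma reduce_cell [simp]: "reduce x \<in> cell a"
  unfolding reduce_def cell_iff by (simp add: frac_lt_1)

lemma reduce_diff [simp]: "x - reduce x \<in> lattice a"
  unfolding lattice_iff reduce_def by (simp add: frac_def)

lemma reduce_unique: "y \<in> cell a \<Longrightarrow> x - y \<in> lattice a \<Longrightarrow> reduce x = y"
proof (rule coord_eqI)
  fix k assume y: "y \<in> cell a" "x - y \<in> lattice a"
  then obtain n :: int where n: "coord k x - coord k y = of_int n"
    using lattice_iff[of "x - y"] by (metis Ints_cases coord_simps(2))
  have "0 \<le> coord k y" "coord k y < 1" using y cell_iff by auto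
  then have "frac (coord k x) = coord k y" using n
    by (subst frac_unique_iff) (auto simp: algebra_simps)
  then show "coord k (reduce x) = coord k y" by (simp add: reduce_def)
qed

lemma reduce_id [simp]: "x \<in> cell a \<Longrightarrow> reduce x = x"
  by (rule reduce_unique) (auto simp: lattice_closed)

lemma periodic_reduce: "periodic a f \<Longrightarrow> f (reduce x) = f x"
  unfolding periodic_def using reduce_diff[of x] by (metis add.commute diff_add_cancel)

section \<open>Dual lattice and its characters\<close>

lemma dual_expand: "k = (\<Sum>j\<in>UNIV. ((k \<bullet> a j) / (2 * pi)) *\<^sub>R b j)"
proof -
  have "k - (\<Sum>j\<in>UNIV. ((k \<bullet> a j) / (2 * pi)) *\<^sub>R b j) = 0"
    by (rule inner_a_eq_0_imp)
      (simp add: inner_diff_left inner_sum_left dual_inner if_distrib sum.If_cases cong: if_cong)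
  then show ?thesis by simp
qed

lemma sum_b_inner_a [simp]: "(\<Sum>j\<in>UNIV. c j *\<^sub>R b j) \<bullet> a i = 2 * pi * c i"
  by (simp add: inner_sum_left dual_inner if_distrib sum.If_cases cong: if_cong)

lemma Q_iff: "k \<in> Q \<longleftrightarrow> (\<forall>j. (k \<bullet> a j) / (2 * pi) \<in> \<int>)"
proof
  assume "k \<in> Q"
  then obtain n :: "3 \<Rightarrow> int" where "k = (\<Sum>j\<in>UNIV. of_int (n j) *\<^sub>R b j)" unfolding lattice_def by blast
  then show "\<forall>j. (k \<bullet> a j) / (2 * pi) \<in> \<int>" by simp
next
  assume *: "\<forall>j. (k \<bullet> a j) / (2 * pi) \<in> \<int>"
  then have "\<forall>j. \<exists>n::int. (k \<bullet> a j) / (2 * pi) = of_int n" by (meson Ints_cases)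
  then obtain n :: "3 \<Rightarrow> int" where "\<And>j. (k \<bullet> a j) / (2 * pi) = of_int (n j)" by metis
  then have "k = (\<Sum>j\<in>UNIV. of_int (n j) *\<^sub>R b j)" by (subst dual_expand) simp
  then show "k \<in> Q" unfolding lattice_def by blast
qed

lemma Q_closed: "0 \<in> Q" "k \<in> Q \<Longrightarrow> l \<in> Q \<Longrightarrow> k + l \<in> Q" "k \<in> Q \<Longrightarrow> l \<in> Q \<Longrightarrow> k - l \<in> Q" "k \<in> Q \<Longrightarrow> - k \<in> Q"
  by (auto simp: Q_iff inner_add_left inner_diff_left add_divide_distrib diff_divide_distrib)

lemma b_in_Q: "b j \<in> Q"
  by (auto simp: Q_iff dual_inner)

lemma Q_inner_lattice:
  assumes "k \<in> Q" "g \<in> lattice a" shows "\<exists>n::int. k \<bullet> g = 2 * pi * of_int n"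
proof -
  have "k \<bullet> g = 2 * pi * (\<Sum>j\<in>UNIV. (k \<bullet> a j / (2 * pi)) * coord j g)"
    by (subst coord_expand[of g]) (simp add: inner_sum_right sum_distrib_left mult.commute)
  moreover have "(\<Sum>j\<in>UNIV. (k \<bullet> a j / (2 * pi)) * coord j g) \<in> \<int>"
    using assms by (intro Ints_sum Ints_mult) (auto simp: Q_iff lattice_iff)
  ultimately show ?thesis by (auto elim: Ints_cases)
qed

lemma cis_2pi_int: "cis (2 * pi * of_int n) = 1"
  by (simp add: cis.ctr complex_eq_iff)

lemma cis_periodic: "k \<in> Q \<Longrightarrow> g \<in> lattice a \<Longrightarrow> cis (k \<bullet> (x + g)) = cis (k \<bullet> x)"
  using Q_inner_lattice[of k g] by (auto simp: inner_add_right cis_2pi_int simp flip: cis_mult)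

lemma periodic_cis: "k \<in> Q \<Longrightarrow> periodic a (\<lambda>x. cis (k \<bullet> x))"
  by (simp add: periodic_def cis_periodic)

text \<open>Equal phases at \<open>b j\<close> mean that the \<open>j\<close>-th coordinates differ
  by an integer. Three characters therefore separate the points of the torus, which makes
  \<open>toral\<close> injective modulo the lattice.\<close>

lemma cis_b_separates:
  assumes "\<And>j. cis (b j \<bullet> x) = cis (b j \<bullet> y)" shows "x - y \<in> lattice a"
  unfolding lattice_iff
proof
  fix j
  have "cis (b j \<bullet> (x - y)) = 1"
    using assms[of j] by (simp add: inner_diff_right flip: cis_divide)
  then have "cos (b j \<bullet> (x - y)) = 1" by (metis cis.simps(1) one_complex.simps(1))
  then obtain n :: int where "b j \<bullet> (x - y) = of_int n * 2 * pi" using cos_one_2pi_int by blast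
  then show "coord j (x - y) \<in> \<int>" by (simp add: coord_def)
qed

section \<open>Measure and volume of the cell\<close>

lemma borel_cell [measurable]: "cell a \<in> sets borel"
proof -
  have "cell a = (\<Inter>j\<in>UNIV. {x. 0 \<le> coord j x} \<inter> {x. coord j x < 1})"
    by (auto simp: cell_iff)
  also have "\<dots> \<in> sets borel"
    by (intro sets.finite_INT sets.Int borel_closed borel_open closed_Collect_le open_Collect_less continuous_intros) auto
  finally show ?thesis .
qed

lemma cell_lebesgue [measurable, simp]: "cell a \<in> sets lebesgue"
  using borel_cell by simp


text \<open>The half-open cell is not compact, so bounds for continuous periodic functions are taken
  on its closure.\<close>

definition ccell :: "(real^3) set" where "ccell = {x. \<forall>j. 0 \<le> coord j x \<and> coord j x \<le> 1}"

lemma cell_subset_ccell: "cell a \<subseteq> ccell"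
  by (auto simp: cell_iff ccell_def less_imp_le)

lemma compact_ccell: "compact ccell"
proof -
  have "ccell = (\<lambda>t::real^3. \<Sum>k\<in>UNIV. (t $ k) *\<^sub>R a k) ` cbox 0 1"
  proof (intro equalityI subsetI)
    fix x assume "x \<in> ccell"
    then show "x \<in> (\<lambda>t::real^3. \<Sum>k\<in>UNIV. (t $ k) *\<^sub>R a k) ` cbox 0 1"
      by (intro image_eqI[of _ _ "\<chi> k. coord k x"])
        (auto simp: ccell_def mem_box_cart intro: coord_eqI)
  qed (auto simp: ccell_def mem_box_cart)
  moreover have "continuous_on (cbox 0 1) (\<lambda>t::real^3. \<Sum>k\<in>UNIV. (t $ k) *\<^sub>R a k)"
    by (intro continuous_intros)
  ultimately show ?thesis by (simp only: compact_continuous_image compact_cbox)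
qed

lemma bounded_cell: "bounded (cell a)"
  using bounded_subset[OF compact_imp_bounded[OF compact_ccell] cell_subset_ccell] .

lemma lmeasurable_cell [simp]: "cell a \<in> lmeasurable"
  using bounded_cell cell_lebesgue by (rule bounded_set_imp_lmeasurable)

definition V :: real where "V = measure lebesgue (cell a)"

lemma V_pos: "V > 0"
proof -
  let ?U = "{x. \<forall>j. 0 < coord j x \<and> coord j x < 1}"
  have "?U = (\<Inter>j\<in>UNIV. {x. 0 < coord j x} \<inter> {x. coord j x < 1})" by auto
  moreover have "open \<dots>"
    by (intro open_INT ballI open_Int open_Collect_less continuous_intros) auto
  ultimately have "open ?U" by simp
  moreover have "(\<Sum>k\<in>UNIV. (1/2) *\<^sub>R a k) \<in> ?U" by simp
  ultimately have "\<not> negligible ?U" using open_not_negligible by blast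
  moreover have "?U \<subseteq> cell a" by (auto simp: cell_iff less_imp_le)
  ultimately have "\<not> negligible (cell a)" using negligible_subset by blast
  then show ?thesis unfolding V_def using negligible_iff_measure0[OF lmeasurable_cell]
    by (simp add: zero_less_measure_iff)
qed

section \<open>Summation over the dual lattice\<close>

lemma b_nonzero: "b j \<noteq> 0"
  using dual_inner[of j j] by auto

lemma infinite_Q: "infinite Q"
proof
  assume "finite Q"
  moreover have "(\<lambda>n::nat. of_nat n *\<^sub>R b 1) ` UNIV \<subseteq> Q"
    by (auto simp: Q_iff dual_inner)
  ultimately have "finite ((\<lambda>n::nat. of_nat n *\<^sub>R b 1) ` UNIV)" using finite_subset by blast
  moreover have "inj (\<lambda>n::nat. of_nat n *\<^sub>R b 1)" using b_nonzero by (auto intro: injI)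
  ultimately show False using finite_imageD by blast
qed

text \<open>The exponent is chosen for dimension three: the terms decay like the power
  \<open>-(4/3)\<close> of n, still summable, while a product of three such factors has total
  exponent \<open>-2\<close>, as in \<open>summable_Q_weight\<close>.\<close>

lemma summable_int_weight: "(\<lambda>n::int. (1 + (real_of_int n)\<^sup>2) powr (-(2/3))) summable_on UNIV"
proof -
  let ?h = "\<lambda>x::real. (1 + x\<^sup>2) powr (-(2/3))"
  have s: "summable (\<lambda>n. ?h (real n))"
  proof (rule summable_comparison_test')
    show "summable (\<lambda>n. real n powr (-(4/3)))" by (simp add: summable_real_powr_iff)
    show "norm (?h (real n)) \<le> real n powr (-(4/3))" if "n \<ge> 1" for n
    proof -
      have "?h (real n) \<le> ((real n)\<^sup>2) powr (-(2/3))"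
        using that by (intro powr_mono2') auto
      also have "\<dots> = real n powr (-(4/3))"
        using that by (simp add: powr_powr flip: powr_numeral)
      finally show ?thesis by simp
    qed
  qed
  then have n: "(\<lambda>n. ?h (real n)) summable_on UNIV"
    by (intro norm_summable_imp_summable_on) simp
  have "(\<lambda>n::int. ?h (real_of_int n)) summable_on (range int)"
    by (subst summable_on_reindex) (use n in \<open>auto simp: o_def\<close>)
  moreover have "(\<lambda>n::int. ?h (real_of_int n)) summable_on (range (\<lambda>n. - int n))"
    by (subst summable_on_reindex) (use n in \<open>auto simp: o_def inj_def\<close>)
  ultimately have "(\<lambda>n::int. ?h (real_of_int n)) summable_on (range int \<union> range (\<lambda>n. - int n))"
    by (rule summable_on_union)
  moreover have "range int \<union> range (\<lambda>n. - int n) = UNIV"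
  proof -
    have "x \<in> range int \<union> range (\<lambda>n. - int n)" for x :: int
      by (cases x rule: int_cases2) auto
    then show ?thesis by blast
  qed
  ultimately show ?thesis by simp
qed

lemma summable_times_real:
  fixes f :: "'a \<Rightarrow> real" and g :: "'b \<Rightarrow> real"
  assumes f: "f summable_on A" "\<And>x. x \<in> A \<Longrightarrow> f x \<ge> 0" and g: "g summable_on B" "\<And>x. x \<in> B \<Longrightarrow> g x \<ge> 0"
  shows "(\<lambda>(x, y). f x * g y) summable_on (A \<times> B)"
proof (rule nonneg_bdd_above_summable_on)
  show "bdd_above (sum (\<lambda>(x, y). f x * g y) ` {F. F \<subseteq> A \<times> B \<and> finite F})"
  proof (rule bdd_aboveI2)
    fix F assume "F \<in> {F. F \<subseteq> A \<times> B \<and> finite F}"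
    then have F: "F \<subseteq> A \<times> B" "finite F" by auto
    have "(\<Sum>(x, y)\<in>F. f x * g y) \<le> (\<Sum>(x, y)\<in>fst ` F \<times> snd ` F. f x * g y)"
      using F by (intro sum_mono2) (auto simp: f g intro!: mult_nonneg_nonneg rev_image_eqI)
    also have "\<dots> = sum f (fst ` F) * sum g (snd ` F)"
      by (simp add: sum_product sum.cartesian_product)
    also have "\<dots> \<le> infsum f A * infsum g B"
      using F by (intro mult_mono finite_sum_le_infsum sum_nonneg infsum_nonneg) (auto simp: f g)
    finally show "(\<Sum>(x, y)\<in>F. f x * g y) \<le> infsum f A * infsum g B" .
  qed
qed (auto simp: f g)

text \<open>Integer coordinates embed \<open>Q\<close> into triples of integers. Each coordinate is
  controlled by |k|, so the weight is at most a constant times a product of three one-dimensional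
  weights.\<close>

lemma summable_Q_weight: "(\<lambda>k. 1 / (1 + k \<bullet> k)\<^sup>2) summable_on Q"
proof -
  \<comment> \<open>\<open>C\<close> absorbs the Cauchy--Schwarz constants of all three
    directions.\<close>
  define C where "C = 1 + (\<Sum>j\<in>UNIV. (norm (a j))\<^sup>2)"
  \<comment> \<open>On \<open>Q\<close> the floor is exact; it only serves to make the coordinate
    integer valued.\<close>
  define n where "n j k = \<lfloor>(k \<bullet> a j) / (2 * pi)\<rfloor>" for j k
  define h where "h = (\<lambda>n::int. (1 + (real_of_int n)\<^sup>2) powr (-(2/3)))"
  have n: "real_of_int (n j k) = (k \<bullet> a j) / (2 * pi)" if "k \<in> Q" for j k
    using that unfolding Q_iff n_def by (auto elim!: allE[of _ j] Ints_cases)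
  have C: "C \<ge> 1" unfolding C_def by (simp add: sum_nonneg)
  have bound: "1 + (real_of_int (n j k))\<^sup>2 \<le> C * (1 + k \<bullet> k)" if "k \<in> Q" for j k
  proof -
    have "(k \<bullet> a j / (2 * pi))\<^sup>2 \<le> (k \<bullet> a j)\<^sup>2"
    proof -
      have "1 \<le> (2 * pi)\<^sup>2" using pi_gt3 by (intro one_le_power) auto
      then have "(k \<bullet> a j)\<^sup>2 / (2 * pi)\<^sup>2 \<le> (k \<bullet> a j)\<^sup>2 / 1" by (intro divide_left_mono) auto
      then show ?thesis by (simp add: power_divide)
    qed
    also have "\<dots> \<le> (k \<bullet> k) * (a j \<bullet> a j)" by (rule Cauchy_Schwarz_ineq)
    also have "\<dots> \<le> (k \<bullet> k) * (\<Sum>j\<in>UNIV. (norm (a j))\<^sup>2)"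
      by (intro mult_left_mono) (auto simp: dot_square_norm intro!: member_le_sum)
    finally show ?thesis using that
      by (simp add: n C_def algebra_simps add_increasing add_increasing2 sum_nonneg)
  qed
  have "(\<lambda>(x, y, z). h x * (h y * h z)) summable_on (UNIV \<times> (UNIV \<times> UNIV))"
    using summable_times_real[OF summable_int_weight _ summable_times_real[OF summable_int_weight _ summable_int_weight]]
    by (simp add: h_def case_prod_unfold)
  then have "(\<lambda>(x, y, z). h x * (h y * h z)) summable_on ((\<lambda>k. (n 1 k, n 2 k, n 3 k)) ` Q)"
    by (rule summable_on_subset_banach) auto
  moreover have "inj_on (\<lambda>k. (n 1 k, n 2 k, n 3 k)) Q"
  proof
    fix k l assume kl: "k \<in> Q" "l \<in> Q" "(n 1 k, n 2 k, n 3 k) = (n 1 l, n 2 l, n 3 l)"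
    have "(k - l) \<bullet> a j = 0" for j
    proof -
      have "n j k = n j l" using kl(3) exhaust_3[of j] by auto
      then have "(k \<bullet> a j) / (2 * pi) = (l \<bullet> a j) / (2 * pi)" using n kl by metis
      then show ?thesis by (simp add: inner_diff_left)
    qed
    then show "k = l" using inner_a_eq_0_imp[of "k - l"] by simp
  qed
  ultimately have s: "(\<lambda>k. h (n 1 k) * (h (n 2 k) * h (n 3 k))) summable_on Q"
    by (subst (asm) summable_on_reindex) (auto simp: o_def)
  have "(\<lambda>k. C\<^sup>2 * (h (n 1 k) * (h (n 2 k) * h (n 3 k)))) summable_on Q"
    by (rule summable_on_cmult_right[OF s])
  then show ?thesis
  proof (rule summable_on_comparison_test)
    fix k assume k: "k \<in> Q"
    let ?w = "1 + k \<bullet> k"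
    have w: "?w \<ge> 1" by simp
    have "(C * ?w) powr (-(2/3)) \<le> h (n j k)" for j
      unfolding h_def using bound[OF k, of j] C w by (intro powr_mono2') (auto intro: add_pos_nonneg)
    then have "(C * ?w) powr (-(2/3)) * ((C * ?w) powr (-(2/3)) * (C * ?w) powr (-(2/3))) \<le> h (n 1 k) * (h (n 2 k) * h (n 3 k))"
      by (intro mult_mono) (auto simp: h_def)
    also have "(C * ?w) powr (-(2/3)) * ((C * ?w) powr (-(2/3)) * (C * ?w) powr (-(2/3))) = (C * ?w) powr (-2)"
      by (simp flip: powr_add)
    also have "\<dots> = 1 / (C * ?w)\<^sup>2" using C w by (simp add: powr_minus_divide powr_numeral)
    finally have "C\<^sup>2 * (1 / (C * ?w)\<^sup>2) \<le> C\<^sup>2 * (h (n 1 k) * (h (n 2 k) * h (n 3 k)))"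
      by (intro mult_left_mono) auto
    also have "C\<^sup>2 * (1 / (C * ?w)\<^sup>2) = 1 / ?w\<^sup>2" using C by (simp add: power_mult_distrib)
    finally show "1 / ?w\<^sup>2 \<le> C\<^sup>2 * (h (n 1 k) * (h (n 2 k) * h (n 3 k)))" .
  qed simp
qed

section \<open>Integration over the cell\<close>

abbreviation M :: "(real^3) measure" where "M \<equiv> lebesgue_on (cell a)"

lemma finite_M: "finite_measure M"
  by (rule finite_measure_lebesgue_on) simp

lemma measure_M: "measure M (cell a) = V"
  by (simp add: V_def measure_restrict_space)

lemma borel_measurable_M: "f \<in> borel_measurable lebesgue \<Longrightarrow> f \<in> borel_measurable M"
  by (rule measurable_restrict_space1)

section \<open>Translation invariance of integrals over the torus\<close>

lemma measurable_translate: "(\<lambda>x. x + y) \<in> lebesgue \<rightarrow>\<^sub>M (lebesgue :: (real^3) measure)"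
  using lebesgue_affine_measurable[of "\<lambda>_. 1" y] by (simp add: euclidean_representation add.commute)

lemma emeasure_translate: "emeasure lebesgue ((\<lambda>x. x + y) ` S) = emeasure lebesgue (S :: (real^3) set)"
  using emeasure_lebesgue_affine[of 1 y S] by simp

lemma sets_translate: "S \<in> sets lebesgue \<Longrightarrow> (\<lambda>x. x + y) ` S \<in> sets (lebesgue :: (real^3) measure)"
  using lebesgue_sets_translation[of S y] by (simp add: add.commute)

text \<open>The shifted cell is cut into countably many pieces according to the lattice vector that
  brings each piece back. Every piece moves rigidly and the images tile the cell, so countable
  additivity and translation invariance of Lebesgue measure suffice.\<close>

lemma distr_reduce:
  shows measurable_reduce: "(\<lambda>x. reduce (x + y)) \<in> M \<rightarrow>\<^sub>M M"
    and "distr M M (\<lambda>x. reduce (x + y)) = M"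
proof -
  define T where "T = (\<lambda>x. reduce (x + y))"
  \<comment> \<open>\<open>X A g\<close> holds the points of the cell that land in \<open>A\<close>
    when \<open>g\<close> is subtracted after the shift; \<open>Y A g\<close> holds their
    images.\<close>
  define X where "X A g = {x \<in> cell a. x + y - g \<in> A}" for A g
  define Y where "Y A g = {z \<in> A. z - y + g \<in> cell a}" for A g
  have XY: "X A g = (\<lambda>z. z + (g - y)) ` Y A g" for A g
    unfolding X_def Y_def by (auto intro!: image_eqI[of _ _ "_ + y - g"] simp: algebra_simps)
  have sY: "Y A g \<in> sets lebesgue" if "A \<in> sets lebesgue" for A g
  proof -
    have "Y A g = A \<inter> (\<lambda>z. z + (y - g)) ` cell a"
      unfolding Y_def by (auto intro!: image_eqI[of _ _ "_ - y + g"] simp: algebra_simps)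
    then show ?thesis using that sets_translate[OF cell_lebesgue] by auto
  qed
  have sX: "X A g \<in> sets lebesgue" if "A \<in> sets lebesgue" for A g
    unfolding XY using sets_translate sY that by blast
  have eXY: "emeasure lebesgue (X A g) = emeasure lebesgue (Y A g)" for A g
    unfolding XY by (rule emeasure_translate)
  have TA: "T -` A \<inter> cell a = (\<Union>g\<in>lattice a. X A g)" if "A \<subseteq> cell a" for A
  proof (intro equalityI subsetI)
    fix x assume "x \<in> T -` A \<inter> cell a"
    then have "x \<in> X A (x + y - reduce (x + y))" by (auto simp: X_def T_def)
    then show "x \<in> (\<Union>g\<in>lattice a. X A g)" using reduce_diff by blast
  next
    fix x assume "x \<in> (\<Union>g\<in>lattice a. X A g)"
    then obtain g where g: "g \<in> lattice a" "x \<in> cell a" "x + y - g \<in> A" by (auto simp: X_def)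
    then have "reduce (x + y) = x + y - g" using that by (intro reduce_unique) auto
    then show "x \<in> T -` A \<inter> cell a" using g by (auto simp: T_def)
  qed
  have AY: "A = (\<Union>g\<in>lattice a. Y A g)" if "A \<subseteq> cell a" for A
  proof (intro equalityI subsetI)
    fix z assume "z \<in> A"
    have "reduce (z - y) - (z - y) \<in> lattice a" using lattice_closed(4)[OF reduce_diff[of "z - y"]] by simp
    moreover have "z \<in> Y A (reduce (z - y) - (z - y))" using \<open>z \<in> A\<close> by (simp add: Y_def)
    ultimately show "z \<in> (\<Union>g\<in>lattice a. Y A g)" by blast
  qed (auto simp: Y_def)
  have dX: "disjoint_family_on (X A) (lattice a)" if "A \<subseteq> cell a" for A
    unfolding disjoint_family_on_def
  proof (intro ballI impI, rule ccontr)
    fix g h assume gh: "g \<in> lattice a" "h \<in> lattice a" "g \<noteq> h" "X A g \<inter> X A h \<noteq> {}"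
    then obtain x where "x + y - g \<in> A" "x + y - h \<in> A" by (auto simp: X_def)
    then have "reduce (x + y) = x + y - g" "reduce (x + y) = x + y - h"
      using that gh by (auto intro!: reduce_unique)
    then show False using gh by simp
  qed
  have dY: "disjoint_family_on (Y A) (lattice a)" for A
    unfolding disjoint_family_on_def
  proof (intro ballI impI, rule ccontr)
    fix g h assume gh: "g \<in> lattice a" "h \<in> lattice a" "g \<noteq> h" "Y A g \<inter> Y A h \<noteq> {}"
    then obtain z where z: "z - y + g \<in> cell a" "z - y + h \<in> cell a" by (auto simp: Y_def)
    have "reduce (z - y) = z - y + g" "reduce (z - y) = z - y + h"
      using z gh lattice_closed(4) by (auto intro!: reduce_unique)
    then show False using gh by simp
  qed
  have sM: "A \<subseteq> cell a \<and> A \<in> sets lebesgue" if "A \<in> sets M" for A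
    using that by (auto simp: sets_restrict_space)
  have Msets: "A \<in> sets M" if "A \<subseteq> cell a" "A \<in> sets lebesgue" for A
    using that by (auto simp: sets_restrict_space)
  have sT: "T -` A \<inter> cell a \<in> sets M" if "A \<in> sets M" for A
  proof (rule Msets)
    show "T -` A \<inter> cell a \<in> sets lebesgue"
      using sM[OF that] by (subst TA) (auto intro!: sets.countable_UN' countable_lattice sX)
  qed auto
  have mT: "T \<in> M \<rightarrow>\<^sub>M M"
    by (rule measurableI) (use sT in \<open>auto simp: T_def\<close>)
  then show "(\<lambda>x. reduce (x + y)) \<in> M \<rightarrow>\<^sub>M M" by (simp add: T_def)
  have "distr M M T = M"
  proof (rule measure_eqI)
    fix A assume "A \<in> sets (distr M M T)"
    then have A: "A \<in> sets M" by simp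
    note A' = sM[OF A]
    have "emeasure (distr M M T) A = emeasure M (T -` A \<inter> cell a)"
      using mT A by (simp add: emeasure_distr)
    also have "\<dots> = emeasure lebesgue (T -` A \<inter> cell a)"
      by (simp add: emeasure_restrict_space)
    also have "\<dots> = emeasure lebesgue (\<Union>g\<in>lattice a. X A g)" using A' by (simp add: TA)
    also have "\<dots> = (\<integral>\<^sup>+g. emeasure lebesgue (X A g) \<partial>count_space (lattice a))"
      using A' by (intro emeasure_UN_countable sX countable_lattice dX) auto
    also have "\<dots> = (\<integral>\<^sup>+g. emeasure lebesgue (Y A g) \<partial>count_space (lattice a))"
      by (simp add: eXY)
    also have "\<dots> = emeasure lebesgue (\<Union>g\<in>lattice a. Y A g)"
      using A' by (intro emeasure_UN_countable[symmetric] sY countable_lattice dY) auto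
    also have "\<dots> = emeasure M A" using A' AY[of A] by (simp add: emeasure_restrict_space)
    finally show "emeasure (distr M M T) A = emeasure M A" .
  qed simp
  then show "distr M M (\<lambda>x. reduce (x + y)) = M" by (simp add: T_def)
qed

lemma integral_translate:
  fixes f :: "real^3 \<Rightarrow> 'b::{banach, second_countable_topology}"
  assumes "periodic a f" "f \<in> borel_measurable M"
  shows "(LINT x|M. f (x + y)) = (LINT x|M. f x)"
proof -
  have "(LINT x|M. f x) = (LINT x|distr M M (\<lambda>x. reduce (x + y)). f x)" by (simp add: distr_reduce)
  also have "\<dots> = (LINT x|M. f (reduce (x + y)))"
    by (rule integral_distr[OF measurable_reduce assms(2)])
  finally show ?thesis using periodic_reduce[OF assms(1)] by simp
qed

lemma integrable_translate:
  fixes f :: "real^3 \<Rightarrow> 'b::{banach, second_countable_topology}"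
  assumes "periodic a f" "integrable M f"
  shows "integrable M (\<lambda>x. f (x + y))"
proof -
  have "integrable (distr M M (\<lambda>x. reduce (x + y))) f" using assms by (simp add: distr_reduce)
  then have "integrable M (\<lambda>x. f (reduce (x + y)))"
    using integrable_distr[OF measurable_reduce] by blast
  then show ?thesis using periodic_reduce[OF assms(1)] by simp
qed

text \<open>A null set in the cell has only countably many lattice translates, and these cover the
  exceptional set in the whole space.\<close>

lemma AE_periodic:
  assumes P: "\<And>g x. g \<in> lattice a \<Longrightarrow> P (x + g) \<longleftrightarrow> P x" and ae: "AE x in M. P x"
  shows "AE x in lebesgue. P x"
proof -
  have "AE x in lebesgue. x \<in> cell a \<longrightarrow> P x"
    using ae by (subst (asm) AE_restrict_space_iff) auto
  then obtain N where N: "N \<in> null_sets lebesgue" "{x. \<not> (x \<in> cell a \<longrightarrow> P x)} \<subseteq> N"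
    by (auto simp: eventually_ae_filter)
  have "(\<Union>g\<in>lattice a. (+) g ` N) \<in> null_sets lebesgue"
    using N negligible_translation[of N] by (intro null_sets_UN' countable_lattice) (auto simp: negligible_iff_null_sets)
  moreover have "{x. \<not> P x} \<subseteq> (\<Union>g\<in>lattice a. (+) g ` N)"
  proof
    fix x assume "x \<in> {x. \<not> P x}"
    then have "\<not> P (reduce x)" using P[OF reduce_diff[of x], of "reduce x"] by simp
    then have "reduce x \<in> N" using N by auto
    then have "x \<in> (+) (x - reduce x) ` N" by (intro image_eqI[of _ _ "reduce x"]) auto
    then show "x \<in> (\<Union>g\<in>lattice a. (+) g ` N)" using reduce_diff by blast
  qed
  ultimately show ?thesis by (auto simp: eventually_ae_filter)
qed

lemma AE_M_cell: "(\<And>x. x \<in> cell a \<Longrightarrow> P x) \<Longrightarrow> AE x in M. P x"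
  by (rule AE_I2) simp

lemma integrable_M_bounded:
  fixes f :: "real^3 \<Rightarrow> 'b::{banach, second_countable_topology}"
  assumes "f \<in> borel_measurable M" "\<And>x. norm (f x) \<le> B"
  shows "integrable M f"
proof -
  interpret finite_measure M by (rule finite_M)
  show ?thesis by (rule integrable_const_bound[of _ B]) (use assms in auto)
qed

lemma integral_const_M: "(LINT x|M. c) = V *\<^sub>R (c :: 'b::{banach, second_countable_topology})"
proof -
  interpret finite_measure M by (rule finite_M)
  show ?thesis by (simp add: measure_M)
qed

section \<open>Lebesgue spaces of periodic functions\<close>

lemma Lp1_iff_aux: "f \<in> Lp a 1 \<longleftrightarrow> periodic a f \<and> f \<in> borel_measurable lebesgue \<and> integrable M f"
  for f :: "real^3 \<Rightarrow> 'b::{banach, second_countable_topology}"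
  unfolding Lp_def by (auto simp: integrable_norm_iff borel_measurable_M)

lemmas Lp1_iff = Lp1_iff_aux Lp1_iff_aux[unfolded One_nat_def]

lemma Lp2_iff: "f \<in> Lp a 2 \<longleftrightarrow> periodic a f \<and> f \<in> borel_measurable lebesgue \<and> integrable M (\<lambda>x. (norm (f x))\<^sup>2)"
  by (simp add: Lp_def)

lemma Lp1D:
  fixes f :: "real^3 \<Rightarrow> 'b::{banach, second_countable_topology}"
  assumes "f \<in> Lp a 1"
  shows "periodic a f" "f \<in> borel_measurable lebesgue" "f \<in> borel_measurable M" "integrable M f"
  using assms borel_measurable_M by (auto simp: Lp1_iff)

lemma Lp2_imp_Lp1:
  fixes f :: "real^3 \<Rightarrow> 'b::{banach, second_countable_topology}"
  assumes "f \<in> Lp a 2" shows "f \<in> Lp a 1"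
proof -
  interpret finite_measure M by (rule finite_M)
  have "integrable M f"
  proof (rule Bochner_Integration.integrable_bound)
    show "integrable M (\<lambda>x. 1 + (norm (f x))\<^sup>2)" using assms by (auto simp: Lp2_iff)
    show "f \<in> borel_measurable M" using assms borel_measurable_M by (auto simp: Lp2_iff)
    show "AE x in M. norm (f x) \<le> norm (1 + (norm (f x))\<^sup>2)" by (auto simp: add_nonneg_nonneg le_one_plus_square)
  qed
  then show ?thesis using assms by (auto simp: Lp1_iff Lp2_iff)
qed

lemma Lp2D:
  fixes f :: "real^3 \<Rightarrow> 'b::{banach, second_countable_topology}"
  assumes "f \<in> Lp a 2"
  shows "periodic a f" "f \<in> borel_measurable lebesgue" "f \<in> borel_measurable M" "integrable M f"
    "integrable M (\<lambda>x. (norm (f x))\<^sup>2)"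
  using assms borel_measurable_M Lp2_imp_Lp1[OF assms] by (auto simp: Lp1_iff Lp2_iff)

lemma Lp1_mult_bounded:
  fixes f g :: "real^3 \<Rightarrow> complex"
  assumes f: "f \<in> Lp a 1" and g: "periodic a g" "g \<in> borel_measurable lebesgue" "\<And>x. norm (g x) \<le> B"
  shows "(\<lambda>x. f x * g x) \<in> Lp a 1"
proof -
  note [measurable] = Lp1D(2,3)[OF f] g(2) borel_measurable_M[OF g(2)]
  have "integrable M (\<lambda>x. f x * g x)"
  proof (rule Bochner_Integration.integrable_bound)
    show "integrable M (\<lambda>x. B * norm (f x))" using f by (auto simp: Lp1_iff)
    have "norm (f x) * norm (g x) \<le> norm (f x) * \<bar>B\<bar>" for x
      by (rule mult_left_mono) (use g(3)[of x] in auto)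
    then show "AE x in M. norm (f x * g x) \<le> norm (B * norm (f x))"
      by (auto simp: norm_mult abs_mult mult.commute)
  qed auto
  then show ?thesis using f g by (auto simp: Lp1_iff periodic_def)
qed

lemma Lp2_mult_bounded:
  fixes f g :: "real^3 \<Rightarrow> complex"
  assumes f: "f \<in> Lp a 2" and g: "periodic a g" "g \<in> borel_measurable lebesgue" "\<And>x. norm (g x) \<le> B"
  shows "(\<lambda>x. f x * g x) \<in> Lp a 2"
proof -
  note [measurable] = Lp2D(2,3)[OF f] g(2) borel_measurable_M[OF g(2)]
  have "integrable M (\<lambda>x. (norm (f x * g x))\<^sup>2)"
  proof (rule Bochner_Integration.integrable_bound)
    show "integrable M (\<lambda>x. B\<^sup>2 * (norm (f x))\<^sup>2)" using f by (auto simp: Lp2_iff)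
    have "(norm (g x))\<^sup>2 \<le> B\<^sup>2" for x
      by (rule power_mono) (use g(3) in auto)
    then have "(norm (f x))\<^sup>2 * (norm (g x))\<^sup>2 \<le> B\<^sup>2 * (norm (f x))\<^sup>2" for x
      by (metis mult.commute mult_right_mono zero_le_power2)
    then show "AE x in M. norm ((norm (f x * g x))\<^sup>2) \<le> norm (B\<^sup>2 * (norm (f x))\<^sup>2)"
      by (auto simp: norm_mult abs_mult power_mult_distrib)
  qed auto
  then show ?thesis using f g by (auto simp: Lp2_iff periodic_def)
qed

lemma Lp2_bounded:
  fixes g :: "real^3 \<Rightarrow> complex"
  assumes g: "periodic a g" "g \<in> borel_measurable lebesgue" "\<And>x. norm (g x) \<le> B"
  shows "g \<in> Lp a 2"
proof -
  have "integrable M (\<lambda>x. (norm (g x))\<^sup>2)"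
    using borel_measurable_M[OF g(2)] power_mono[OF g(3) norm_ge_zero]
    by (intro integrable_M_bounded[of _ "B\<^sup>2"]) auto
  then show ?thesis using g by (simp add: Lp2_iff)
qed

lemma Lp2_mult_Lp2:
  fixes f g :: "real^3 \<Rightarrow> complex"
  assumes f: "f \<in> Lp a 2" and g: "g \<in> Lp a 2"
  shows "(\<lambda>x. f x * g x) \<in> Lp a 1"
proof -
  note [measurable] = Lp2D(2,3)[OF f] Lp2D(2,3)[OF g]
  have "integrable M (\<lambda>x. f x * g x)"
  proof (rule Bochner_Integration.integrable_bound)
    show "integrable M (\<lambda>x. (norm (f x))\<^sup>2 + (norm (g x))\<^sup>2)" using f g by (auto simp: Lp2_iff)
    show "AE x in M. norm (f x * g x) \<le> norm ((norm (f x))\<^sup>2 + (norm (g x))\<^sup>2)"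
      by (auto simp: norm_mult add_nonneg_nonneg mult_le_sum_squares)
  qed auto
  then show ?thesis using f g by (auto simp: Lp1_iff Lp2_iff periodic_def)
qed

lemma Lp2_add:
  fixes f g :: "real^3 \<Rightarrow> complex"
  assumes f: "f \<in> Lp a 2" and g: "g \<in> Lp a 2"
  shows "(\<lambda>x. f x + g x) \<in> Lp a 2"
proof -
  note [measurable] = Lp2D(2,3)[OF f] Lp2D(2,3)[OF g]
  have "integrable M (\<lambda>x. (norm (f x + g x))\<^sup>2)"
  proof (rule Bochner_Integration.integrable_bound)
    show "integrable M (\<lambda>x. 2 * ((norm (f x))\<^sup>2 + (norm (g x))\<^sup>2))" using f g by (auto simp: Lp2_iff)
    have "(norm (f x + g x))\<^sup>2 \<le> 2 * ((norm (f x))\<^sup>2 + (norm (g x))\<^sup>2)" for x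
    proof -
      have "(norm (f x + g x))\<^sup>2 \<le> (norm (f x) + norm (g x))\<^sup>2"
        by (intro power_mono norm_triangle_ineq) auto
      then show ?thesis using sum_squares_bound[of "norm (f x)" "norm (g x)"] by (simp add: power2_sum)
    qed
    then show "AE x in M. norm ((norm (f x + g x))\<^sup>2) \<le> norm (2 * ((norm (f x))\<^sup>2 + (norm (g x))\<^sup>2))"
      by (auto simp: add_nonneg_nonneg)
  qed auto
  then show ?thesis using f g by (auto simp: Lp2_iff periodic_def)
qed

lemma Lp2_const: "(\<lambda>x. c) \<in> Lp a 2" for c :: complex
  by (rule Lp2_bounded[of _ "norm c"]) (auto simp: periodic_def)

lemma Lp2_cmult:
  fixes f :: "real^3 \<Rightarrow> complex" shows "f \<in> Lp a 2 \<Longrightarrow> (\<lambda>x. c * f x) \<in> Lp a 2"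
  using Lp2_mult_bounded[of f "\<lambda>_. c" "norm c"] by (simp add: periodic_def mult.commute)

lemma Lp2_diff:
  fixes f g :: "real^3 \<Rightarrow> complex"
  shows "f \<in> Lp a 2 \<Longrightarrow> g \<in> Lp a 2 \<Longrightarrow> (\<lambda>x. f x - g x) \<in> Lp a 2"
  using Lp2_add[of f "\<lambda>x. (-1) * g x"] Lp2_cmult[of g "-1"] by simp

lemma Lp2_cnj: "f \<in> Lp a 2 \<Longrightarrow> (\<lambda>x. cnj (f x)) \<in> Lp a 2"
  using measurable_compose[OF _ borel_measurable_continuous_onI[of cnj], of f lebesgue]
  by (auto simp: Lp2_iff periodic_def intro!: continuous_intros)

lemma Lp2_sum:
  fixes f :: "'i \<Rightarrow> real^3 \<Rightarrow> complex"
  shows "(\<And>i. i \<in> I \<Longrightarrow> f i \<in> Lp a 2) \<Longrightarrow> (\<lambda>x. \<Sum>i\<in>I. f i x) \<in> Lp a 2"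
  by (induction I rule: infinite_finite_induct) (auto intro: Lp2_add Lp2_const)

text \<open>Promotes a given integrable function, such as a weak derivative or a density, to
  \<open>Lp a 2\<close> once it is known to agree almost everywhere with a Riesz--Fischer
  function.\<close>

lemma Lp2_cong_AE:
  fixes f g :: "real^3 \<Rightarrow> complex"
  assumes f: "f \<in> Lp a 2" and g: "g \<in> Lp a 1" and ae: "AE x in lebesgue. f x = g x"
  shows "g \<in> Lp a 2"
proof -
  have "AE x in M. f x = g x"
    using ae by (subst AE_restrict_space_iff) auto
  then have "integrable M (\<lambda>x. (norm (g x))\<^sup>2)"
    using Lp2D(5,3)[OF f] Lp1D(3)[OF g]
    by (subst integrable_cong_AE[where g = "\<lambda>x. (norm (f x))\<^sup>2"]) auto
  then show ?thesis using g by (auto simp: Lp1_iff Lp2_iff)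
qed

lemma Lp_translate:
  fixes f :: "real^3 \<Rightarrow> complex"
  assumes "f \<in> Lp a p" shows "(\<lambda>x. f (x - y)) \<in> Lp a p"
proof -
  have f: "periodic a f" "f \<in> borel_measurable lebesgue" "integrable M (\<lambda>x. norm (f x) ^ p)"
    using assms by (auto simp: Lp_def)
  have "periodic a (\<lambda>x. f (x - y))" using f(1) by (simp add: periodic_def add_diff_eq[symmetric] add.commute diff_add_eq)
  moreover have "(\<lambda>x. f (x - y)) \<in> borel_measurable lebesgue"
    using measurable_compose[OF measurable_translate[of "- y"] f(2)] by simp
  moreover have "integrable M (\<lambda>x. norm (f (x - y)) ^ p)"
    using integrable_translate[OF _ f(3), of "-y"] f(1) by (simp add: periodic_def)
  ultimately show ?thesis by (simp add: Lp_def)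
qed

end

section \<open>Fourier coefficients\<close>

text \<open>Otherwise the simplifier turns \<^term>\<open>Lp a 1\<close> into \<^term>\<open>Lp a (Suc 0)\<close>.\<close>

declare One_nat_def [simp del]

text \<open>The pointwise limits in the Riesz--Fischer argument come without a dominating function,
  so the norm bound is carried over as an inequality only.\<close>

lemma fatou_norm_square:
  fixes s :: "nat \<Rightarrow> 'a \<Rightarrow> complex"
  assumes [measurable]: "f \<in> borel_measurable N" "\<And>n. s n \<in> borel_measurable N"
    and lim: "AE x in N. (\<lambda>n. s n x) \<longlonglongrightarrow> f x"
    and int: "\<And>n. integrable N (\<lambda>x. (norm (s n x))\<^sup>2)"
    and bound: "\<And>n. (LINT x|N. (norm (s n x))\<^sup>2) \<le> B"
  shows "integrable N (\<lambda>x. (norm (f x))\<^sup>2)" "(LINT x|N. (norm (f x))\<^sup>2) \<le> B"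
proof -
  have "0 \<le> (LINT x|N. (norm (s 0 x))\<^sup>2)" by simp
  then have B: "B \<ge> 0" using bound[of 0] by linarith
  have "(\<integral>\<^sup>+x. ennreal ((norm (f x))\<^sup>2) \<partial>N) = (\<integral>\<^sup>+x. liminf (\<lambda>n. ennreal ((norm (s n x))\<^sup>2)) \<partial>N)"
  proof (rule nn_integral_cong_AE)
    show "AE x in N. ennreal ((norm (f x))\<^sup>2) = liminf (\<lambda>n. ennreal ((norm (s n x))\<^sup>2))"
      using lim
    proof eventually_elim
      case (elim x)
      then have "(\<lambda>n. ennreal ((norm (s n x))\<^sup>2)) \<longlonglongrightarrow> ennreal ((norm (f x))\<^sup>2)"
        by (intro tendsto_intros)
      then show ?case by (rule lim_imp_Liminf[OF sequentially_bot, symmetric])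
    qed
  qed
  also have "\<dots> \<le> liminf (\<lambda>n. \<integral>\<^sup>+x. ennreal ((norm (s n x))\<^sup>2) \<partial>N)"
    by (rule nn_integral_liminf) simp
  also have "\<dots> \<le> liminf (\<lambda>n::nat. ennreal B)"
    using int bound by (intro Liminf_mono always_eventually allI) (simp add: nn_integral_eq_integral ennreal_leI)
  also have "\<dots> = ennreal B" by (simp add: Liminf_const)
  finally have *: "(\<integral>\<^sup>+x. ennreal ((norm (f x))\<^sup>2) \<partial>N) \<le> ennreal B" .
  then show i: "integrable N (\<lambda>x. (norm (f x))\<^sup>2)"
    by (intro integrableI_bounded) (auto simp: le_less_trans[OF _ ennreal_less_top])
  from * show "(LINT x|N. (norm (f x))\<^sup>2) \<le> B"
    using B by (simp add: nn_integral_eq_integral[OF i] ennreal_le_iff)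
qed

context torus begin

abbreviation fc :: "(real^3 \<Rightarrow> complex) \<Rightarrow> real^3 \<Rightarrow> complex" where "fc \<equiv> fourier_coeff a"

lemma fc_eq: "fc f k = (LINT x|M. cis (k \<bullet> x) * f x) / sqrt V"
  by (simp add: fourier_coeff_def V_def)

lemma borel_measurable_cis [measurable]: "(\<lambda>x. cis (k \<bullet> x)) \<in> borel_measurable lebesgue"
  "(\<lambda>x. cis (k \<bullet> x)) \<in> borel_measurable M"
proof -
  have "(\<lambda>x::real^3. cis (k \<bullet> x)) \<in> borel_measurable borel"
    by (intro borel_measurable_continuous_onI) (intro continuous_intros)
  then show 1: "(\<lambda>x. cis (k \<bullet> x)) \<in> borel_measurable lebesgue" by (simp add: measurable_completion)
  then show "(\<lambda>x. cis (k \<bullet> x)) \<in> borel_measurable M" by (rule borel_measurable_M)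
qed

lemma Lp1_cis_mult:
  assumes "k \<in> Q" "f \<in> Lp a 1" shows "(\<lambda>x. cis (k \<bullet> x) * f x) \<in> Lp a 1"
  using Lp1_mult_bounded[OF assms(2) periodic_cis[OF assms(1)], of 1] by (simp add: mult.commute)

lemma integrable_cis_mult:
  assumes "f \<in> Lp a 1" shows "integrable M (\<lambda>x. cis (k \<bullet> x) * f x)"
proof (rule Bochner_Integration.integrable_bound)
  show "integrable M f" using Lp1D[OF assms] by simp
  note [measurable] = Lp1D(3)[OF assms]
  show "(\<lambda>x. cis (k \<bullet> x) * f x) \<in> borel_measurable M" by measurable
qed (auto simp: norm_mult)

lemma Lp2_cis: "k \<in> Q \<Longrightarrow> (\<lambda>x. cis (k \<bullet> x)) \<in> Lp a 2"
  by (rule Lp2_bounded[of _ 1]) (auto simp: periodic_cis)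

lemma Lp2_cis_minus: "k \<in> Q \<Longrightarrow> (\<lambda>x. cis (- (k \<bullet> x))) \<in> Lp a 2"
  using Lp2_cis[of "- k"] Q_closed by simp

lemma fc_add: "f \<in> Lp a 1 \<Longrightarrow> g \<in> Lp a 1 \<Longrightarrow> fc (\<lambda>x. f x + g x) k = fc f k + fc g k"
  by (simp add: fc_eq distrib_left integrable_cis_mult add_divide_distrib)

lemma fc_diff: "f \<in> Lp a 1 \<Longrightarrow> g \<in> Lp a 1 \<Longrightarrow> fc (\<lambda>x. f x - g x) k = fc f k - fc g k"
  by (simp add: fc_eq right_diff_distrib integrable_cis_mult diff_divide_distrib)

lemma fc_cmult: "fc (\<lambda>x. c * f x) k = c * fc f k"
  by (simp add: fc_eq mult.left_commute[of _ c])

lemma fc_zero [simp]: "fc (\<lambda>x. 0) k = 0"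
  by (simp add: fc_eq)

lemma fc_sum: "(\<And>i. i \<in> I \<Longrightarrow> f i \<in> Lp a 2) \<Longrightarrow> fc (\<lambda>x. \<Sum>i\<in>I. f i x) k = (\<Sum>i\<in>I. fc (f i) k)"
proof (induction I rule: infinite_finite_induct)
  case (insert i I)
  then show ?case by (simp add: fc_add Lp2_imp_Lp1 Lp2_sum)
qed simp_all

lemma fc_cnj: "fc (\<lambda>x. cnj (f x)) k = cnj (fc f (- k))"
proof -
  have "(LINT x|M. cis (k \<bullet> x) * cnj (f x)) = (LINT x|M. cnj (cis (- k \<bullet> x) * f x))"
    by (simp add: cis_cnj)
  also have "\<dots> = cnj (LINT x|M. cis (- k \<bullet> x) * f x)" by (rule Bochner_Integration.integral_cnj)
  finally show ?thesis by (simp add: fc_eq)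
qed

lemma fc_shift: "fc (\<lambda>x. cis (l \<bullet> x) * f x) k = fc f (k + l)"
  by (simp add: fc_eq inner_add_left mult.assoc flip: cis_mult)

lemma fc_translate:
  assumes "k \<in> Q" "f \<in> Lp a 1"
  shows "fc (\<lambda>x. f (x - y)) k = cis (k \<bullet> y) * fc f k"
proof -
  let ?g = "\<lambda>x. cis (k \<bullet> x) * f x"
  have g: "?g \<in> Lp a 1" using assms by (rule Lp1_cis_mult)
  have "(LINT x|M. cis (k \<bullet> x) * f (x - y)) = (LINT x|M. cis (k \<bullet> y) * ?g (x + (- y)))"
    by (simp add: inner_diff_right cis_mult mult.assoc[symmetric])
  also have "\<dots> = cis (k \<bullet> y) * (LINT x|M. ?g (x + (- y)))" by (rule integral_mult_right_zero)
  also have "(LINT x|M. ?g (x + (- y))) = (LINT x|M. ?g x)"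
    by (rule integral_translate[OF Lp1D(1,3)[OF g]])
  finally show ?thesis by (simp add: fc_eq)
qed

lemma integral_cis: "k \<in> Q \<Longrightarrow> (LINT x|M. cis (k \<bullet> x)) = (if k = 0 then of_real V else 0)"
proof (cases "k = 0")
  case True
  then show ?thesis by (simp add: measure_M scaleR_conv_of_real)
next
  case False
  assume k: "k \<in> Q"
  \<comment> \<open>Shifting by this \<open>y\<close> turns every phase by \<open>pi\<close>, so the
    integral equals its own negative.\<close>
  define y where "y = (pi / (k \<bullet> k)) *\<^sub>R k"
  have "k \<bullet> y = pi" using False by (simp add: y_def)
  have "(LINT x|M. cis (k \<bullet> x)) = (LINT x|M. cis (k \<bullet> (x + y)))"
    using integral_translate[OF periodic_cis[OF k], of y] by simp
  also have "\<dots> = (LINT x|M. - cis (k \<bullet> x))"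
    using \<open>k \<bullet> y = pi\<close> by (simp add: inner_add_right flip: cis_mult)
  finally show ?thesis using False by simp
qed

lemma fc_cis: "k \<in> Q \<Longrightarrow> l \<in> Q \<Longrightarrow> fc (\<lambda>x. cis (- (l \<bullet> x))) k = (if k = l then of_real (sqrt V) else 0)"
proof -
  assume "k \<in> Q" "l \<in> Q"
  then have "fc (\<lambda>x. cis (- (l \<bullet> x))) k = (LINT x|M. cis ((k - l) \<bullet> x)) / sqrt V"
    by (simp add: fc_eq cis_mult inner_diff_left)
  moreover have "of_real V / of_real (sqrt V) = complex_of_real (sqrt V)"
    using V_pos by (simp add: real_div_sqrt flip: of_real_divide)
  ultimately show ?thesis using integral_cis[OF Q_closed(3)] \<open>k \<in> Q\<close> \<open>l \<in> Q\<close> by simp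
qed

text \<open>If \<open>h\<close> were positive on a set of positive measure, inner regularity would
  give a compact subset of positive measure, on which the integral of \<open>h\<close> is
  positive.\<close>

lemma AE_nonpos_if_compact_integrals:
  fixes h :: "real^3 \<Rightarrow> real"
  assumes h: "integrable M h"
    and C: "\<And>C. compact C \<Longrightarrow> C \<subseteq> cell a \<Longrightarrow> (LINT x|M. indicator C x * h x) = 0"
  shows "AE x in M. h x \<le> 0"
proof -
  note [measurable] = borel_measurable_integrable[OF h]
  define S where "S = {x \<in> space M. h x > 0}"
  have "S \<in> sets M" unfolding S_def by measurable
  then have S: "S \<in> sets lebesgue" "S \<subseteq> cell a" by (auto simp: sets_restrict_space)
  have "emeasure lebesgue S \<le> 0"
  proof (rule ennreal_le_epsilon)
    fix e :: real assume "0 < e"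
    then obtain T where T: "closed T" "T \<subseteq> S" "S - T \<in> lmeasurable" "emeasure lebesgue (S - T) < ennreal e"
      using sets_lebesgue_inner_closed[OF S(1)] by blast
    have "bounded T" using bounded_subset[OF bounded_cell] T(2) S(2) by auto
    then have "compact T" using T(1) by (simp add: compact_eq_bounded_closed)
    have sT: "T \<in> sets M" using T S \<open>compact T\<close> by (auto simp: sets_restrict_space image_iff intro!: bexI[of _ T])
    have "(LINT x|M. indicator T x * h x) = 0" using C \<open>compact T\<close> T S by blast
    moreover have "integrable M (\<lambda>x. indicator T x * h x)"
      using integrable_real_mult_indicator[OF sT h] by (simp add: mult.commute)
    moreover have "AE x in M. 0 \<le> indicator T x * h x"
      using T(2) by (intro AE_I2) (auto simp: S_def indicator_def split: if_splits)
    ultimately have "AE x in M. indicator T x * h x = 0"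
      by (subst (asm) integral_nonneg_eq_0_iff_AE) auto
    then have "AE x in M. x \<notin> T"
      by eventually_elim (use T(2) in \<open>auto simp: S_def indicator_def split: if_splits\<close>)
    moreover have TC: "{x \<in> space M. x \<in> T} = T" using T S by auto
    ultimately have "emeasure M {x \<in> space M. x \<in> T} = 0"
      using sT by (subst (asm) AE_iff_measurable[where N = "{x \<in> space M. x \<in> T}"]) (use TC in auto)
    with TC have "emeasure M T = 0" by simp
    then have "emeasure lebesgue T = 0" using T S by (subst (asm) emeasure_restrict_space) auto
    moreover have "emeasure lebesgue S \<le> emeasure lebesgue T + emeasure lebesgue (S - T)"
      using emeasure_subadditive[of T lebesgue "S - T"] T \<open>compact T\<close> by (simp add: Un_absorb1)
    ultimately show "emeasure lebesgue S \<le> 0 + ennreal e" using T(4) by simp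
  qed
  then have "emeasure M S = 0" using S by (simp add: emeasure_restrict_space)
  then show ?thesis
    by (intro AE_I[where N=S]) (use \<open>S \<in> sets M\<close> in \<open>auto simp: S_def not_le\<close>)
qed

text \<open>Embeds the torus as a compact subset of \<open>complex^3\<close>, where
  Stone--Weierstrass and distance functions are available.\<close>

definition toral :: "real^3 \<Rightarrow> complex^3" where "toral x = (\<chi> j. cis (b j \<bullet> x))"

lemma continuous_toral [continuous_intros]: "continuous_on S toral"
  unfolding toral_def by (intro continuous_intros)

lemma toral_periodic: "g \<in> lattice a \<Longrightarrow> toral (x + g) = toral x"
  by (simp add: toral_def cis_periodic b_in_Q)

lemma toral_eq_iff: "toral x = toral y \<longleftrightarrow> x - y \<in> lattice a"
proof
  assume "toral x = toral y"
  then show "x - y \<in> lattice a" by (intro cis_b_separates) (simp add: toral_def vec_eq_iff)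
next
  assume "x - y \<in> lattice a"
  then show "toral x = toral y" using toral_periodic[of "x - y" y] by simp
qed

lemma range_toral: "range toral = toral ` ccell"
proof -
  have "toral x \<in> toral ` ccell" for x
    using cell_subset_ccell reduce_cell[of x] reduce_diff[of x] by (auto simp: toral_eq_iff intro!: image_eqI[of _ _ "reduce x"])
  then show ?thesis by blast
qed

lemma compact_range_toral: "compact (range toral)"
  unfolding range_toral by (intro compact_continuous_image continuous_intros compact_ccell)

lemma fun_toral:
  fixes u :: "complex^3 \<Rightarrow> real"
  assumes u: "continuous_on (range toral) u"
  shows "periodic a (\<lambda>x. complex_of_real (u (toral x)))"
    "(\<lambda>x. complex_of_real (u (toral x))) \<in> borel_measurable lebesgue"
    "\<exists>B. \<forall>x. norm (complex_of_real (u (toral x))) \<le> B"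
proof -
  show "periodic a (\<lambda>x. complex_of_real (u (toral x)))" by (simp add: periodic_def toral_periodic)
  have "continuous_on UNIV (\<lambda>x. complex_of_real (u (toral x)))"
    by (intro continuous_intros continuous_on_compose2[OF u]) auto
  then have "(\<lambda>x. complex_of_real (u (toral x))) \<in> borel_measurable borel" by (rule borel_measurable_continuous_onI)
  then show "(\<lambda>x. complex_of_real (u (toral x))) \<in> borel_measurable lebesgue" by (simp add: measurable_completion)
  have "bounded (u ` range toral)"
    by (intro compact_imp_bounded compact_continuous_image u compact_range_toral)
  then show "\<exists>B. \<forall>x. norm (complex_of_real (u (toral x))) \<le> B"
    by (auto simp: bounded_iff)
qed

text \<open>Multiplication by \<open>h \<circ> toral\<close> preserves the functions with vanishing Fourier coefficients if \<open>h\<close>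
  is the real part of a multiple of a coordinate; the \<open>h\<close> with this property form an algebra, to which
  the Stone--Weierstrass theorem applies on the compact image of the torus.\<close>

lemma fc_null_mult:
  fixes u :: "complex^3 \<Rightarrow> real"
  assumes f: "f \<in> Lp a 1" "\<And>k. k \<in> Q \<Longrightarrow> fc f k = 0" and u: "continuous_on (range toral) u"
  shows "(LINT x|M. f x * of_real (u (toral x))) = 0"
proof -
  define P where "P h \<longleftrightarrow> continuous_on (range toral) h \<and>
    (\<forall>f\<in>Lp a 1. (\<forall>k\<in>Q. fc f k = 0) \<longrightarrow> (\<forall>k\<in>Q. fc (\<lambda>x. f x * of_real (h (toral x))) k = 0))" for h
  have L1: "(\<lambda>x. f x * of_real (h (toral x))) \<in> Lp a 1" if "continuous_on (range toral) h" "f \<in> Lp a 1"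
    for h and f :: "real^3 \<Rightarrow> complex"
    using fun_toral[OF that(1)] Lp1_mult_bounded[OF that(2)] by blast
  have PRe: "P (\<lambda>z. Re (c * z $ j))" for c j
    unfolding P_def
  proof (intro conjI ballI impI)
    show "continuous_on (range toral) (\<lambda>z. Re (c * z $ j))" by (intro continuous_intros)
    fix f k assume f: "f \<in> Lp a 1" "\<forall>k\<in>Q. fc f k = 0" and k: "k \<in> Q"
    have L: "(\<lambda>x. d * (cis (l \<bullet> x) * f x)) \<in> Lp a 1" if "l \<in> Q" for d l
      using Lp1_mult_bounded[OF Lp1_cis_mult[OF that f(1)], of "\<lambda>_. d" "norm d"] by (simp add: periodic_def mult.commute)
    \<comment> \<open>A coordinate of \<open>toral\<close> is a character, so multiplying by it or
      by its conjugate shifts frequencies by \<open>b j\<close> or \<open>- b j\<close> and stays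
      within \<open>Q\<close>.\<close>
    have "f x * of_real (Re (c * toral x $ j)) = c / 2 * (cis (b j \<bullet> x) * f x) + cnj c / 2 * (cis (- b j \<bullet> x) * f x)" for x
      by (simp add: toral_def complex_eq_iff field_simps)
    then have "fc (\<lambda>x. f x * of_real (Re (c * toral x $ j))) k = c / 2 * fc f (k + b j) + cnj c / 2 * fc f (k + - b j)"
      using fc_add[OF L[of "b j" "c / 2"] L[of "- b j" "cnj c / 2"], of k] b_in_Q Q_closed(4)
      by (simp only: fc_cmult fc_shift)
    then show "fc (\<lambda>x. f x * of_real (Re (c * toral x $ j))) k = 0"
      using f k Q_closed(2)[OF k b_in_Q[of j]] Q_closed(3)[OF k b_in_Q[of j]] by simp
  qed
  have Pconst: "P (\<lambda>z. c)" for c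
    by (simp add: P_def mult.commute[of _ "of_real c"] fc_cmult)
  have Padd: "P (\<lambda>z. g z + h z)" if "P g" "P h" for g h
    unfolding P_def
  proof (intro conjI ballI impI)
    show "continuous_on (range toral) (\<lambda>z. g z + h z)" using that by (intro continuous_intros) (auto simp: P_def)
    fix f k assume f: "f \<in> Lp a 1" "\<forall>k\<in>Q. fc f k = 0" and k: "k \<in> Q"
    have "fc (\<lambda>x. f x * of_real (g (toral x) + h (toral x))) k =
      fc (\<lambda>x. f x * of_real (g (toral x))) k + fc (\<lambda>x. f x * of_real (h (toral x))) k"
      using that f by (subst fc_add[symmetric]) (auto simp: P_def distrib_left intro!: L1)
    then show "fc (\<lambda>x. f x * of_real (g (toral x) + h (toral x))) k = 0" using that f k by (auto simp: P_def)
  qed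
  have Pmult: "P (\<lambda>z. g z * h z)" if "P g" "P h" for g h
    unfolding P_def
  proof (intro conjI ballI impI)
    show "continuous_on (range toral) (\<lambda>z. g z * h z)" using that by (intro continuous_intros) (auto simp: P_def)
    fix f k assume f: "f \<in> Lp a 1" "\<forall>k\<in>Q. fc f k = 0" and k: "k \<in> Q"
    let ?f = "\<lambda>x. f x * of_real (g (toral x))"
    have "?f \<in> Lp a 1" "\<forall>k\<in>Q. fc ?f k = 0" using that f by (auto simp: P_def intro!: L1)
    then have "fc (\<lambda>x. ?f x * of_real (h (toral x))) k = 0" using that(2) k unfolding P_def by blast
    then show "fc (\<lambda>x. f x * of_real (g (toral x) * h (toral x))) k = 0" by (simp add: mult.assoc)
  qed
  have sep: "\<exists>h. P h \<and> h x \<noteq> h y" if "x \<noteq> y" for x y :: "complex^3"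
  proof -
    from that obtain j where "x $ j \<noteq> y $ j" by (auto simp: vec_eq_iff)
    then have "Re (x $ j) \<noteq> Re (y $ j) \<or> Im (x $ j) \<noteq> Im (y $ j)" by (auto simp: complex_eq_iff)
    \<comment> \<open>The factor \<open>- \<i>\<close> presents the imaginary part as a real part,
      the form covered by \<open>PRe\<close>.\<close>
    then have "Re (1 * x $ j) \<noteq> Re (1 * y $ j) \<or> Re (- \<i> * x $ j) \<noteq> Re (- \<i> * y $ j)" by simp
    then show ?thesis using PRe[of 1 j] PRe[of "- \<i>" j] by blast
  qed
  have approx: "\<exists>g. P g \<and> (\<forall>z\<in>range toral. \<bar>u z - g z\<bar> < e)" if "e > 0" for e
    by (rule Stone_Weierstrass_HOL[where P = P]) (use Pconst Padd Pmult sep u that compact_range_toral in \<open>auto simp: P_def\<close>)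
  define B where "B = (LINT x|M. norm (f x))"
  have B: "B \<ge> 0" by (simp add: B_def)
  have "norm (LINT x|M. f x * of_real (u (toral x))) \<le> 0"
  proof (rule field_le_epsilon)
    fix e :: real assume "e > 0"
    \<comment> \<open>The \<open>+ 1\<close> keeps the tolerance positive when the norm
      \<open>B\<close> is zero.\<close>
    then have "e / (B + 1) > 0" using B by simp
    then obtain g where g: "P g" "\<And>x. \<bar>u (toral x) - g (toral x)\<bar> < e / (B + 1)" using approx by blast
    have gi: "integrable M (\<lambda>x. f x * of_real (g (toral x)))" 
      using Lp1D(4)[OF L1[OF _ f(1)]] g by (auto simp: P_def)
    have ui: "integrable M (\<lambda>x. f x * of_real (u (toral x)))" 
      using Lp1D(4)[OF L1[OF u f(1)]] .
    have "fc (\<lambda>x. f x * of_real (g (toral x))) 0 = 0" using g f Q_closed by (auto simp: P_def)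
    then have g0: "(LINT x|M. f x * of_real (g (toral x))) = 0" using V_pos by (simp add: fc_eq)
    have "(LINT x|M. f x * of_real (u (toral x))) = (LINT x|M. f x * of_real (u (toral x)) - f x * of_real (g (toral x)))"
      using gi ui g0 by simp
    also have "norm \<dots> \<le> (LINT x|M. norm (f x * of_real (u (toral x)) - f x * of_real (g (toral x))))"
      by (rule integral_norm_bound)
    also have "\<dots> \<le> (LINT x|M. e / (B + 1) * norm (f x))"
    proof (rule integral_mono)
      show "integrable M (\<lambda>x. norm (f x * of_real (u (toral x)) - f x * of_real (g (toral x))))"
        using gi ui by auto
      show "integrable M (\<lambda>x. e / (B + 1) * norm (f x))" using Lp1D[OF f(1)] by auto
      fix x
      have "norm (f x * of_real (u (toral x)) - f x * of_real (g (toral x))) = norm (f x * of_real (u (toral x) - g (toral x)))"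
        by (simp add: right_diff_distrib)
      also have "\<dots> = norm (f x) * \<bar>u (toral x) - g (toral x)\<bar>"
        by (simp only: norm_mult norm_of_real)
      also have "\<dots> \<le> norm (f x) * (e / (B + 1))" by (rule mult_left_mono[OF less_imp_le[OF g(2)] norm_ge_zero])
      finally show "norm (f x * of_real (u (toral x)) - f x * of_real (g (toral x))) \<le> e / (B + 1) * norm (f x)"
        by (simp add: mult.commute)
    qed
    also have "\<dots> = e / (B + 1) * B" by (simp add: B_def)
    also have "\<dots> \<le> e" using B \<open>e > 0\<close> by (simp add: field_simps)
    finally show "norm (LINT x|M. f x * of_real (u (toral x))) \<le> 0 + e" by simp
  qed
  then show ?thesis by simp
qed

text \<open>The indicator of \<open>C\<close> is a decreasing limit of continuous functions of the
  distance to the image of \<open>C\<close> under \<open>toral\<close>; dominated convergence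
  carries \<open>fc_null_mult\<close> over to it.\<close>

lemma fc_null_compact:
  assumes f: "f \<in> Lp a 1" "\<And>k. k \<in> Q \<Longrightarrow> fc f k = 0" and C: "compact C" "C \<subseteq> cell a"
  shows "(LINT x|M. indicator C x * f x) = 0"
proof (cases "C = {}")
  case False
  let ?K = "toral ` C"
  have cK: "compact ?K" using C by (intro compact_continuous_image continuous_intros)
  define u where "u n z = max 0 (1 - real n * infdist z ?K)" for n :: nat and z
  have cu: "continuous_on S (u n)" for n S unfolding u_def by (intro continuous_intros)
  have lim: "(\<lambda>n. u n (toral x)) \<longlonglongrightarrow> indicator C x" if x: "x \<in> cell a" for x
  proof (cases "x \<in> C")
    case True
    then have "u n (toral x) = 1" for n by (simp add: u_def)
    then show ?thesis using True by simp
  next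
    case False
    \<comment> \<open>The cell holds one representative of each class, so a point of the cell
      outside \<open>C\<close> is not equivalent to any point of \<open>C\<close>.\<close>
    have "toral x \<notin> ?K"
    proof
      assume "toral x \<in> ?K"
      then obtain y where y: "y \<in> C" "x - y \<in> lattice a" by (auto simp: toral_eq_iff)
      then have "reduce x = y" using C by (intro reduce_unique) auto
      then show False using x y False by simp
    qed
    then have d: "infdist (toral x) ?K > 0"
      using in_closed_iff_infdist_zero[of ?K "toral x"] compact_imp_closed[OF cK] \<open>C \<noteq> {}\<close> infdist_nonneg[of "toral x" ?K]
      by auto
    then obtain n0 :: nat where "1 / infdist (toral x) ?K < real n0" using reals_Archimedean2 by blast
    then have n0: "1 < real n0 * infdist (toral x) ?K" using d by (simp add: field_simps)
    have "u n (toral x) = 0" if "n \<ge> n0" for n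
    proof -
      have "real n0 * infdist (toral x) ?K \<le> real n * infdist (toral x) ?K"
        using that d by (intro mult_right_mono) auto
      then show ?thesis using n0 by (simp add: u_def)
    qed
    then have "eventually (\<lambda>n. u n (toral x) = 0) sequentially" by (auto simp: eventually_sequentially)
    then show ?thesis using False by (simp add: tendsto_eventually)
  qed
  have sC: "C \<in> sets M" using C by (auto simp: sets_restrict_space image_iff intro!: bexI[of _ C] lmeasurable_compact fmeasurableD)
  note [measurable] = Lp1D(3)[OF f(1)] sC borel_measurable_M[OF fun_toral(2)[OF cu]]
  have "(\<lambda>n. LINT x|M. f x * of_real (u n (toral x))) \<longlonglongrightarrow> (LINT x|M. f x * indicator C x)"
  proof (rule integral_dominated_convergence)
    show "integrable M (\<lambda>x. norm (f x))" using Lp1D[OF f(1)] by auto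
    have "(\<lambda>n. f x * of_real (u n (toral x))) \<longlonglongrightarrow> f x * indicator C x" if "x \<in> cell a" for x
    proof -
      have "(\<lambda>n. complex_of_real (u n (toral x))) \<longlonglongrightarrow> of_real (indicator C x)"
        by (rule tendsto_of_real[OF lim[OF that]])
      then have "(\<lambda>n. f x * of_real (u n (toral x))) \<longlonglongrightarrow> f x * of_real (indicator C x)"
        by (rule tendsto_mult[OF tendsto_const])
      then show ?thesis by (simp add: indicator_def of_bool_def split: if_splits)
    qed
    then show "AE x in M. (\<lambda>n. f x * of_real (u n (toral x))) \<longlonglongrightarrow> f x * indicator C x" by (rule AE_M_cell)
    have "\<bar>u n z\<bar> \<le> 1" for n z by (auto simp: u_def infdist_nonneg)
    then show "AE x in M. norm (f x * of_real (u n (toral x))) \<le> norm (f x)" for n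
      by (intro AE_I2) (simp add: norm_mult mult_left_le)
  qed measurable
  moreover have "(LINT x|M. f x * of_real (u n (toral x))) = 0" for n
    by (rule fc_null_mult[OF f cu])
  ultimately have "(LINT x|M. f x * indicator C x) = 0" by (simp add: LIMSEQ_const_iff)
  then show ?thesis by (simp add: mult.commute)
qed simp

text \<open>The test with compact sets concerns real functions and one sign. The four factors
  \<open>1\<close>, \<open>-1\<close>, \<open>\<i>\<close> and \<open>- \<i>\<close> cover both
  signs of the real and imaginary parts.\<close>

lemma fc_null_AE:
  assumes f: "f \<in> Lp a 1" "\<And>k. k \<in> Q \<Longrightarrow> fc f k = 0"
  shows "AE x in lebesgue. f x = 0"
proof -
  note fi = Lp1D[OF f(1)]
  have C0: "(LINT x|M. Re (c * (indicator C x * f x))) = 0" if "compact C" "C \<subseteq> cell a" for C c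
  proof -
    have i: "integrable M (\<lambda>x. indicator C x * f x)"
    proof (rule Bochner_Integration.integrable_bound)
      have sC: "C \<in> sets M" using that by (auto simp: sets_restrict_space image_iff intro!: bexI[of _ C] lmeasurable_compact fmeasurableD)
      note [measurable] = fi(3) sC
      show "(\<lambda>x. indicator C x * f x) \<in> borel_measurable M" by measurable
    qed (use fi in \<open>auto simp: indicator_def norm_mult\<close>)
    have "(LINT x|M. Re (c * (indicator C x * f x))) = Re (LINT x|M. c * (indicator C x * f x))"
      using i by (intro integral_Re) auto
    then show ?thesis using fc_null_compact[OF f that] by simp
  qed
  have le: "AE x in M. Re (c * f x) \<le> 0" for c
  proof (rule AE_nonpos_if_compact_integrals)
    show "integrable M (\<lambda>x. Re (c * f x))" using fi by auto
    fix C assume C: "compact C" "C \<subseteq> cell a"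
    have "indicator C x * Re (c * f x) = Re (c * (indicator C x * f x))" for x by (simp add: indicator_def)
    then show "(LINT x|M. indicator C x * Re (c * f x)) = 0" using C0[OF C] by presburger
  qed
  have "AE x in M. f x = 0"
    using le[of 1] le[of "-1"] le[of "\<i>"] le[of "- \<i>"] by eventually_elim (auto simp: complex_eq_iff)
  then show ?thesis by (rule AE_periodic[rotated]) (use fi in \<open>auto simp: periodic_def\<close>)
qed

text \<open>The setting is \<open>Lp a 1\<close> so that functions can be compared before they are
  known to be square integrable.\<close>

lemma fc_unique:
  assumes "f \<in> Lp a 1" "g \<in> Lp a 1" "\<And>k. k \<in> Q \<Longrightarrow> fc f k = fc g k"
  shows "AE x in lebesgue. f x = g x"
proof -
  have d: "(\<lambda>x. f x - g x) \<in> Lp a 1"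
    using assms Lp1D[OF assms(1)] Lp1D[OF assms(2)] by (auto simp: Lp1_iff periodic_def)
  have "AE x in lebesgue. f x - g x = 0"
    by (rule fc_null_AE[OF d]) (use assms in \<open>simp add: fc_diff\<close>)
  then show ?thesis by simp
qed

lemma AE_lebesgue_M: "AE x in lebesgue. P x \<Longrightarrow> AE x in M. P x"
  by (subst AE_restrict_space_iff) auto

end

section \<open>Riesz--Fischer and Parseval\<close>

text \<open>By monotone convergence the sum of the norms has a finite integral, hence is finite
  almost everywhere.\<close>

lemma AE_summable_norm:
  fixes f :: "nat \<Rightarrow> 'a \<Rightarrow> 'b::{banach, second_countable_topology}"
  assumes f: "\<And>n. integrable N (f n)" and s: "summable (\<lambda>n. LINT x|N. norm (f n x))"
  shows "AE x in N. summable (\<lambda>n. norm (f n x))"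
proof -
  note [measurable] = borel_measurable_integrable[OF f]
  have "(\<integral>\<^sup>+x. (\<Sum>n. ennreal (norm (f n x))) \<partial>N) = (\<Sum>n. \<integral>\<^sup>+x. ennreal (norm (f n x)) \<partial>N)"
    by (rule nn_integral_suminf) simp
  also have "\<dots> = (\<Sum>n. ennreal (LINT x|N. norm (f n x)))"
    using f by (intro suminf_cong nn_integral_eq_integral) auto
  also have "\<dots> \<noteq> \<infinity>" using s by (simp add: ennreal_suminf_neq_top)
  finally have "(\<integral>\<^sup>+x. (\<Sum>n. ennreal (norm (f n x))) \<partial>N) \<noteq> \<infinity>" .
  then have "AE x in N. (\<Sum>n. ennreal (norm (f n x))) \<noteq> \<infinity>"
    by (intro nn_integral_PInf_AE) auto
  then show ?thesis by eventually_elim (rule summable_suminf_not_top, auto)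
qed

context torus begin

section \<open>Finite Fourier sums and Bessel's inequality\<close>

definition tsum :: "(real^3) set \<Rightarrow> (real^3 \<Rightarrow> complex) \<Rightarrow> real^3 \<Rightarrow> complex" where
  "tsum F c x = (\<Sum>k\<in>F. c k * (cis (- (k \<bullet> x)) / sqrt V))"

lemma Lp2_tsum: "F \<subseteq> Q \<Longrightarrow> tsum F c \<in> Lp a 2"
  unfolding tsum_def
  using Lp2_cmult[OF Lp2_cis_minus, of _ "1 / sqrt V"]
  by (intro Lp2_sum Lp2_cmult) auto

lemma fc_tsum:
  assumes "finite F" "F \<subseteq> Q" "k \<in> Q" shows "fc (tsum F c) k = (if k \<in> F then c k else 0)"
proof -
  have L: "(\<lambda>x. c l * (cis (- (l \<bullet> x)) / sqrt V)) \<in> Lp a 2" if "l \<in> F" for l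
    using Lp2_cmult[OF Lp2_cis_minus, of l "c l / sqrt V"] that assms by auto
  have "fc (tsum F c) k = (\<Sum>l\<in>F. fc (\<lambda>x. (c l / sqrt V) * cis (- (l \<bullet> x))) k)"
    unfolding tsum_def by (subst fc_sum) (use L in auto)
  also have "\<dots> = (\<Sum>l\<in>F. if k = l then c l else 0)"
    using assms V_pos by (intro sum.cong refl) (subst fc_cmult, auto simp: fc_cis)
  finally show ?thesis using assms by simp
qed

lemma integral_tsum:
  assumes "finite F" "F \<subseteq> Q" "f \<in> Lp a 1"
  shows "(LINT x|M. f x * cnj (tsum F c x)) = (\<Sum>k\<in>F. fc f k * cnj (c k))"
proof -
  have "f x * cnj (tsum F c x) = (\<Sum>k\<in>F. (cnj (c k) / sqrt V) * (cis (k \<bullet> x) * f x))" for x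
    by (simp add: tsum_def cis_cnj sum_distrib_left mult_ac)
  then have "(LINT x|M. f x * cnj (tsum F c x)) = (\<Sum>k\<in>F. (LINT x|M. (cnj (c k) / sqrt V) * (cis (k \<bullet> x) * f x)))"
    using assms by (simp add: integral_sum integrable_cis_mult)
  also have "\<dots> = (\<Sum>k\<in>F. fc f k * cnj (c k))"
    by (intro sum.cong refl) (simp add: fc_eq)
  finally show ?thesis .
qed

lemma norm_square_cnj: "complex_of_real ((norm z)\<^sup>2) = z * cnj z"
  by (rule complex_norm_square)

lemma tsum_norm:
  assumes "finite F" "F \<subseteq> Q"
  shows "(LINT x|M. (norm (tsum F c x))\<^sup>2) = (\<Sum>k\<in>F. (norm (c k))\<^sup>2)"
proof -
  have "complex_of_real (LINT x|M. (norm (tsum F c x))\<^sup>2) = (LINT x|M. tsum F c x * cnj (tsum F c x))"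
    by (simp only: norm_square_cnj flip: integral_complex_of_real)
  also have "\<dots> = (\<Sum>k\<in>F. fc (tsum F c) k * cnj (c k))"
    using assms by (intro integral_tsum Lp2_imp_Lp1 Lp2_tsum)
  also have "\<dots> = (\<Sum>k\<in>F. complex_of_real ((norm (c k))\<^sup>2))"
    using assms by (intro sum.cong refl) (simp only: norm_square_cnj, subst fc_tsum, auto)
  finally show ?thesis by (simp only: of_real_eq_iff flip: of_real_sum)
qed

lemma integral_norm_diff_square:
  assumes f: "f \<in> Lp a 2" and g: "g \<in> Lp a 2"
  shows "(LINT x|M. (norm (f x - g x))\<^sup>2) = (LINT x|M. (norm (f x))\<^sup>2)
    - 2 * Re (LINT x|M. f x * cnj (g x)) + (LINT x|M. (norm (g x))\<^sup>2)"
proof -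
  have i: "integrable M (\<lambda>x. f x * cnj (g x))"
    using Lp1D(4)[OF Lp2_mult_Lp2[OF f Lp2_cnj[OF g]]] .
  define G where "G x = Re (f x * cnj (g x))" for x
  have G: "integrable M G" "(LINT x|M. G x) = Re (LINT x|M. f x * cnj (g x))"
    unfolding G_def by (rule integrable_Re[OF i], rule integral_Re[OF i])
  have "(norm (f x - g x))\<^sup>2 = (norm (f x))\<^sup>2 - 2 * G x + (norm (g x))\<^sup>2" for x
    unfolding G_def by (simp only: cmod_power2) (simp add: algebra_simps power2_eq_square)
  then show ?thesis using G Lp2D(5)[OF f] Lp2D(5)[OF g] by simp
qed

text \<open>Expand the squared distance from \<open>f\<close> to its own partial Fourier sum, which
  is nonnegative.\<close>

lemma bessel:
  assumes f: "f \<in> Lp a 2" and F: "finite F" "F \<subseteq> Q"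
  shows "(\<Sum>k\<in>F. (norm (fc f k))\<^sup>2) \<le> (LINT x|M. (norm (f x))\<^sup>2)"
proof -
  let ?S = "tsum F (fc f)"
  have "0 \<le> (LINT x|M. (norm (f x - ?S x))\<^sup>2)" by simp
  also have "\<dots> = (LINT x|M. (norm (f x))\<^sup>2) - 2 * Re (\<Sum>k\<in>F. fc f k * cnj (fc f k)) + (\<Sum>k\<in>F. (norm (fc f k))\<^sup>2)"
    using F f by (subst integral_norm_diff_square) (auto simp: tsum_norm integral_tsum Lp2_imp_Lp1 Lp2_tsum)
  also have "(\<Sum>k\<in>F. fc f k * cnj (fc f k)) = of_real (\<Sum>k\<in>F. (norm (fc f k))\<^sup>2)"
    by (simp only: of_real_sum norm_square_cnj)
  finally show ?thesis by simp
qed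

lemma fc_summable: "f \<in> Lp a 2 \<Longrightarrow> (\<lambda>k. (norm (fc f k))\<^sup>2) summable_on Q"
  by (rule nonneg_bdd_above_summable_on) (auto intro!: bdd_aboveI2[of _ _ "LINT x|M. (norm (f x))\<^sup>2"] bessel)

lemma Q_enum: obtains q :: "nat \<Rightarrow> real^3" where "bij_betw q UNIV Q"
  using bij_betw_from_nat_into[OF countable_lattice infinite_Q] by blast

text \<open>Riesz--Fischer: along a subsequence with summable increments the partial sums converge
  almost everywhere.\<close>

lemma riesz_fischer:
  assumes c: "(\<lambda>k. (norm (c k))\<^sup>2) summable_on Q"
  shows "\<exists>f\<in>Lp a 2. (\<forall>k\<in>Q. fc f k = c k) \<and> (LINT x|M. (norm (f x))\<^sup>2) \<le> (\<Sum>\<^sub>\<infinity>k\<in>Q. (norm (c k))\<^sup>2)"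
proof -
  obtain q :: "nat \<Rightarrow> real^3" where q: "bij_betw q UNIV Q" by (rule Q_enum)
  have qQ: "q i \<in> Q" for i using q by (auto simp: bij_betw_def)
  have qinj: "inj_on q A" for A using q by (auto simp: bij_betw_def intro: inj_on_subset)
  define w where "w i = (norm (c (q i)))\<^sup>2" for i
  have "(w has_sum (\<Sum>\<^sub>\<infinity>k\<in>Q. (norm (c k))\<^sup>2)) UNIV"
    unfolding w_def using has_sum_infsum[OF c] has_sum_reindex_bij_betw[OF q, of "\<lambda>k. (norm (c k))\<^sup>2"] by simp
  then have ws: "w sums (\<Sum>\<^sub>\<infinity>k\<in>Q. (norm (c k))\<^sup>2)" by (rule has_sum_imp_sums)
  then have wsum: "summable w" by (simp add: sums_iff)
  have "\<exists>n0. \<forall>n\<ge>n0. \<forall>m\<ge>n. (\<Sum>i\<in>{n..<m}. w i) \<le> (1/4)^j" for j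
  proof -
    obtain n0 where n0: "\<And>m n. m \<ge> n0 \<Longrightarrow> norm (sum w {m..<n}) < (1/4)^j"
      using wsum[unfolded summable_Cauchy] by (meson zero_less_power zero_less_divide_1_iff zero_less_numeral)
    then show ?thesis by (intro exI[of _ n0]) (auto simp: w_def sum_nonneg abs_of_nonneg less_imp_le)
  qed
  then obtain n0 where n0: "\<And>j n m. n \<ge> n0 j \<Longrightarrow> m \<ge> n \<Longrightarrow> (\<Sum>i\<in>{n..<m}. w i) \<le> (1/4)^j" by metis
  \<comment> \<open>Adding all earlier thresholds makes \<open>r\<close> monotone and at least
    \<open>n0 j\<close>; the summand \<open>j\<close> makes it unbounded, so every mode is
    eventually included.\<close>
  define r where "r j = j + (\<Sum>i\<le>j. n0 i)" for j :: nat
  have r_ge: "r j \<ge> n0 j" "r j \<ge> j" for j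
    using member_le_sum[of j "{..j}" n0] by (auto simp: r_def)
  have r_mono: "r j \<le> r (Suc j)" for j by (simp add: r_def)
  define s where "s n = tsum (q ` {..<n}) c" for n
  define D where "D j x = s (r (Suc j)) x - s (r j) x" for j x
  have s_L2: "s n \<in> Lp a 2" for n unfolding s_def by (rule Lp2_tsum) (use qQ in auto)
  have D_L2: "D j \<in> Lp a 2" for j unfolding D_def[abs_def] by (intro Lp2_diff s_L2)
  have D_tsum: "D j = tsum (q ` {r j..<r (Suc j)}) c" for j
  proof
    fix x
    have "s (r (Suc j)) x = s (r j) x + tsum (q ` {r j..<r (Suc j)}) c x"
      unfolding s_def tsum_def
      by (subst sum.union_disjoint[symmetric])
        (use r_mono[of j] qinj in \<open>auto simp: inj_on_eq_iff[OF qinj[of UNIV]] ivl_disj_un image_Un[symmetric]\<close>)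
    then show "D j x = tsum (q ` {r j..<r (Suc j)}) c x" by (simp add: D_def)
  qed
  have D_norm2: "(LINT x|M. (norm (D j x))\<^sup>2) \<le> (1/4)^j" for j
  proof -
    have "(LINT x|M. (norm (D j x))\<^sup>2) = (\<Sum>i\<in>{r j..<r (Suc j)}. w i)"
      unfolding D_tsum by (subst tsum_norm) (use qQ in \<open>auto simp: sum.reindex qinj w_def\<close>)
    then show ?thesis using n0[OF r_ge(1) r_mono] by simp
  qed
  have D_norm1: "(LINT x|M. norm (D j x)) \<le> (V + 1) * (1/2)^j" for j
  proof -
    \<comment> \<open>This trades the square bound \<open>(1/4)^j\<close> for a summable bound on
      the first power, using the finite volume.\<close>
    have "norm (D j x) \<le> (1/2)^j + 2^j * (norm (D j x))\<^sup>2" for x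
    proof -
      define t e where "t = norm (D j x)" and "e = (1/2::real)^j"
      have e: "e > 0" "2^j = 1 / e" by (auto simp: e_def power_one_over)
      have "0 \<le> t * e" using e by (simp add: t_def)
      moreover have "2 * (t * e) \<le> t\<^sup>2 + e\<^sup>2" using sum_squares_bound[of t e] by (simp add: mult.assoc)
      ultimately have "t * e \<le> e\<^sup>2 + t\<^sup>2" by linarith
      then have "t \<le> e + t\<^sup>2 / e" using e by (simp add: field_simps power2_eq_square)
      then show ?thesis using e by (simp add: t_def e_def)
    qed
    moreover have "integrable M (\<lambda>x. (1/2)^j + 2^j * (norm (D j x))\<^sup>2)"
      by (intro Bochner_Integration.integrable_add integrable_mult_right Lp2D(5) D_L2 finite_measure.integrable_const[OF finite_M])
    moreover have "integrable M (\<lambda>x. norm (D j x))" using Lp2D(4)[OF D_L2] by (rule integrable_norm)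
    ultimately have "(LINT x|M. norm (D j x)) \<le> (LINT x|M. (1/2)^j + 2^j * (norm (D j x))\<^sup>2)"
      by (intro integral_mono)
    also have "\<dots> = V * (1/2)^j + 2^j * (LINT x|M. (norm (D j x))\<^sup>2)"
      by (subst Bochner_Integration.integral_add)
        (simp_all add: integral_const_M measure_M Lp2D(5)[OF D_L2] finite_measure.integrable_const[OF finite_M] del: integral_const)
    also have "\<dots> \<le> V * (1/2)^j + 2^j * (1/4)^j"
      by (intro add_left_mono mult_left_mono D_norm2) auto
    also have "(2::real)^j * (1/4)^j = (1/2)^j" by (simp flip: power_mult_distrib)
    finally show ?thesis by (simp add: algebra_simps)
  qed
  have D_sum: "summable (\<lambda>j. LINT x|M. norm (D j x))"
    by (rule summable_comparison_test'[where g = "\<lambda>j. (V + 1) * (1/2)^j"])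
      (use D_norm1 in \<open>auto intro!: summable_mult summable_geometric\<close>)
  have D_int: "integrable M (D j)" for j using Lp2D[OF D_L2] by simp
  have aeD: "AE x in M. summable (\<lambda>j. norm (D j x))"
    by (rule AE_summable_norm[OF D_int D_sum])
  \<comment> \<open>Where the series diverges, \<open>suminf\<close> still depends only on its
    terms, so \<open>f\<close> is periodic at every point.\<close>
  define f where "f x = s (r 0) x + (\<Sum>j. D j x)" for x
  have per: "periodic a f"
    using Lp2D(1)[OF D_L2] Lp2D(1)[OF s_L2] by (simp add: periodic_def f_def)
  note [measurable] = Lp2D(2,3)[OF D_L2] Lp2D(2,3)[OF s_L2]
  have meas [measurable]: "f \<in> borel_measurable lebesgue" unfolding f_def[abs_def] by measurable
  note [measurable] = borel_measurable_M[OF meas]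
  have tel: "s (r 0) x + (\<Sum>j<n. D j x) = s (r n) x" for n x
    using sum_lessThan_telescope[of "\<lambda>n. s (r n) x" n] by (simp add: D_def)
  have lim: "AE x in M. (\<lambda>n. s (r n) x) \<longlonglongrightarrow> f x"
    using aeD
  proof eventually_elim
    case (elim x)
    then have "(\<lambda>n. \<Sum>j<n. D j x) \<longlonglongrightarrow> (\<Sum>j. D j x)"
      by (intro summable_LIMSEQ summable_norm_cancel[of "\<lambda>j. D j x"])
    then have "(\<lambda>n. s (r 0) x + (\<Sum>j<n. D j x)) \<longlonglongrightarrow> f x" unfolding f_def by (intro tendsto_intros)
    then show ?case by (simp add: tel)
  qed
  have s_bound: "(LINT x|M. (norm (s n x))\<^sup>2) \<le> (\<Sum>\<^sub>\<infinity>k\<in>Q. (norm (c k))\<^sup>2)" for n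
  proof -
    have "(LINT x|M. (norm (s n x))\<^sup>2) = (\<Sum>k\<in>q ` {..<n}. (norm (c k))\<^sup>2)"
      unfolding s_def by (rule tsum_norm) (use qQ in auto)
    also have "\<dots> \<le> (\<Sum>\<^sub>\<infinity>k\<in>Q. (norm (c k))\<^sup>2)"
      by (rule finite_sum_le_infsum[OF c]) (use qQ in auto)
    finally show ?thesis .
  qed
  have fat: "integrable M (\<lambda>x. (norm (f x))\<^sup>2)" "(LINT x|M. (norm (f x))\<^sup>2) \<le> (\<Sum>\<^sub>\<infinity>k\<in>Q. (norm (c k))\<^sup>2)"
    using fatou_norm_square[of f M "\<lambda>n. s (r n)", OF _ _ lim Lp2D(5)[OF s_L2] s_bound] by auto
  have f_L2: "f \<in> Lp a 2" using per meas fat by (simp add: Lp2_iff)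
  have "fc f k = c k" if k: "k \<in> Q" for k
  proof -
    have ci: "integrable M (\<lambda>x. cis (k \<bullet> x) * D j x)" for j
      by (intro integrable_cis_mult Lp2_imp_Lp1 D_L2)
    have "(\<lambda>j. LINT x|M. cis (k \<bullet> x) * D j x) sums (LINT x|M. (\<Sum>j. cis (k \<bullet> x) * D j x))"
      by (rule sums_integral[OF ci]) (use aeD D_sum in \<open>simp_all add: norm_mult\<close>)
    also have "(LINT x|M. (\<Sum>j. cis (k \<bullet> x) * D j x)) = (LINT x|M. cis (k \<bullet> x) * f x - cis (k \<bullet> x) * s (r 0) x)"
    proof (rule integral_cong_AE)
      show "AE x in M. (\<Sum>j. cis (k \<bullet> x) * D j x) = cis (k \<bullet> x) * f x - cis (k \<bullet> x) * s (r 0) x"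
        using aeD by eventually_elim
          (simp add: f_def suminf_mult summable_norm_cancel distrib_left)
    qed measurable
    also have "\<dots> = sqrt V * (fc f k - fc (s (r 0)) k)"
      using V_pos integrable_cis_mult[OF Lp2_imp_Lp1[OF f_L2], of k] integrable_cis_mult[OF Lp2_imp_Lp1[OF s_L2], of k]
      by (simp add: fc_eq right_diff_distrib)
    finally have "(\<lambda>j. (LINT x|M. cis (k \<bullet> x) * D j x) / sqrt V) sums (sqrt V * (fc f k - fc (s (r 0)) k) / sqrt V)"
      by (rule sums_divide)
    then have "(\<lambda>j. fc (D j) k) sums (fc f k - fc (s (r 0)) k)" using V_pos by (simp add: fc_eq)
    moreover have "fc (D j) k = fc (s (r (Suc j))) k - fc (s (r j)) k" for j
      unfolding D_def[abs_def] by (intro fc_diff Lp2_imp_Lp1 s_L2)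
    moreover have "(\<Sum>j<n. fc (s (r (Suc j))) k - fc (s (r j)) k) = fc (s (r n)) k - fc (s (r 0)) k" for n
      by (rule sum_lessThan_telescope)
    ultimately have "(\<lambda>n. fc (s (r n)) k - fc (s (r 0)) k) \<longlonglongrightarrow> fc f k - fc (s (r 0)) k"
      by (simp add: sums_def)
    then have l1: "(\<lambda>n. fc (s (r n)) k) \<longlonglongrightarrow> fc f k" using tendsto_add[OF _ tendsto_const[of "fc (s (r 0)) k"]] by fastforce
    from k obtain i where i: "k = q i" using q by (auto simp: bij_betw_def)
    have "fc (s (r n)) k = c k" if "n > i" for n
      unfolding s_def by (subst fc_tsum) (use qQ k i that r_ge(2)[of n] in auto)
    then have "eventually (\<lambda>n. fc (s (r n)) k = c k) sequentially"
      unfolding eventually_at_top_dense by blast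
    then have "(\<lambda>n. fc (s (r n)) k) \<longlonglongrightarrow> c k" by (rule tendsto_eventually)
    with l1 show ?thesis by (rule LIMSEQ_unique)
  qed
  with f_L2 fat show ?thesis by blast
qed

text \<open>Bessel gives one inequality. For the other, the Riesz--Fischer function with the same
  coefficients has squared norm at most their sum, and by uniqueness it equals \<open>f\<close>
  almost everywhere.\<close>

lemma parseval_norm:
  assumes f: "f \<in> Lp a 2"
  shows "((\<lambda>k. (norm (fc f k))\<^sup>2) has_sum (LINT x|M. (norm (f x))\<^sup>2)) Q"
proof -
  let ?I = "\<Sum>\<^sub>\<infinity>k\<in>Q. (norm (fc f k))\<^sup>2"
  note s = fc_summable[OF f]
  obtain g where g: "g \<in> Lp a 2" "\<And>k. k \<in> Q \<Longrightarrow> fc g k = fc f k" "(LINT x|M. (norm (g x))\<^sup>2) \<le> ?I"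
    using riesz_fischer[OF s] by blast
  have "AE x in lebesgue. g x = f x" by (rule fc_unique) (use f g in \<open>auto intro: Lp2_imp_Lp1\<close>)
  then have ae: "AE x in M. g x = f x" by (rule AE_lebesgue_M)
  have "(LINT x|M. (norm (g x))\<^sup>2) = (LINT x|M. (norm (f x))\<^sup>2)"
    using ae Lp2D(3)[OF f] Lp2D(3)[OF g(1)] by (intro integral_cong_AE) auto
  then have "(LINT x|M. (norm (f x))\<^sup>2) \<le> ?I" using g by simp
  moreover have "?I \<le> (LINT x|M. (norm (f x))\<^sup>2)"
    by (rule infsum_le_finite_sums[OF s]) (rule bessel[OF f])
  ultimately show ?thesis using has_sum_infsum[OF s] by simp
qed

text \<open>Polarization of \<open>parseval_norm\<close>, applied to \<open>f + u * g\<close> with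
  \<open>u\<close> equal to \<open>1\<close>, \<open>-1\<close>, \<open>\<i>\<close> and
  \<open>- \<i>\<close>.\<close>

lemma parseval:
  assumes f: "f \<in> Lp a 2" and g: "g \<in> Lp a 2"
  shows "((\<lambda>k. fc f k * cnj (fc g k)) has_sum (LINT x|M. f x * cnj (g x))) Q"
proof -
  define N where "N u = (\<lambda>x. (norm (f x + u * g x))\<^sup>2)" for u
  define n where "n u = (\<lambda>k. (norm (fc f k + u * fc g k))\<^sup>2)" for u
  have pol: "z * cnj w = ((1/4) * of_real ((norm (z + 1 * w))\<^sup>2) + (-1/4) * of_real ((norm (z + (-1) * w))\<^sup>2))
     + ((\<i>/4) * of_real ((norm (z + \<i> * w))\<^sup>2) + (-\<i>/4) * of_real ((norm (z + (-\<i>) * w))\<^sup>2))" for z w :: complex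
    by (simp only: norm_square_cnj) (simp add: algebra_simps)
  have L: "(\<lambda>x. f x + u * g x) \<in> Lp a 2" for u by (intro Lp2_add Lp2_cmult f g)
  have hs: "(n u has_sum (LINT x|M. N u x)) Q" for u
    using parseval_norm[OF L[of u]] unfolding N_def n_def
    by (simp add: fc_add fc_cmult Lp2_imp_Lp1 Lp2_cmult f g)
  have Ni: "integrable M (N u)" for u using Lp2D(5)[OF L[of u]] by (simp add: N_def)
  have hc: "((\<lambda>k. z * of_real (n u k)) has_sum (z * of_real (LINT x|M. N u x))) Q" for z :: complex and u
    by (intro has_sum_cmult_right has_sum_of_real hs)
  have "((\<lambda>k. fc f k * cnj (fc g k)) has_sum
     (((1/4) * of_real (LINT x|M. N 1 x) + (-1/4) * of_real (LINT x|M. N (-1) x)) +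
     ((\<i>/4) * of_real (LINT x|M. N \<i> x) + (-\<i>/4) * of_real (LINT x|M. N (-\<i>) x)))) Q"
    unfolding pol n_def[symmetric] by (intro has_sum_add hc[unfolded n_def])
  also have "((1/4) * of_real (LINT x|M. N 1 x) + (-1/4) * of_real (LINT x|M. N (-1) x)) +
     ((\<i>/4) * of_real (LINT x|M. N \<i> x) + (-\<i>/4) * of_real (LINT x|M. N (-\<i>) x)) =
     (LINT x|M. ((1/4) * of_real (N 1 x) + (-1/4) * of_real (N (-1) x)) +
     ((\<i>/4) * of_real (N \<i> x) + (-\<i>/4) * of_real (N (-\<i>) x)))"
    using Ni by simp
  also have "\<dots> = (LINT x|M. f x * cnj (g x))" unfolding pol N_def ..
  finally show ?thesis .
qed

definition aseries :: "(real^3 \<Rightarrow> complex) \<Rightarrow> real^3 \<Rightarrow> complex" where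
  "aseries c x = (\<Sum>\<^sub>\<infinity>k\<in>Q. c k * (cis (- (k \<bullet> x)) / sqrt V))"

text \<open>Absolute convergence gives a value and a uniform bound at every point, not only almost
  everywhere.\<close>

lemma aseries:
  assumes c: "(\<lambda>k. norm (c k)) summable_on Q"
  shows "aseries c \<in> Lp a 2" "k \<in> Q \<Longrightarrow> fc (aseries c) k = c k" "\<exists>B. \<forall>x. norm (aseries c x) \<le> B"
proof -
  define t where "t k x = c k * (cis (- (k \<bullet> x)) / sqrt V)" for k x
  have nt: "norm (t k x) = norm (c k) / sqrt V" for k x
    using V_pos by (simp add: t_def norm_mult norm_divide)
  have ns: "(\<lambda>k. norm (c k) / sqrt V) summable_on Q"
    using summable_on_cmult_left[OF c, of "1 / sqrt V"] by simp
  have ts: "(\<lambda>k. norm (t k x)) summable_on Q" for x unfolding nt by (rule ns)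
  \<comment> \<open>An enumeration turns the unordered sum into a series, to which measurability and
    termwise integration apply.\<close>
  obtain q :: "nat \<Rightarrow> real^3" where q: "bij_betw q UNIV Q" by (rule Q_enum)
  have qQ: "q i \<in> Q" for i using q by (auto simp: bij_betw_def)
  have "((\<lambda>k. t k x) has_sum aseries c x) Q" for x
    unfolding aseries_def t_def[symmetric] by (rule has_sum_infsum[OF abs_summable_summable[OF ts]])
  then have sm: "(\<lambda>i. t (q i) x) sums aseries c x" for x
    using has_sum_reindex_bij_betw[OF q, of "\<lambda>k. t k x"] by (intro has_sum_imp_sums) simp
  then have eq: "aseries c = (\<lambda>x. \<Sum>i. t (q i) x)" by (auto simp: sums_iff)
  have tL: "t k \<in> Lp a 2" if "k \<in> Q" for k
    using Lp2_cmult[OF Lp2_cis_minus[OF that], of "c k / sqrt V"] by (simp add: t_def[abs_def])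
  have per: "periodic a (aseries c)"
    using Lp2D(1)[OF tL[OF qQ]] by (simp add: periodic_def eq)
  have meas: "aseries c \<in> borel_measurable lebesgue"
    using Lp2D(2)[OF tL[OF qQ]] unfolding eq by (rule borel_measurable_suminf)
  have bd: "norm (aseries c x) \<le> (\<Sum>\<^sub>\<infinity>k\<in>Q. norm (c k) / sqrt V)" for x
    using norm_infsum_bound[OF ts[of x]] by (simp only: nt aseries_def t_def[symmetric])
  then show "\<exists>B. \<forall>x. norm (aseries c x) \<le> B" by blast
  show L2: "aseries c \<in> Lp a 2" using per meas bd by (rule Lp2_bounded)
  assume k: "k \<in> Q"
  have sn: "summable (\<lambda>i. norm (c (q i)) / sqrt V)"
  proof -
    have "(\<lambda>i. norm (c (q i)) / sqrt V) summable_on UNIV"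
      by (rule summable_on_reindex_bij_betw[OF q, THEN iffD2]) (rule ns)
    then obtain S where "((\<lambda>i. norm (c (q i)) / sqrt V) has_sum S) UNIV" unfolding summable_on_def by blast
    then show ?thesis by (rule sums_summable[OF has_sum_imp_sums])
  qed
  have "(\<lambda>i. LINT x|M. cis (k \<bullet> x) * t (q i) x) sums (LINT x|M. (\<Sum>i. cis (k \<bullet> x) * t (q i) x))"
  proof (rule sums_integral)
    show "integrable M (\<lambda>x. cis (k \<bullet> x) * t (q i) x)" for i
      by (intro integrable_cis_mult Lp2_imp_Lp1 tL qQ)
    show "AE x in M. summable (\<lambda>i. norm (cis (k \<bullet> x) * t (q i) x))"
      using sn by (simp add: norm_mult nt)
    show "summable (\<lambda>i. LINT x|M. norm (cis (k \<bullet> x) * t (q i) x))"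
      using summable_mult[OF sn, of V] by (simp add: norm_mult nt integral_const_M measure_M)
  qed
  also have "(LINT x|M. (\<Sum>i. cis (k \<bullet> x) * t (q i) x)) = (LINT x|M. cis (k \<bullet> x) * aseries c x)"
    using sm by (simp add: eq suminf_mult sums_iff)
  finally have "(\<lambda>i. (LINT x|M. cis (k \<bullet> x) * t (q i) x) / sqrt V) sums ((LINT x|M. cis (k \<bullet> x) * aseries c x) / sqrt V)"
    by (rule sums_divide)
  then have l: "(\<lambda>i. fc (t (q i)) k) sums (fc (aseries c) k)" by (simp add: fc_eq)
  from k obtain j where j: "k = q j" using q by (auto simp: bij_betw_def)
  have "fc (t (q i)) k = (if i = j then c k else 0)" for i
  proof -
    have "t (q i) = (\<lambda>x. (c (q i) / sqrt V) * cis (- (q i \<bullet> x)))" by (auto simp: t_def)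
    then have "fc (t (q i)) k = (c (q i) / sqrt V) * fc (\<lambda>x. cis (- (q i \<bullet> x))) k" by (simp only: fc_cmult)
    moreover have "q j = q i \<longleftrightarrow> i = j" using q by (auto simp: bij_betw_def inj_eq)
    ultimately show ?thesis using V_pos fc_cis[OF k qQ[of i]] by (auto simp: j)
  qed
  then have "(\<lambda>i. fc (t (q i)) k) sums c k"
    using sums_single[of j "\<lambda>_. c k"] by simp
  with l show "fc (aseries c) k = c k" by (rule sums_unique2)
qed

end

section \<open>Weak derivatives\<close>

lemma summable_on_finite_sum:
  fixes f :: "'i \<Rightarrow> 'a \<Rightarrow> real"
  shows "(\<And>i. i \<in> I \<Longrightarrow> f i summable_on A) \<Longrightarrow> (\<lambda>x. \<Sum>i\<in>I. f i x) summable_on A"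
  by (induction I rule: infinite_finite_induct) (auto intro: summable_on_add)

context torus begin

section \<open>Exponentials as test functions\<close>

lemma has_derivative_cis:
  "((\<lambda>x. c * cis (k \<bullet> x)) has_derivative (\<lambda>h. \<i> * of_real (k \<bullet> h) * (c * cis (k \<bullet> x)))) (at x)"
proof -
  have "((\<lambda>x. \<i> * complex_of_real (k \<bullet> x)) has_derivative (\<lambda>h. \<i> * complex_of_real (k \<bullet> h))) (at x)"
    by (auto intro!: derivative_eq_intros)
  then have "((\<lambda>x. exp (\<i> * complex_of_real (k \<bullet> x))) has_derivative
      (\<lambda>h. exp (\<i> * complex_of_real (k \<bullet> x)) * (\<i> * complex_of_real (k \<bullet> h)))) (at x)"
    by (rule has_derivative_compose[OF _ DERIV_exp[THEN has_field_derivative_imp_has_derivative]])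
  from has_derivative_mult_right[OF this, of c] show ?thesis
    unfolding cis_conv_exp by (simp add: mult_ac)
qed

lemma partial_deriv_eqI:
  "(f has_derivative f') (at x) \<Longrightarrow> partial_deriv l f x = f' (axis l 1)"
  unfolding partial_deriv_def by (metis frechet_derivative_at)

lemma partial_deriv_cis: "partial_deriv l (\<lambda>x. c * cis (k \<bullet> x)) = (\<lambda>x. (\<i> * of_real (k $ l) * c) * cis (k \<bullet> x))"
  by (rule ext, subst partial_deriv_eqI[OF has_derivative_cis]) (simp add: inner_axis)

lemma continuously_diff_cis: "continuously_diff n (\<lambda>x. c * cis (k \<bullet> x))"
proof (induction n arbitrary: c)
  case 0
  show ?case by (auto intro!: continuous_intros)
next
  case (Suc n)
  have "(\<lambda>x. c * cis (k \<bullet> x)) differentiable (at x)" for x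
    using has_derivative_cis unfolding differentiable_def by blast
  with Suc show ?case by (simp add: partial_deriv_cis)
qed

lemma test_function_cis: "k \<in> Q \<Longrightarrow> (\<lambda>x. cis (k \<bullet> x)) \<in> test_functions a"
  using continuously_diff_cis[of _ 1 k] periodic_cis[of k] by (simp add: test_functions_def)

text \<open>The exponential with frequency \<open>k\<close> is itself a test function, and
  differentiating it brings down the factor \<open>\<i> * k $ l\<close>.\<close>

lemma fc_weak_deriv:
  assumes "has_weak_deriv a l f g" "k \<in> Q"
  shows "fc g k = - \<i> * of_real (k $ l) * fc f k"
proof -
  have "(LINT x|M. f x * partial_deriv l (\<lambda>x. cis (k \<bullet> x)) x) = - (LINT x|M. g x * cis (k \<bullet> x))"
    using assms test_function_cis unfolding has_weak_deriv_def by blast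
  moreover have "partial_deriv l (\<lambda>x. cis (k \<bullet> x)) = (\<lambda>x. (\<i> * of_real (k $ l)) * cis (k \<bullet> x))"
    using partial_deriv_cis[of l 1 k] by simp
  ultimately have "(LINT x|M. (\<i> * of_real (k $ l)) * (cis (k \<bullet> x) * f x)) = - (LINT x|M. cis (k \<bullet> x) * g x)"
    by (simp add: mult_ac)
  then have "- ((\<i> * of_real (k $ l)) * (LINT x|M. cis (k \<bullet> x) * f x)) = (LINT x|M. cis (k \<bullet> x) * g x)"
    by (simp only: integral_mult_right_zero) simp
  then show ?thesis by (simp add: fc_eq)
qed

section \<open>Integration by parts on the torus\<close>

lemma continuous_periodic_bounded:
  fixes v :: "real^3 \<Rightarrow> complex"
  assumes "periodic a v" "continuous_on UNIV v" shows "\<exists>B. \<forall>x. norm (v x) \<le> B"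
proof -
  have "bounded (v ` ccell)"
    by (intro compact_imp_bounded compact_continuous_image compact_ccell continuous_on_subset[OF assms(2)]) auto
  then obtain B where B: "\<And>x. x \<in> ccell \<Longrightarrow> norm (v x) \<le> B" by (auto simp: bounded_iff)
  have "norm (v x) \<le> B" for x
    using B[OF subsetD[OF cell_subset_ccell reduce_cell[of x]]] periodic_reduce[OF assms(1)] by simp
  then show ?thesis by blast
qed

lemma continuous_periodic_Lp2:
  fixes v :: "real^3 \<Rightarrow> complex"
  assumes "periodic a v" "continuous_on UNIV v" shows "v \<in> Lp a 2"
proof -
  obtain B where "\<And>x. norm (v x) \<le> B" using continuous_periodic_bounded[OF assms] by blast
  moreover have "v \<in> borel_measurable lebesgue"
    using borel_measurable_continuous_onI[OF assms(2)] by (simp add: measurable_completion)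
  ultimately show ?thesis using assms by (intro Lp2_bounded)
qed

lemma periodic_partial:
  assumes "periodic a u" "\<And>x. u differentiable (at x)" shows "periodic a (partial_deriv l u)"
  unfolding periodic_def
proof (intro ballI allI)
  fix g x assume g: "g \<in> lattice a"
  have "(u has_derivative frechet_derivative u (at (x + g))) (at (x + g))"
    using assms(2) frechet_derivative_works by blast
  then have "((\<lambda>y. u (y + g)) has_derivative (\<lambda>h. frechet_derivative u (at (x + g)) h)) (at x)"
    by (rule has_derivative_compose[rotated, where f = "\<lambda>y. y + g"]) (auto intro!: derivative_eq_intros)
  moreover have "(\<lambda>y. u (y + g)) = u" using assms(1) g by (auto simp: periodic_def)
  ultimately have "(u has_derivative frechet_derivative u (at (x + g))) (at x)" by simp
  then show "partial_deriv l u (x + g) = partial_deriv l u x"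
    by (simp add: partial_deriv_eqI) (simp add: partial_deriv_def)
qed

text \<open>The difference quotients have vanishing integral by translation invariance.\<close>

lemma integral_partial_deriv:
  assumes per: "periodic a u" and diff: "\<And>x. u differentiable (at x)"
    and cont: "continuous_on UNIV (partial_deriv l u)"
  shows "(LINT x|M. partial_deriv l u x) = 0"
proof -
  define e :: "real^3" where "e = axis l 1"
  define v where "v = partial_deriv l u"
  have cu: "continuous_on UNIV u"
    using diff differentiable_imp_continuous_within by (auto simp: continuous_on_eq_continuous_within)
  have uL: "u \<in> Lp a 2" by (rule continuous_periodic_Lp2[OF per cu])
  have vL: "v \<in> Lp a 2" unfolding v_def by (rule continuous_periodic_Lp2[OF periodic_partial[OF per diff] cont])
  obtain B where B: "\<And>x. norm (v x) \<le> B"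
    using continuous_periodic_bounded[OF periodic_partial[OF per diff] cont] by (auto simp: v_def)
  have line: "((\<lambda>t. u (x + t *\<^sub>R e)) has_derivative (\<lambda>h. h *\<^sub>R v (x + t *\<^sub>R e))) (at t)" for x t
  proof -
    have ud: "(u has_derivative frechet_derivative u (at (x + t *\<^sub>R e))) (at (x + t *\<^sub>R e))"
      using diff frechet_derivative_works by blast
    have "((\<lambda>t. u (x + t *\<^sub>R e)) has_derivative (\<lambda>h. frechet_derivative u (at (x + t *\<^sub>R e)) (h *\<^sub>R e))) (at t)"
      by (rule has_derivative_compose[where f = "\<lambda>t. x + t *\<^sub>R e" and g = u, OF _ ud]) (auto intro!: derivative_eq_intros)
    moreover have "frechet_derivative u (at (x + t *\<^sub>R e)) (h *\<^sub>R e) = h *\<^sub>R v (x + t *\<^sub>R e)" for h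
      using linear_scale[OF has_derivative_linear[OF ud]] by (simp add: v_def partial_deriv_def e_def)
    ultimately show ?thesis by simp
  qed
  define h where "h n = 1 / (1 + real n)" for n
  have h: "h n > 0" for n by (simp add: h_def)
  have h0: "h \<longlonglongrightarrow> 0" unfolding h_def[abs_def] using LIMSEQ_inverse_real_of_nat by (simp add: inverse_eq_divide)
  define d where "d n x = (u (x + h n *\<^sub>R e) - u x) /\<^sub>R h n" for n x
  \<comment> \<open>The mean value inequality bounds all difference quotients by the supremum of the
    derivative, the dominating constant below.\<close>
  have dB: "norm (d n x) \<le> B" for n x
  proof -
    have "norm (u (x + h n *\<^sub>R e) - u (x + 0 *\<^sub>R e)) \<le> B * norm (h n - 0)"
    proof (rule differentiable_bound[where S = UNIV])
      show "((\<lambda>t. u (x + t *\<^sub>R e)) has_derivative (\<lambda>h. h *\<^sub>R v (x + t *\<^sub>R e))) (at t within UNIV)" for t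
        using line by simp
      show "onorm (\<lambda>h. h *\<^sub>R v (x + t *\<^sub>R e)) \<le> B" for t
        using mult_left_mono[OF B[of "x + t *\<^sub>R e"] abs_ge_zero] by (intro onorm_le) (simp add: mult.commute)
    qed auto
    moreover have "norm (d n x) = norm (u (x + h n *\<^sub>R e) - u x) / h n"
      using h[of n] by (simp add: d_def divide_inverse mult.commute)
    ultimately show ?thesis using h[of n] by (simp add: pos_divide_le_eq)
  qed
  have dlim: "(\<lambda>n. d n x) \<longlonglongrightarrow> v x" for x
  proof -
    have "((\<lambda>t. (1 / norm (t - 0)) *\<^sub>R (u (x + t *\<^sub>R e) - (u (x + 0 *\<^sub>R e) + (t - 0) *\<^sub>R v (x + 0 *\<^sub>R e)))) \<longlongrightarrow> 0) (at 0)"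
      using line[of x 0] unfolding has_derivative_def by (simp add: has_derivative_within Lim_within divide_inverse netlimit_at diff_diff_eq)
    moreover have "filterlim h (at 0) sequentially"
      using h0 h unfolding filterlim_at by (auto intro!: always_eventually) (metis less_irrefl)
    ultimately have "(\<lambda>n. (1 / norm (h n - 0)) *\<^sub>R (u (x + h n *\<^sub>R e) - (u (x + 0 *\<^sub>R e) + (h n - 0) *\<^sub>R v (x + 0 *\<^sub>R e)))) \<longlonglongrightarrow> 0"
      by (rule filterlim_compose)
    moreover have "(1 / norm (h n - 0)) *\<^sub>R (u (x + h n *\<^sub>R e) - (u (x + 0 *\<^sub>R e) + (h n - 0) *\<^sub>R v (x + 0 *\<^sub>R e))) = d n x - v x" for n
      using h[of n] by (simp add: d_def scaleR_diff_right scaleR_add_right divide_inverse)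
    ultimately show ?thesis by (simp add: LIM_zero_iff)
  qed
  have d0: "(LINT x|M. d n x) = 0" for n
  proof -
    have i: "integrable M (\<lambda>x. u (x + h n *\<^sub>R e))" by (rule integrable_translate[OF Lp2D(1,4)[OF uL]])
    have "(LINT x|M. d n x) = (LINT x|M. u (x + h n *\<^sub>R e) - u x) /\<^sub>R h n"
      unfolding d_def by (rule integral_scaleR_right)
    also have "(LINT x|M. u (x + h n *\<^sub>R e) - u x) = 0"
      using i Lp2D(4)[OF uL] integral_translate[OF Lp2D(1,3)[OF uL]] by simp
    finally show ?thesis by simp
  qed
  have "(\<lambda>n. LINT x|M. d n x) \<longlonglongrightarrow> (LINT x|M. v x)"
  proof (rule integral_dominated_convergence)
    show "integrable M (\<lambda>_. B)" by (rule finite_measure.integrable_const[OF finite_M])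
    show "v \<in> borel_measurable M" by (rule Lp2D(3)[OF vL])
    show "d n \<in> borel_measurable M" for n
    proof -
      have "(\<lambda>x. u (x + h n *\<^sub>R e)) \<in> borel_measurable M"
        using borel_measurable_integrable[OF integrable_translate[OF Lp2D(1,4)[OF uL]]] .
      then show ?thesis unfolding d_def[abs_def] using Lp2D(3)[OF uL] by (intro borel_measurable_scaleR borel_measurable_diff borel_measurable_const)
    qed
  qed (use dlim dB in auto)
  then show ?thesis using LIMSEQ_const_iff by (simp add: d0 v_def LIMSEQ_const_iff)
qed

lemma test_functionD:
  assumes "u \<in> test_functions a"
  shows "periodic a u" "u differentiable (at x)" "continuous_on UNIV u" "continuous_on UNIV (partial_deriv l u)"
proof -
  have "continuously_diff 0 u" "continuously_diff (Suc 0) u" using assms unfolding test_functions_def by blast+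
  then show "u differentiable (at x)" "continuous_on UNIV u" "continuous_on UNIV (partial_deriv l u)" by auto
  show "periodic a u" using assms unfolding test_functions_def by blast
qed

text \<open>The derivative of \<open>cis (k \<bullet> x) * u x\<close> has integral zero, and the
  product rule splits that integral into the two coefficients.\<close>

lemma fc_partial_deriv:
  assumes u: "periodic a u" "\<And>x. u differentiable (at x)" "continuous_on UNIV u" "continuous_on UNIV (partial_deriv l u)"
    and k: "k \<in> Q"
  shows "fc (partial_deriv l u) k = - \<i> * of_real (k $ l) * fc u k"
proof -
  define w where "w x = cis (k \<bullet> x) * u x" for x
  have dw: "(w has_derivative (\<lambda>h. cis (k \<bullet> x) * frechet_derivative u (at x) h + (\<i> * of_real (k \<bullet> h) * cis (k \<bullet> x)) * u x)) (at x)" for x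
    unfolding w_def
    using has_derivative_mult[OF has_derivative_cis[of 1 k x, simplified] frechet_derivative_works[THEN iffD1, OF u(2)[of x]]]
    by simp
  have pw: "partial_deriv l w = (\<lambda>x. cis (k \<bullet> x) * partial_deriv l u x + (\<i> * of_real (k $ l)) * (cis (k \<bullet> x) * u x))"
    by (rule ext, subst partial_deriv_eqI[OF dw]) (simp add: inner_axis partial_deriv_def)
  have "(LINT x|M. partial_deriv l w x) = 0"
  proof (rule integral_partial_deriv)
    show "periodic a w" using u(1) cis_periodic[OF k] by (simp add: periodic_def w_def)
    show "w differentiable (at x)" for x using dw by (auto simp: differentiable_def)
    show "continuous_on UNIV (partial_deriv l w)"
      unfolding pw by (intro continuous_intros u(3,4))
  qed
  moreover have i: "integrable M (\<lambda>x. cis (k \<bullet> x) * partial_deriv l u x)" "integrable M (\<lambda>x. cis (k \<bullet> x) * u x)"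
    by (intro integrable_cis_mult Lp2_imp_Lp1 continuous_periodic_Lp2 periodic_partial u)+
  ultimately have "(LINT x|M. cis (k \<bullet> x) * partial_deriv l u x) + (\<i> * of_real (k $ l)) * (LINT x|M. cis (k \<bullet> x) * u x) = 0"
    by (simp add: pw)
  then have "(LINT x|M. cis (k \<bullet> x) * partial_deriv l u x) = - (\<i> * of_real (k $ l)) * (LINT x|M. cis (k \<bullet> x) * u x)"
    by (simp add: add_eq_0_iff2)
  then show ?thesis by (simp add: fc_eq)
qed

text \<open>Parseval turns both sides of the defining identity into sums over \<open>Q\<close> that
  agree term by term. The identity is bilinear while Parseval is sesquilinear, hence the conjugates
  around the test function.\<close>

lemma has_weak_deriv_fourier:
  assumes f: "f \<in> Lp a 2" and g: "g \<in> Lp a 2"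
    and fg: "\<And>k. k \<in> Q \<Longrightarrow> fc g k = - \<i> * of_real (k $ l) * fc f k"
  shows "has_weak_deriv a l f g"
  unfolding has_weak_deriv_def
proof (intro conjI ballI)
  show "f \<in> Lp a 1" "g \<in> Lp a 1" using f g Lp2_imp_Lp1 by auto
  fix u assume "u \<in> test_functions a"
  note u = test_functionD[OF this]
  have uL: "u \<in> Lp a 2" and pL: "partial_deriv l u \<in> Lp a 2"
    by (intro continuous_periodic_Lp2 periodic_partial u)+
  have "((\<lambda>k. fc f k * cnj (fc (\<lambda>x. cnj (partial_deriv l u x)) k)) has_sum (LINT x|M. f x * partial_deriv l u x)) Q"
    using parseval[OF f Lp2_cnj[OF pL]] by simp
  moreover have "((\<lambda>k. - (fc g k * cnj (fc (\<lambda>x. cnj (u x)) k))) has_sum - (LINT x|M. g x * u x)) Q"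
    using has_sum_uminusI[OF parseval[OF g Lp2_cnj[OF uL]]] by simp
  moreover have "fc f k * cnj (fc (\<lambda>x. cnj (partial_deriv l u x)) k) = - (fc g k * cnj (fc (\<lambda>x. cnj (u x)) k))" if "k \<in> Q" for k
    using that by (simp add: fc_cnj fc_partial_deriv[OF u] fg Q_closed)
  ultimately show "(LINT x|M. f x * partial_deriv l u x) = - (LINT x|M. g x * u x)"
    by (metis (no_types, lifting) has_sum_cong has_sum_unique)
qed

text \<open>Riesz--Fischer produces one weak derivative, so the choice operator in
  \<open>weak_deriv\<close> does return a weak derivative. Uniqueness of coefficients identifies the
  two almost everywhere, which transfers square integrability.\<close>

lemma weak_deriv_L2:
  assumes f: "f \<in> Lp a 2" and s: "(\<lambda>k. (k $ l)\<^sup>2 * (norm (fc f k))\<^sup>2) summable_on Q"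
  shows "has_weak_deriv a l f (weak_deriv a l f)" "weak_deriv a l f \<in> Lp a 2"
    "k \<in> Q \<Longrightarrow> fc (weak_deriv a l f) k = - \<i> * of_real (k $ l) * fc f k"
proof -
  have "(\<lambda>k. (norm (- \<i> * of_real (k $ l) * fc f k))\<^sup>2) summable_on Q"
    using s by (simp add: norm_mult power_mult_distrib)
  then obtain g where g: "g \<in> Lp a 2" "\<forall>k\<in>Q. fc g k = - \<i> * of_real (k $ l) * fc f k"
    using riesz_fischer[of "\<lambda>k. - \<i> * of_real (k $ l) * fc f k"] by blast
  then have "has_weak_deriv a l f g" by (intro has_weak_deriv_fourier f) auto
  then show w: "has_weak_deriv a l f (weak_deriv a l f)" unfolding weak_deriv_def by (rule someI[where P = "has_weak_deriv a l f"])
  then have L1: "weak_deriv a l f \<in> Lp a 1" unfolding has_weak_deriv_def by blast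
  have "AE x in lebesgue. g x = weak_deriv a l f x"
    by (rule fc_unique) (use g L1 fc_weak_deriv[OF w] in \<open>auto intro: Lp2_imp_Lp1\<close>)
  then show "weak_deriv a l f \<in> Lp a 2" by (rule Lp2_cong_AE[OF g(1) L1])
  show "k \<in> Q \<Longrightarrow> fc (weak_deriv a l f) k = - \<i> * of_real (k $ l) * fc f k" by (rule fc_weak_deriv[OF w])
qed

section \<open>Sobolev spaces as weighted sequence spaces\<close>

lemma inner_self_vec: "k \<bullet> k = (\<Sum>l\<in>UNIV. (k $ l)\<^sup>2)" for k :: "real^3"
  by (simp add: inner_vec_def power2_eq_square)

lemma component_le_inner: "(k $ l)\<^sup>2 \<le> k \<bullet> k" for k :: "real^3"
  unfolding inner_self_vec by (rule member_le_sum) auto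

text \<open>The component weights \<open>(k $ l)\<^sup>2\<close> add up to
  \<open>k \<bullet> k\<close> in one direction and are dominated by it in the other.\<close>

lemma Sobolev_1_iff:
  "f \<in> Sobolev a 1 \<longleftrightarrow> f \<in> Lp a 2 \<and> (\<lambda>k. (k \<bullet> k) * (norm (fc f k))\<^sup>2) summable_on Q"
proof
  assume "f \<in> Sobolev a 1"
  then have f: "f \<in> Lp a 2" "\<forall>l. \<exists>g\<in>Lp a 2. has_weak_deriv a l f g" by (simp_all add: One_nat_def)
  then obtain g where g: "\<And>l. g l \<in> Lp a 2" "\<And>l. has_weak_deriv a l f (g l)" by metis
  have "(\<lambda>k. \<Sum>l\<in>UNIV. (norm (fc (g l) k))\<^sup>2) summable_on Q"
    by (intro summable_on_finite_sum fc_summable g)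
  moreover have "(\<Sum>l\<in>UNIV. (norm (fc (g l) k))\<^sup>2) = (k \<bullet> k) * (norm (fc f k))\<^sup>2" if "k \<in> Q" for k
    using fc_weak_deriv[OF g(2) that] by (simp add: norm_mult power_mult_distrib inner_self_vec sum_distrib_right)
  ultimately show "f \<in> Lp a 2 \<and> (\<lambda>k. (k \<bullet> k) * (norm (fc f k))\<^sup>2) summable_on Q"
    using f(1) summable_on_cong[of Q] by (metis (no_types, lifting))
next
  assume *: "f \<in> Lp a 2 \<and> (\<lambda>k. (k \<bullet> k) * (norm (fc f k))\<^sup>2) summable_on Q"
  have "(\<lambda>k. (k $ l)\<^sup>2 * (norm (fc f k))\<^sup>2) summable_on Q" for l
    by (rule summable_on_comparison_test[OF conjunct2[OF *]]) (auto intro: mult_right_mono component_le_inner)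
  then show "f \<in> Sobolev a 1" using * weak_deriv_L2 by (simp add: One_nat_def) blast
qed

lemma Sobolev_1D:
  assumes "f \<in> Sobolev a 1"
  shows "f \<in> Lp a 2" "(\<lambda>k. (k \<bullet> k) * (norm (fc f k))\<^sup>2) summable_on Q"
    "has_weak_deriv a l f (weak_deriv a l f)" "weak_deriv a l f \<in> Lp a 2"
    "k \<in> Q \<Longrightarrow> fc (weak_deriv a l f) k = - \<i> * of_real (k $ l) * fc f k"
proof -
  show 1: "f \<in> Lp a 2" "(\<lambda>k. (k \<bullet> k) * (norm (fc f k))\<^sup>2) summable_on Q" using assms by (auto simp: Sobolev_1_iff)
  have "(\<lambda>k. (k $ l)\<^sup>2 * (norm (fc f k))\<^sup>2) summable_on Q" for l
    by (rule summable_on_comparison_test[OF 1(2)]) (auto intro: mult_right_mono component_le_inner)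
  then show "has_weak_deriv a l f (weak_deriv a l f)" "weak_deriv a l f \<in> Lp a 2"
    "k \<in> Q \<Longrightarrow> fc (weak_deriv a l f) k = - \<i> * of_real (k $ l) * fc f k"
    using weak_deriv_L2[OF 1(1)] by auto
qed

lemma Sobolev_2:
  assumes f: "f \<in> Lp a 2" and s: "(\<lambda>k. (k \<bullet> k)\<^sup>2 * (norm (fc f k))\<^sup>2) summable_on Q"
  shows "f \<in> Sobolev a 2" "f \<in> Sobolev a 1"
    "weak_laplacian a f \<in> Lp a 2" "k \<in> Q \<Longrightarrow> fc (weak_laplacian a f) k = - of_real (k \<bullet> k) * fc f k"
proof -
  have "(\<lambda>k. (norm (fc f k))\<^sup>2 + (k \<bullet> k)\<^sup>2 * (norm (fc f k))\<^sup>2) summable_on Q"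
    by (intro summable_on_add fc_summable f s)
  \<comment> \<open>The intermediate weight is controlled by the outer two through
    \<open>le_one_plus_square\<close> at \<open>k \<bullet> k\<close>.\<close>
  then have s1: "(\<lambda>k. (k \<bullet> k) * (norm (fc f k))\<^sup>2) summable_on Q"
  proof (rule summable_on_comparison_test)
    show "(k \<bullet> k) * (norm (fc f k))\<^sup>2 \<le> (norm (fc f k))\<^sup>2 + (k \<bullet> k)\<^sup>2 * (norm (fc f k))\<^sup>2" for k
      using mult_right_mono[OF le_one_plus_square[of "k \<bullet> k"], of "(norm (fc f k))\<^sup>2"] by (simp add: algebra_simps)
  qed auto
  then show f1: "f \<in> Sobolev a 1" using f by (simp add: Sobolev_1_iff)
  note d = Sobolev_1D[OF f1]
  have d1: "weak_deriv a l f \<in> Sobolev a 1" for l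
    unfolding Sobolev_1_iff
  proof
    show "(\<lambda>k. (k \<bullet> k) * (norm (fc (weak_deriv a l f) k))\<^sup>2) summable_on Q"
    proof (rule summable_on_comparison_test[OF s])
      fix k assume k: "k \<in> Q"
      have "(k \<bullet> k) * (norm (fc (weak_deriv a l f) k))\<^sup>2 = (k \<bullet> k) * ((k $ l)\<^sup>2 * (norm (fc f k))\<^sup>2)"
        using d(5)[OF k] by (simp add: norm_mult power_mult_distrib)
      also have "\<dots> \<le> (k \<bullet> k) * ((k \<bullet> k) * (norm (fc f k))\<^sup>2)"
        by (intro mult_left_mono mult_right_mono component_le_inner) auto
      finally show "(k \<bullet> k) * (norm (fc (weak_deriv a l f) k))\<^sup>2 \<le> (k \<bullet> k)\<^sup>2 * (norm (fc f k))\<^sup>2"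
        by (simp add: power2_eq_square mult.assoc)
    qed auto
  qed (rule d)
  have "Sobolev a 2 = {f \<in> Lp a 2. \<forall>k. \<exists>g\<in>Sobolev a 1. has_weak_deriv a k f g}"
    by (simp only: numeral_2_eq_2 One_nat_def Sobolev.simps)
  then show "f \<in> Sobolev a 2" using f d1 d(3) by blast
  note dd = Sobolev_1D[OF d1]
  show "weak_laplacian a f \<in> Lp a 2" unfolding weak_laplacian_def[abs_def] by (intro Lp2_sum dd(4))
  assume k: "k \<in> Q"
  have "fc (weak_laplacian a f) k = (\<Sum>l\<in>UNIV. fc (weak_deriv a l (weak_deriv a l f)) k)"
    unfolding weak_laplacian_def[abs_def] by (intro fc_sum dd(4))
  also have "\<dots> = (\<Sum>l\<in>UNIV. - of_real ((k $ l)\<^sup>2) * fc f k)"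
    using dd(5)[OF k] d(5)[OF k] by (intro sum.cong refl) (simp add: power2_eq_square mult_ac)
  also have "\<dots> = - of_real (k \<bullet> k) * fc f k" by (simp add: inner_self_vec sum_distrib_right sum_negf)
  finally show "fc (weak_laplacian a f) k = - of_real (k \<bullet> k) * fc f k" .
qed

end

section \<open>The energy in Fourier space\<close>

lemma has_sum_finite_sum:
  fixes f :: "'i \<Rightarrow> 'a \<Rightarrow> 'b::{topological_ab_group_add, t2_space}"
  shows "(\<And>i. i \<in> I \<Longrightarrow> (f i has_sum s i) A) \<Longrightarrow> ((\<lambda>x. \<Sum>i\<in>I. f i x) has_sum (\<Sum>i\<in>I. s i)) A"
proof (induction I rule: infinite_finite_induct)
  case (insert i I)
  then have "((\<lambda>x. f i x + (\<Sum>i\<in>I. f i x)) has_sum (s i + (\<Sum>i\<in>I. s i))) A"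
    by (intro has_sum_add) auto
  then show ?case using insert by simp
qed auto

lemma of_real_measurable: "f \<in> borel_measurable N \<Longrightarrow> (\<lambda>x. complex_of_real (f x)) \<in> borel_measurable N"
  by (rule measurable_compose[OF _ borel_measurable_continuous_onI[of complex_of_real]]) (auto intro: continuous_intros)

context torus begin

lemma Q_uminus_bij: "bij_betw uminus Q Q"
  by (rule bij_betwI[of _ _ _ uminus]) (auto simp: Q_closed)

text \<open>For nonzero \<open>k\<close> some \<open>k \<bullet> a j\<close> is a nonzero multiple
  of \<open>2 * pi\<close>, so Cauchy--Schwarz bounds |k| from below. At \<open>k = 0\<close> the
  left side is zero by the convention on division.\<close>

lemma Q_gap: "\<exists>C>0. \<forall>k\<in>Q. 1 / (k \<bullet> k) \<le> C * (1 / (1 + k \<bullet> k))"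
proof -
  define A where "A = (\<Sum>j\<in>UNIV. a j \<bullet> a j)"
  have A: "A \<ge> 0" unfolding A_def by (intro sum_nonneg) auto
  have "1 / (k \<bullet> k) \<le> (1 + A) * (1 / (1 + k \<bullet> k))" if k: "k \<in> Q" for k
  proof (cases "k = 0")
    case False
    then obtain j where j: "k \<bullet> a j \<noteq> 0" using inner_a_eq_0_imp by blast
    obtain n :: int where n: "(k \<bullet> a j) / (2 * pi) = of_int n" using k unfolding Q_iff by (auto elim: Ints_cases)
    then have n': "k \<bullet> a j = 2 * pi * of_int n" by (simp add: field_simps)
    then have "n \<noteq> 0" using j by auto
    then have "1 \<le> \<bar>real_of_int n\<bar>" by linarith
    moreover have "1 \<le> 2 * pi" using pi_gt3 by simp
    ultimately have "1 * 1 \<le> (2 * pi) * \<bar>real_of_int n\<bar>" by (intro mult_mono) auto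
    then have "1 \<le> \<bar>k \<bullet> a j\<bar>" by (simp add: n' abs_mult)
    then have "1 \<le> (k \<bullet> a j)\<^sup>2" by (metis one_le_power power2_abs)
    also have "\<dots> \<le> (k \<bullet> k) * (a j \<bullet> a j)" by (rule Cauchy_Schwarz_ineq)
    also have "\<dots> \<le> (k \<bullet> k) * A" unfolding A_def by (intro mult_left_mono member_le_sum) auto
    finally have "1 + k \<bullet> k \<le> (1 + A) * (k \<bullet> k)" by (simp add: algebra_simps)
    then show ?thesis using False by (simp add: divide_simps mult.commute add_pos_nonneg)
  qed (use A in auto)
  then show ?thesis using A by (intro exI[of _ "1 + A"]) auto
qed

lemma inverse_square_summable: "(\<lambda>k. (1 / (k \<bullet> k))\<^sup>2) summable_on Q"
proof -
  obtain C where C: "C > 0" "\<And>k. k \<in> Q \<Longrightarrow> 1 / (k \<bullet> k) \<le> C * (1 / (1 + k \<bullet> k))" using Q_gap by blast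
  have "(\<lambda>k. C\<^sup>2 * (1 / (1 + k \<bullet> k)\<^sup>2)) summable_on Q" by (rule summable_on_cmult_right[OF summable_Q_weight])
  then show ?thesis
  proof (rule summable_on_comparison_test)
    fix k assume "k \<in> Q"
    have "(1 / (k \<bullet> k))\<^sup>2 \<le> (C * (1 / (1 + k \<bullet> k)))\<^sup>2" by (intro power_mono C \<open>k \<in> Q\<close>) simp
    then show "(1 / (k \<bullet> k))\<^sup>2 \<le> C\<^sup>2 * (1 / (1 + k \<bullet> k)\<^sup>2)" by (simp add: power_mult_distrib power_divide)
  qed simp
qed

section \<open>The electron density\<close>

definition dens :: "(real^3 \<Rightarrow> complex) \<Rightarrow> real^3 \<Rightarrow> complex" where
  "dens f x = complex_of_real ((cmod (f x))\<^sup>2)"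

lemma dens_eq: "dens f x = f x * cnj (f x)"
  unfolding dens_def by (rule complex_norm_square)

lemma dens_Lp1: "f \<in> Lp a 2 \<Longrightarrow> dens f \<in> Lp a 1"
  unfolding dens_eq[abs_def] by (intro Lp2_mult_Lp2 Lp2_cnj)

text \<open>Parseval for \<open>f\<close> and its product with an exponential: up to a constant, the
  coefficients of the density are the autocorrelation of those of \<open>f\<close>.\<close>

lemma fc_dens:
  assumes f: "f \<in> Lp a 2" and k: "k \<in> Q"
  shows "((\<lambda>l. fc f l * cnj (fc f (l - k))) has_sum (sqrt V * fc (dens f) k)) Q"
proof -
  have L: "(\<lambda>x. cis (- k \<bullet> x) * f x) \<in> Lp a 2"
    using Lp2_mult_bounded[OF f periodic_cis[OF Q_closed(4)[OF k]] borel_measurable_cis(1), of 1] by (simp add: mult.commute)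
  have "sqrt V * fc (dens f) k = (LINT x|M. cis (k \<bullet> x) * dens f x)"
    using V_pos by (simp add: fc_eq)
  also have "\<dots> = (LINT x|M. f x * cnj (cis (- k \<bullet> x) * f x))"
    by (simp add: dens_eq cis_cnj mult_ac)
  finally show ?thesis using parseval[OF f L] by (simp only: fc_shift) simp
qed

text \<open>A weighted Cauchy--Schwarz inequality for the convolution of the Fourier coefficients,
  using that the weights \<open>(1 + |k|\<^sup>2)\<^sup>-\<^sup>2\<close> are summable in dimension three.\<close>

lemma dens_Lp2:
  assumes f: "f \<in> Sobolev a 1"
  shows "dens f \<in> Lp a 2"
proof -
  note fL = Sobolev_1D(1)[OF f]
  \<comment> \<open>These terms sum to the squared H^1 norm \<open>W\<close>; \<open>G\<close> below
    is their autocorrelation.\<close>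
  define w where "w k = (1 + k \<bullet> k) * (norm (fc f k))\<^sup>2" for k
  define K where "K = (\<Sum>\<^sub>\<infinity>k\<in>Q. 1 / (1 + k \<bullet> k)\<^sup>2)"
  define W where "W = infsum w Q"
  have "(\<lambda>k. (norm (fc f k))\<^sup>2 + (k \<bullet> k) * (norm (fc f k))\<^sup>2) summable_on Q"
    by (intro summable_on_add fc_summable fL Sobolev_1D(2)[OF f])
  then have ws: "w summable_on Q" by (simp add: w_def[abs_def] algebra_simps)
  have w0: "w k \<ge> 0" for k by (simp add: w_def)
  have Wb: "sum w F \<le> W" if "finite F" "F \<subseteq> Q" for F
    unfolding W_def using finite_sum_le_infsum[OF ws that] w0 by auto
  have Kb: "(\<Sum>k\<in>F. 1 / (1 + k \<bullet> k)\<^sup>2) \<le> K" if "finite F" "F \<subseteq> Q" for F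
    unfolding K_def using finite_sum_le_infsum[OF summable_Q_weight that] by auto
  have K0: "K \<ge> 0" and W0: "W \<ge> 0" using Kb[of "{}"] Wb[of "{}"] by auto
  have wW: "w k \<le> W" if "k \<in> Q" for k using Wb[of "{k}"] that by auto
  define G where "G k = (\<Sum>\<^sub>\<infinity>l\<in>Q. w l * w (l - k))" for k
  have Gs: "(\<lambda>l. w l * w (l - k)) summable_on Q" if "k \<in> Q" for k
    by (rule summable_on_comparison_test[OF summable_on_cmult_left[OF ws, of W]])
      (use that w0 wW Q_closed in \<open>auto intro: mult_left_mono\<close>)
  have conv: "(norm (sqrt V * fc (dens f) k))\<^sup>2 \<le> K * G k" if k: "k \<in> Q" for k
  proof -
    have fin: "(\<Sum>l\<in>F. norm (fc f l * cnj (fc f (l - k)))) \<le> sqrt (K * G k)" if F: "finite F" "F \<subseteq> Q" for F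
    proof -
      \<comment> \<open>Cauchy--Schwarz will be applied to \<open>p * q\<close>: the inverse weights
        go into \<open>p\<close>, the weighted coefficients into \<open>q\<close>.\<close>
      define p where "p l = 1 / (sqrt (1 + l \<bullet> l) * sqrt (1 + (l - k) \<bullet> (l - k)))" for l
      define q where "q l = sqrt (w l) * sqrt (w (l - k))" for l
      have pq: "norm (fc f l * cnj (fc f (l - k))) = p l * q l" for l
      proof -
        have "sqrt (1 + l \<bullet> l) \<noteq> 0" for l :: "real^3"
          by (metis add_pos_nonneg inner_ge_zero less_irrefl real_sqrt_gt_0_iff zero_less_one)
        moreover have "sqrt (w l) = sqrt (1 + l \<bullet> l) * norm (fc f l)" for l by (simp add: w_def real_sqrt_mult)
        ultimately show ?thesis by (simp add: p_def q_def norm_mult)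
      qed
      have "(\<Sum>l\<in>F. (p l)\<^sup>2) \<le> K"
      proof -
        \<comment> \<open>The arithmetic-geometric mean inequality decouples \<open>l\<close> from
          \<open>l - k\<close>, so one constant \<open>K\<close> serves every shift.\<close>
        have "(p l)\<^sup>2 \<le> (1/2) * (1 / (1 + l \<bullet> l)\<^sup>2 + 1 / (1 + (l - k) \<bullet> (l - k))\<^sup>2)" for l
        proof -
          define s t where "s = 1 / (1 + l \<bullet> l)" and "t = 1 / (1 + (l - k) \<bullet> (l - k))"
          have "(p l)\<^sup>2 = s * t" by (simp add: p_def s_def t_def power_divide power_mult_distrib)
          also have "\<dots> \<le> (1/2) * (s\<^sup>2 + t\<^sup>2)" using sum_squares_bound[of s t] by simp
          finally show ?thesis by (simp add: s_def t_def power_divide)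
        qed
        then have "(\<Sum>l\<in>F. (p l)\<^sup>2) \<le> (\<Sum>l\<in>F. (1/2) * (1 / (1 + l \<bullet> l)\<^sup>2 + 1 / (1 + (l - k) \<bullet> (l - k))\<^sup>2))"
          by (intro sum_mono)
        also have "\<dots> = (1/2) * ((\<Sum>l\<in>F. 1 / (1 + l \<bullet> l)\<^sup>2) + (\<Sum>l\<in>(\<lambda>l. l - k) ` F. 1 / (1 + l \<bullet> l)\<^sup>2))"
        proof -
          have "inj_on (\<lambda>l. l - k) F" by (auto simp: inj_on_def)
          then show ?thesis by (simp only: sum.reindex o_def sum_distrib_left[symmetric] sum.distrib)
        qed
        also have "\<dots> \<le> (1/2) * (K + K)"
          using F k Q_closed by (intro mult_left_mono add_mono Kb) auto
        finally show ?thesis by simp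
      qed
      moreover have "(\<Sum>l\<in>F. (q l)\<^sup>2) \<le> G k"
      proof -
        have "(\<Sum>l\<in>F. (q l)\<^sup>2) = (\<Sum>l\<in>F. w l * w (l - k))"
          using w0 by (simp add: q_def power_mult_distrib)
        also have "\<dots> \<le> G k" unfolding G_def
          using finite_sum_le_infsum[OF Gs[OF k] F] w0 by auto
        finally show ?thesis .
      qed
      ultimately have "(\<Sum>l\<in>F. (p l)\<^sup>2) * (\<Sum>l\<in>F. (q l)\<^sup>2) \<le> K * G k"
        by (intro mult_mono) (auto simp: K0 sum_nonneg)
      moreover have "(\<Sum>l\<in>F. p l * q l)\<^sup>2 \<le> (\<Sum>l\<in>F. (p l)\<^sup>2) * (\<Sum>l\<in>F. (q l)\<^sup>2)"
        by (rule Cauchy_Schwarz_ineq_sum)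
      ultimately have "(\<Sum>l\<in>F. p l * q l)\<^sup>2 \<le> K * G k" by linarith
      then have "(\<Sum>l\<in>F. p l * q l) \<le> sqrt (K * G k)" by (rule real_le_rsqrt)
      then show ?thesis by (simp add: pq)
    qed
    have s: "(\<lambda>l. norm (fc f l * cnj (fc f (l - k)))) summable_on Q"
      by (rule nonneg_bdd_above_summable_on) (auto intro!: bdd_aboveI2[of _ _ "sqrt (K * G k)"] fin)
    have "norm (sqrt V * fc (dens f) k) \<le> (\<Sum>\<^sub>\<infinity>l\<in>Q. norm (fc f l * cnj (fc f (l - k))))"
      using norm_infsum_bound[OF s] infsumI[OF fc_dens[OF fL k]] by simp
    also have "\<dots> \<le> sqrt (K * G k)" by (rule infsum_le_finite_sums[OF s fin])
    finally have "(norm (sqrt V * fc (dens f) k))\<^sup>2 \<le> (sqrt (K * G k))\<^sup>2" by (intro power_mono) auto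
    moreover have "G k \<ge> 0" unfolding G_def by (intro infsum_nonneg) (auto simp: w0)
    ultimately show ?thesis using K0 by simp
  qed
  have "(\<lambda>k. (norm (fc (dens f) k))\<^sup>2) summable_on Q"
  proof (rule nonneg_bdd_above_summable_on)
    show "bdd_above (sum (\<lambda>k. (norm (fc (dens f) k))\<^sup>2) ` {F. F \<subseteq> Q \<and> finite F})"
    proof (rule bdd_aboveI2)
      fix F assume "F \<in> {F. F \<subseteq> Q \<and> finite F}"
      then have F: "F \<subseteq> Q" "finite F" by auto
      have hs: "((\<lambda>l. \<Sum>k\<in>F. w l * w (l - k)) has_sum (\<Sum>k\<in>F. G k)) Q"
        unfolding G_def using F by (intro has_sum_finite_sum has_sum_infsum Gs) auto
      \<comment> \<open>For fixed \<open>l\<close> the map from \<open>k\<close> to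
        \<open>l - k\<close> is injective, so the sum over \<open>k\<close> is at most
        \<open>W\<close>; summing over \<open>l\<close> then bounds the total of \<open>G\<close> by
        \<open>W * W\<close>.\<close>
      have "(\<Sum>k\<in>F. w l * w (l - k)) \<le> w l * W" if "l \<in> Q" for l
      proof -
        have "(\<Sum>k\<in>F. w (l - k)) = sum w ((\<lambda>k. l - k) ` F)" by (subst sum.reindex) (auto simp: inj_on_def)
        also have "\<dots> \<le> W" using F that Q_closed by (intro Wb) auto
        finally show ?thesis by (simp add: sum_distrib_left[symmetric] mult_left_mono w0)
      qed
      then have "(\<Sum>k\<in>F. G k) \<le> W * W"
        by (intro has_sum_mono[OF hs]) (auto simp: W_def intro!: has_sum_cmult_left has_sum_infsum ws)
      then have "K * (\<Sum>k\<in>F. G k) \<le> K * (W * W)" using K0 by (intro mult_left_mono)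
      moreover have "V * (\<Sum>k\<in>F. (norm (fc (dens f) k))\<^sup>2) \<le> K * (\<Sum>k\<in>F. G k)"
      proof -
        have "V * (\<Sum>k\<in>F. (norm (fc (dens f) k))\<^sup>2) = (\<Sum>k\<in>F. (norm (sqrt V * fc (dens f) k))\<^sup>2)"
          using V_pos by (simp add: sum_distrib_left norm_mult power_mult_distrib)
        also have "\<dots> \<le> (\<Sum>k\<in>F. K * G k)" using F by (intro sum_mono conv) auto
        finally show ?thesis by (simp add: sum_distrib_left)
      qed
      ultimately show "(\<Sum>k\<in>F. (norm (fc (dens f) k))\<^sup>2) \<le> K * (W * W) / V"
        using V_pos by (simp add: pos_le_divide_eq mult.commute)
    qed
  qed auto
  then obtain h where h: "h \<in> Lp a 2" "\<forall>k\<in>Q. fc h k = fc (dens f) k"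
    using riesz_fischer[of "fc (dens f)"] by blast
  have "AE x in lebesgue. h x = dens f x"
    by (rule fc_unique) (use h dens_Lp1[OF fL] in \<open>auto intro: Lp2_imp_Lp1\<close>)
  then show ?thesis by (rule Lp2_cong_AE[OF h(1) dens_Lp1[OF fL]])
qed

definition pot :: "(real^3 \<Rightarrow> complex) \<Rightarrow> real^3 \<Rightarrow> complex" where "pot = inv_laplacian a"

text \<open>The excluded zero mode can be put back, since dividing by
  \<open>k \<bullet> k = 0\<close> gives zero.\<close>

lemma pot_eq: "pot R = aseries (\<lambda>k. fc R k / complex_of_real (k \<bullet> k))"
proof
  fix x
  have "pot R x = (\<Sum>\<^sub>\<infinity>k\<in>Q - {0}. 1 / complex_of_real (sqrt V) * (fc R k / complex_of_real (k \<bullet> k) * cis (- (k \<bullet> x))))"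
    unfolding pot_def inv_laplacian_def V_def by (rule infsum_cmult_right'[symmetric])
  also have "\<dots> = aseries (\<lambda>k. fc R k / complex_of_real (k \<bullet> k)) x"
    unfolding aseries_def by (rule infsum_cong_neutral) auto
  finally show "pot R x = aseries (\<lambda>k. fc R k / complex_of_real (k \<bullet> k)) x" .
qed

text \<open>The coefficients are products of two square-summable families, so the series converges
  absolutely. The resulting uniform bound lets the potential multiply functions in
  \<open>Lp a 2\<close>.\<close>

lemma pot:
  assumes R: "R \<in> Lp a 2"
  shows "pot R \<in> Lp a 2" "k \<in> Q \<Longrightarrow> fc (pot R) k = fc R k / complex_of_real (k \<bullet> k)" "\<exists>B. \<forall>x. norm (pot R x) \<le> B"
proof -
  have "(\<lambda>k. norm (fc R k / complex_of_real (k \<bullet> k))) summable_on Q"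
  proof (rule summable_on_comparison_test)
    show "(\<lambda>k. (norm (fc R k))\<^sup>2 + (1 / (k \<bullet> k))\<^sup>2) summable_on Q"
      by (intro summable_on_add fc_summable R inverse_square_summable)
    from mult_le_sum_squares[of "norm (fc R k)" "1 / (k \<bullet> k)" for k]
    show "norm (fc R k / complex_of_real (k \<bullet> k)) \<le> (norm (fc R k))\<^sup>2 + (1 / (k \<bullet> k))\<^sup>2" for k
      by (simp add: norm_divide)
  qed auto
  from aseries[OF this]
  show "pot R \<in> Lp a 2" "k \<in> Q \<Longrightarrow> fc (pot R) k = fc R k / complex_of_real (k \<bullet> k)" "\<exists>B. \<forall>x. norm (pot R x) \<le> B"
    unfolding pot_eq by auto
qed

lemma fc_real: "fc (\<lambda>x. complex_of_real (r x)) (- k) = cnj (fc (\<lambda>x. complex_of_real (r x)) k)"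
  using fc_cnj[of "\<lambda>x. complex_of_real (r x)" "- k"] by simp

text \<open>Reindexing the sum from \<open>k\<close> to \<open>- k\<close> gives its
  conjugate.\<close>

lemma pot_real: "complex_of_real (Re (pot (\<lambda>x. complex_of_real (r x)) x)) = pot (\<lambda>x. complex_of_real (r x)) x"
proof -
  let ?t = "\<lambda>k. fc (\<lambda>x. complex_of_real (r x)) k / complex_of_real (k \<bullet> k) * (cis (- (k \<bullet> x)) / complex_of_real (sqrt V))"
  have "cnj (infsum ?t Q) = (\<Sum>\<^sub>\<infinity>k\<in>Q. cnj (?t k))" by (rule infsum_cnj[symmetric])
  also have "\<dots> = (\<Sum>\<^sub>\<infinity>k\<in>Q. ?t (- k))" by (simp add: fc_real cis_cnj)
  also have "\<dots> = infsum ?t Q" by (rule infsum_reindex_bij_betw[OF Q_uminus_bij])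
  finally show ?thesis unfolding pot_eq aseries_def by (simp add: complex_eq_iff)
qed

lemma energy_has_sum:
  fixes r :: "real^3 \<Rightarrow> real"
  assumes psi: "\<psi> \<in> Sobolev a 1" and R: "(\<lambda>x. complex_of_real (r x)) \<in> Lp a 2"
  shows "((\<lambda>k. A * ((k \<bullet> k) * (norm (fc \<psi> k))\<^sup>2) + 1 / 2 * ((norm (fc (\<lambda>x. complex_of_real (r x)) k))\<^sup>2 / (k \<bullet> k)))
    has_sum (LINT x|M. A * (norm (weak_grad a \<psi> x))\<^sup>2 + 1 / 2 * Re (pot (\<lambda>x. complex_of_real (r x)) x) * r x)) Q"
proof -
  let ?R = "\<lambda>x. complex_of_real (r x)"
  note d = Sobolev_1D[OF psi]
  have ng: "(norm (weak_grad a \<psi> x))\<^sup>2 = (\<Sum>l\<in>UNIV. (norm (weak_deriv a l \<psi> x))\<^sup>2)" for x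
    by (simp add: norm_vec_def L2_set_def weak_grad_def sum_nonneg)
  have gi: "integrable M (\<lambda>x. (norm (weak_grad a \<psi> x))\<^sup>2)"
    unfolding ng by (intro Bochner_Integration.integrable_sum Lp2D(5) d(4))
  have "((\<lambda>k. \<Sum>l\<in>UNIV. (norm (fc (weak_deriv a l \<psi>) k))\<^sup>2) has_sum (\<Sum>l\<in>UNIV. LINT x|M. (norm (weak_deriv a l \<psi> x))\<^sup>2)) Q"
    by (intro has_sum_finite_sum parseval_norm d(4))
  also have "(\<Sum>l\<in>UNIV. LINT x|M. (norm (weak_deriv a l \<psi> x))\<^sup>2) = (LINT x|M. (norm (weak_grad a \<psi> x))\<^sup>2)"
    unfolding ng by (intro Bochner_Integration.integral_sum[symmetric] Lp2D(5) d(4))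
  finally have "((\<lambda>k. \<Sum>l\<in>UNIV. (norm (fc (weak_deriv a l \<psi>) k))\<^sup>2) has_sum (LINT x|M. (norm (weak_grad a \<psi> x))\<^sup>2)) Q" .
  moreover have "(\<Sum>l\<in>UNIV. (norm (fc (weak_deriv a l \<psi>) k))\<^sup>2) = (k \<bullet> k) * (norm (fc \<psi> k))\<^sup>2" if "k \<in> Q" for k
    using that by (simp add: d(5) norm_mult power_mult_distrib inner_self_vec sum_distrib_right)
  ultimately have 1: "((\<lambda>k. (k \<bullet> k) * (norm (fc \<psi> k))\<^sup>2) has_sum (LINT x|M. (norm (weak_grad a \<psi> x))\<^sup>2)) Q"
    by (metis (no_types, lifting) has_sum_cong)
  have pi: "integrable M (\<lambda>x. pot ?R x * cnj (?R x))"
    using Lp1D(4)[OF Lp2_mult_Lp2[OF pot(1)[OF R] Lp2_cnj[OF R]]] .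
  have re: "Re (pot ?R x * cnj (?R x)) = Re (pot ?R x) * r x" for x by simp
  have "((\<lambda>k. Re (fc (pot ?R) k * cnj (fc ?R k))) has_sum Re (LINT x|M. pot ?R x * cnj (?R x))) Q"
    by (intro has_sum_Re parseval pot R)
  also have "Re (LINT x|M. pot ?R x * cnj (?R x)) = (LINT x|M. Re (pot ?R x) * r x)"
    using integral_Re[OF pi] by (simp only: re)
  finally have "((\<lambda>k. Re (fc (pot ?R) k * cnj (fc ?R k))) has_sum (LINT x|M. Re (pot ?R x) * r x)) Q" .
  moreover have "Re (fc (pot ?R) k * cnj (fc ?R k)) = (norm (fc ?R k))\<^sup>2 / (k \<bullet> k)" if k: "k \<in> Q" for k
  proof -
    have "fc (pot ?R) k * cnj (fc ?R k) = complex_of_real ((norm (fc ?R k))\<^sup>2 / (k \<bullet> k))"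
      unfolding of_real_divide complex_norm_square pot(2)[OF R k] by simp
    then show "Re (fc (pot ?R) k * cnj (fc ?R k)) = (norm (fc ?R k))\<^sup>2 / (k \<bullet> k)" by (metis Re_complex_of_real)
  qed
  ultimately have 2: "((\<lambda>k. (norm (fc ?R k))\<^sup>2 / (k \<bullet> k)) has_sum (LINT x|M. Re (pot ?R x) * r x)) Q"
    by (metis (no_types, lifting) has_sum_cong)
  have pri: "integrable M (\<lambda>x. Re (pot ?R x) * r x)" using integrable_Re[OF pi] by (simp only: re)
  have "(LINT x|M. A * (norm (weak_grad a \<psi> x))\<^sup>2 + 1 / 2 * Re (pot ?R x) * r x) =
    A * (LINT x|M. (norm (weak_grad a \<psi> x))\<^sup>2) + 1 / 2 * (LINT x|M. Re (pot ?R x) * r x)"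
    using gi pri by (simp add: mult.assoc)
  then show ?thesis using has_sum_add[OF has_sum_cmult_right[OF 1, of A] has_sum_cmult_right[OF 2, of "1/2"]] by simp
qed

end

section \<open>Existence of a minimizer\<close>

lemma finite_superlevel_summable:
  fixes f :: "'a \<Rightarrow> real"
  assumes "f summable_on A" "\<And>x. x \<in> A \<Longrightarrow> f x \<ge> 0" "e > 0"
  shows "finite {x \<in> A. f x \<ge> e}"
proof (rule ccontr)
  assume inf: "infinite {x \<in> A. f x \<ge> e}"
  obtain n :: nat where n: "infsum f A / e < real n" using reals_Archimedean2 by blast
  obtain F where F: "finite F" "card F = n" "F \<subseteq> {x \<in> A. f x \<ge> e}" using infinite_arbitrarily_large[OF inf] by blast
  have "real n * e = (\<Sum>x\<in>F. e)" using F by simp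
  also have "\<dots> \<le> sum f F" using F by (intro sum_mono) auto
  also have "\<dots> \<le> infsum f A" using F assms by (intro finite_sum_le_infsum) auto
  finally show False using n assms(3) by (simp add: field_simps)
qed

context torus begin

text \<open>A weak form of Cauchy--Schwarz, obtained from Young's inequality with the norm of
  \<open>f\<close> as parameter. It suffices where only the smallness of the first factor
  matters.\<close>

lemma L2_pair_bound:
  fixes f g :: "real^3 \<Rightarrow> complex"
  assumes f: "f \<in> Lp a 2" and g: "g \<in> Lp a 2"
  shows "norm (LINT x|M. f x * g x) \<le> sqrt (LINT x|M. (norm (f x))\<^sup>2) * (1 + (LINT x|M. (norm (g x))\<^sup>2))"
proof -
  define I P R where "I = norm (LINT x|M. f x * g x)" and "P = (LINT x|M. (norm (f x))\<^sup>2)" and "R = (LINT x|M. (norm (g x))\<^sup>2)"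
  have P0: "P \<ge> 0" and R0: "R \<ge> 0" and I0: "I \<ge> 0" by (auto simp: P_def R_def I_def)
  have t: "I \<le> P / t + t * R" if "t > 0" for t
  proof -
    have "I \<le> (LINT x|M. norm (f x * g x))" unfolding I_def by (rule integral_norm_bound)
    also have "\<dots> \<le> (LINT x|M. (norm (f x))\<^sup>2 / t + t * (norm (g x))\<^sup>2)"
    proof (rule integral_mono)
      show "integrable M (\<lambda>x. norm (f x * g x))" using Lp1D(4)[OF Lp2_mult_Lp2[OF f g]] by (rule integrable_norm)
      show "integrable M (\<lambda>x. (norm (f x))\<^sup>2 / t + t * (norm (g x))\<^sup>2)"
        by (intro Bochner_Integration.integrable_add integrable_divide integrable_mult_right Lp2D(5) f g)
      fix x
      define p q where "p = norm (f x)" and "q = norm (g x)"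
      have "0 \<le> (p - t * q)\<^sup>2" by simp
      then have "2 * (t * (p * q)) \<le> p\<^sup>2 + t\<^sup>2 * q\<^sup>2" by (simp add: power2_eq_square algebra_simps)
      moreover have "0 \<le> t * (p * q)" using that by (simp add: p_def q_def)
      ultimately have "t * (p * q) \<le> p\<^sup>2 + t\<^sup>2 * q\<^sup>2" by linarith
      then have "p * q \<le> p\<^sup>2 / t + t * q\<^sup>2" using that by (simp add: field_simps power2_eq_square)
      then show "norm (f x * g x) \<le> (norm (f x))\<^sup>2 / t + t * (norm (g x))\<^sup>2" by (simp add: norm_mult p_def q_def)
    qed
    also have "\<dots> = P / t + t * R"
      unfolding P_def R_def using Lp2D(5)[OF f] Lp2D(5)[OF g] by (subst Bochner_Integration.integral_add) auto
    finally show ?thesis .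
  qed
  have "I \<le> sqrt P * (1 + R)"
  proof (cases "P = 0")
    case False
    then have p: "P > 0" using P0 by simp
    then have "P / sqrt P = sqrt P" by (simp add: real_div_sqrt)
    then show ?thesis using t[of "sqrt P"] p by (simp add: algebra_simps)
  next
    case True
    have "I = 0"
    proof (rule ccontr)
      assume "I \<noteq> 0"
      then have I: "I > 0" using I0 by simp
      \<comment> \<open>With \<open>P = 0\<close> the bound reads \<open>I \<le> t * R\<close>; this
        \<open>t\<close> makes the right side smaller than \<open>I\<close>.\<close>
      then have "I \<le> I / (R + 1) * R" using t[of "I / (R + 1)"] R0 True by simp
      then have "I * (R + 1) \<le> I * R" using R0 by (simp add: field_simps)
      then show False using I by (simp add: algebra_simps)
    qed
    then show ?thesis using True by simp
  qed
  then show ?thesis by (simp add: I_def P_def R_def)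
qed

text \<open>The difference of the densities is \<open>(g - f) * cnj g + cnj (g - f) * f\<close>, and
  each summand contains the small factor. Hence L^2 convergence gives convergence of every density
  coefficient.\<close>

lemma fc_dens_diff:
  assumes f: "f \<in> Lp a 2" and g: "g \<in> Lp a 2" and k: "k \<in> Q"
  shows "norm (fc (dens g) k - fc (dens f) k) \<le>
    sqrt (LINT x|M. (norm (g x - f x))\<^sup>2) * (2 + (LINT x|M. (norm (g x))\<^sup>2) + (LINT x|M. (norm (f x))\<^sup>2)) / sqrt V"
proof -
  let ?d = "\<lambda>x. g x - f x"
  have d: "?d \<in> Lp a 2" by (intro Lp2_diff f g)
  have c: "(\<lambda>x. cis (k \<bullet> x) * h x) \<in> Lp a 2" if "h \<in> Lp a 2" for h
    using Lp2_mult_bounded[OF that periodic_cis[OF k] borel_measurable_cis(1), of 1] by (simp add: mult.commute)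
  have g': "(\<lambda>x. cis (k \<bullet> x) * cnj (g x)) \<in> Lp a 2" and f': "(\<lambda>x. cis (k \<bullet> x) * f x) \<in> Lp a 2" and d': "(\<lambda>x. cnj (?d x)) \<in> Lp a 2"
    by (intro c Lp2_cnj f g d)+
  have i1: "integrable M (\<lambda>x. ?d x * (cis (k \<bullet> x) * cnj (g x)))" by (rule Lp1D(4)[OF Lp2_mult_Lp2[OF d g']])
  have i2: "integrable M (\<lambda>x. cnj (?d x) * (cis (k \<bullet> x) * f x))" by (rule Lp1D(4)[OF Lp2_mult_Lp2[OF d' f']])
  have "sqrt V * (fc (dens g) k - fc (dens f) k) = (LINT x|M. cis (k \<bullet> x) * dens g x - cis (k \<bullet> x) * dens f x)"
    using V_pos integrable_cis_mult[OF dens_Lp1[OF f]] integrable_cis_mult[OF dens_Lp1[OF g]]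
    by (simp add: fc_eq right_diff_distrib)
  also have "\<dots> = (LINT x|M. ?d x * (cis (k \<bullet> x) * cnj (g x)) + cnj (?d x) * (cis (k \<bullet> x) * f x))"
    by (simp add: dens_eq algebra_simps)
  also have "\<dots> = (LINT x|M. ?d x * (cis (k \<bullet> x) * cnj (g x))) + (LINT x|M. cnj (?d x) * (cis (k \<bullet> x) * f x))"
    by (rule Bochner_Integration.integral_add[OF i1 i2])
  finally have "norm (sqrt V * (fc (dens g) k - fc (dens f) k)) \<le> norm (LINT x|M. ?d x * (cis (k \<bullet> x) * cnj (g x))) + norm (LINT x|M. cnj (?d x) * (cis (k \<bullet> x) * f x))"
    by (simp only: norm_triangle_ineq)
  also have "\<dots> \<le> sqrt (LINT x|M. (norm (?d x))\<^sup>2) * (1 + (LINT x|M. (norm (g x))\<^sup>2)) + sqrt (LINT x|M. (norm (?d x))\<^sup>2) * (1 + (LINT x|M. (norm (f x))\<^sup>2))"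
    using L2_pair_bound[OF d g'] L2_pair_bound[OF d' f'] by (intro add_mono) (simp_all only: norm_mult norm_cis complex_mod_cnj mult_1)
  also have "\<dots> = sqrt (LINT x|M. (norm (?d x))\<^sup>2) * (2 + (LINT x|M. (norm (g x))\<^sup>2) + (LINT x|M. (norm (f x))\<^sup>2))"
    by (simp add: algebra_simps)
  finally show ?thesis using V_pos by (simp add: norm_mult pos_le_divide_eq mult.commute)
qed

end

section \<open>The crystal: charge densities, energy and configurations\<close>

locale crystal = torus +
  fixes hbar m e :: real and N :: nat and \<mu> :: "nat \<Rightarrow> real^3 \<Rightarrow> real"
  assumes hbar: "hbar > 0" and m: "m > 0" and e: "e < 0"
    and mu: "\<And>j. j \<in> {1..N} \<Longrightarrow> \<mu> j \<in> Lp a 1 \<inter> Lp a 2"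
    and Zpos: "total_ion_number a e N \<mu> > 0"
begin

abbreviation Z :: real where "Z \<equiv> total_ion_number a e N \<mu>"
definition A :: real where "A = hbar\<^sup>2 / (2 * m)"
definition muc :: "nat \<Rightarrow> real^3 \<Rightarrow> complex" where "muc j x = complex_of_real (\<mu> j x)"
definition sig :: "(nat \<Rightarrow> real^3) \<Rightarrow> real^3 \<Rightarrow> complex" where "sig X x = complex_of_real (ion_density N \<mu> X x)"
definition rho :: "(real^3 \<Rightarrow> complex) \<Rightarrow> (nat \<Rightarrow> real^3) \<Rightarrow> real^3 \<Rightarrow> complex" where
  "rho \<psi> X x = complex_of_real (charge_density e N \<mu> \<psi> X x)"
abbreviation energ :: "(real^3 \<Rightarrow> complex) \<Rightarrow> (nat \<Rightarrow> real^3) \<Rightarrow> real" where "energ \<equiv> energy a hbar m e N \<mu>"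
text \<open>The second summand vanishes at \<open>k = 0\<close> because \<open>x / 0 = 0\<close>, so the sum runs over all of \<open>Q\<close>.\<close>

definition ens :: "(real^3 \<Rightarrow> complex) \<Rightarrow> (nat \<Rightarrow> real^3) \<Rightarrow> real^3 \<Rightarrow> real" where
  "ens \<psi> X k = A * ((k \<bullet> k) * (norm (fc \<psi> k))\<^sup>2) + 1 / 2 * ((norm (fc (rho \<psi> X) k))\<^sup>2 / (k \<bullet> k))"

lemma A_pos: "A > 0" using hbar m by (simp add: A_def)

lemma muc_Lp2: "j \<in> {1..N} \<Longrightarrow> muc j \<in> Lp a 2"
  using mu[of j] of_real_measurable by (auto simp: Lp2_iff muc_def[abs_def] periodic_def)

lemma sig_eq: "sig X x = (\<Sum>j\<in>{1..N}. muc j (x - X j))"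
  by (simp add: sig_def ion_density_def muc_def)

lemma sig_Lp2: "sig X \<in> Lp a 2"
  unfolding sig_eq[abs_def] by (intro Lp2_sum Lp_translate muc_Lp2)

lemma fc_sig: "k \<in> Q \<Longrightarrow> fc (sig X) k = (\<Sum>j\<in>{1..N}. cis (k \<bullet> X j) * fc (muc j) k)"
  unfolding sig_eq[abs_def]
  by (subst fc_sum) (auto intro!: Lp_translate muc_Lp2 sum.cong fc_translate Lp2_imp_Lp1)

lemma rho_eq: "rho \<psi> X x = sig X x + of_real e * dens \<psi> x"
  by (simp add: rho_def charge_density_def sig_def dens_def)

lemma rho_Lp2: "\<psi> \<in> Sobolev a 1 \<Longrightarrow> rho \<psi> X \<in> Lp a 2"
  unfolding rho_eq[abs_def] by (intro Lp2_add Lp2_cmult sig_Lp2 dens_Lp2)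

lemma fc_rho: "\<psi> \<in> Lp a 2 \<Longrightarrow> fc (rho \<psi> X) k = fc (sig X) k + of_real e * fc (dens \<psi>) k"
proof -
  assume "\<psi> \<in> Lp a 2"
  then have "(\<lambda>x. of_real e * dens \<psi> x) \<in> Lp a 1"
    using Lp1_mult_bounded[OF dens_Lp1, of \<psi> "\<lambda>_. of_real e" "\<bar>e\<bar>"] by (simp add: periodic_def mult.commute)
  then show ?thesis unfolding rho_eq[abs_def] by (simp add: fc_add fc_cmult Lp2_imp_Lp1 sig_Lp2)
qed

lemma energy_ens: "\<psi> \<in> Sobolev a 1 \<Longrightarrow> (ens \<psi> X has_sum energ \<psi> X) Q"
  using energy_has_sum[of \<psi> "charge_density e N \<mu> \<psi> X" A] rho_Lp2[of \<psi> X]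
  by (simp add: ens_def[abs_def] rho_def[abs_def] energy_def Let_def A_def pot_def)

lemma ens_nonneg: "ens \<psi> X k \<ge> 0"
  using A_pos by (simp add: ens_def)

lemma energy_nonneg: "\<psi> \<in> Sobolev a 1 \<Longrightarrow> energ \<psi> X \<ge> 0"
  using has_sum_nonneg[OF energy_ens] ens_nonneg by blast

lemma energy_reduce:
  assumes "\<And>j. j \<in> {1..N} \<Longrightarrow> Y j - X j \<in> lattice a"
  shows "ion_density N \<mu> X = ion_density N \<mu> Y" "energ \<psi> X = energ \<psi> Y"
proof -
  show *: "ion_density N \<mu> X = ion_density N \<mu> Y"
  proof
    fix x
    have "\<mu> j (x - X j) = \<mu> j (x - Y j)" if j: "j \<in> {1..N}" for j
    proof -
      have "periodic a (\<mu> j)" using mu[OF j] by (simp add: Lp2_iff)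
      then have "\<mu> j ((x - Y j) + (Y j - X j)) = \<mu> j (x - Y j)" using assms[OF j] unfolding periodic_def by blast
      then show ?thesis by simp
    qed
    then show "ion_density N \<mu> X x = ion_density N \<mu> Y x" unfolding ion_density_def by (intro sum.cong) auto
  qed
  have "charge_density e N \<mu> \<psi> X = charge_density e N \<mu> \<psi> Y" unfolding charge_density_def[abs_def] * ..
  then show "energ \<psi> X = energ \<psi> Y" by (simp add: energy_def)
qed

text \<open>Limits and shifts of ion positions may leave the half-open cell. This restores the
  membership demanded by \<open>configurations\<close>, including extensionality of the
  tuple.\<close>

definition cellify :: "(nat \<Rightarrow> real^3) \<Rightarrow> nat \<Rightarrow> real^3" where
  "cellify X = restrict (\<lambda>j. reduce (X j)) {1..N}"

lemma cellify: "cellify X \<in> {1..N} \<rightarrow>\<^sub>E cell a" "energ \<psi> (cellify X) = energ \<psi> X"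
  using energy_reduce(2)[of X "cellify X"] by (auto simp: cellify_def)

lemma config_iff: "(\<psi>, X) \<in> configurations a e N \<mu> \<longleftrightarrow>
   \<psi> \<in> Sobolev a 1 \<and> (LINT x|M. (cmod (\<psi> x))\<^sup>2) = Z \<and> X \<in> {1..N} \<rightarrow>\<^sub>E cell a"
  by (auto simp: configurations_def)

text \<open>The witness is the constant wave function of the prescribed norm, with every ion at the
  origin; its only nonzero coefficient is the zeroth.\<close>

lemma config_nonempty: "configurations a e N \<mu> \<noteq> {}"
proof -
  define \<psi> :: "real^3 \<Rightarrow> complex" where "\<psi> = (\<lambda>x. of_real (sqrt (Z / V)))"
  have fc\<psi>: "fc \<psi> k = 0" if "k \<in> Q" "k \<noteq> 0" for k
    using fc_cmult[of "of_real (sqrt (Z / V))" "\<lambda>x. cis (- (0 \<bullet> x))" k] fc_cis[OF that(1) Q_closed(1)] that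
    by (simp add: \<psi>_def)
  have "(\<lambda>k. (k \<bullet> k) * (norm (fc \<psi> k))\<^sup>2) summable_on Q \<longleftrightarrow> (\<lambda>k. 0::real) summable_on Q"
    by (rule summable_on_cong) (use fc\<psi> in \<open>metis inner_zero_left mult_zero_left mult_zero_right norm_zero zero_power2\<close>)
  then have "\<psi> \<in> Sobolev a 1" unfolding Sobolev_1_iff by (simp add: \<psi>_def Lp2_const)
  moreover have "(LINT x|M. (cmod (\<psi> x))\<^sup>2) = Z"
    using Zpos V_pos by (simp add: \<psi>_def integral_const_M measure_M)
  ultimately have "(\<psi>, cellify (\<lambda>_. 0)) \<in> configurations a e N \<mu>" using cellify(1) by (simp add: config_iff)
  then show ?thesis by blast
qed

theorem minimizer_exists:
  "\<exists>\<psi>0 X0. (\<psi>0, X0) \<in> configurations a e N \<mu> \<and> (\<forall>(\<psi>, X)\<in>configurations a e N \<mu>. energ \<psi>0 X0 \<le> energ \<psi> X)"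
proof -
  define S where "S = (\<lambda>(\<psi>, X). energ \<psi> X) ` configurations a e N \<mu>"
  have S: "S \<noteq> {}" "bdd_below S"
    using config_nonempty energy_nonneg by (auto simp: S_def config_iff intro!: bdd_belowI2[of _ 0])
  define I where "I = Inf S"
  have "\<exists>\<psi> X. (\<psi>, X) \<in> configurations a e N \<mu> \<and> energ \<psi> X < I + 1 / (real n + 1)" for n :: nat
  proof -
    have "Inf S < I + 1 / (real n + 1)" by (simp add: I_def add_pos_nonneg)
    then obtain s where "s \<in> S" "s < I + 1 / (real n + 1)" using cInf_lessD[OF S(1)] by blast
    then show ?thesis by (auto simp: S_def)
  qed
  then obtain \<psi> X where seq: "\<And>n. (\<psi> n, X n) \<in> configurations a e N \<mu>" "\<And>n::nat. energ (\<psi> n) (X n) < I + 1 / (real n + 1)"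
    by metis
  have psi: "\<psi> n \<in> Sobolev a 1" "\<psi> n \<in> Lp a 2" "(LINT x|M. (cmod (\<psi> n x))\<^sup>2) = Z" "X n \<in> {1..N} \<rightarrow>\<^sub>E cell a" for n
    using seq(1)[of n] Sobolev_1D(1) by (auto simp: config_iff)
  have cb: "(\<Sum>k\<in>F. (norm (fc (\<psi> n) k))\<^sup>2) \<le> Z" if "finite F" "F \<subseteq> Q" for F n
    using bessel[OF psi(2) that] psi(3) by simp
  have nb: "norm (fc (\<psi> n) k) \<le> sqrt Z" if "k \<in> Q" for n k
    using cb[of "{k}" n] that by (intro real_le_rsqrt) auto
  obtain r1 where r1: "strict_mono (r1::nat\<Rightarrow>nat)" "\<And>k. k \<in> Q \<Longrightarrow> \<exists>l. (\<lambda>n. fc (\<psi> (r1 n)) k) \<longlonglongrightarrow> l"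
  proof (rule function_convergent_subsequence[of Q "\<lambda>n. fc (\<psi> n)" "sqrt Z"])
    fix k :: "nat \<Rightarrow> nat"
    assume "strict_mono k" "\<And>x. x \<in> Q \<Longrightarrow> \<exists>l. (\<lambda>n. fc (\<psi> (k n)) x) \<longlonglongrightarrow> l"
    then show thesis by (rule that)
  qed (rule countable_lattice, rule nb)
  obtain B where B: "\<And>x. x \<in> cell a \<Longrightarrow> norm x \<le> B" using bounded_cell by (auto simp: bounded_iff)
  have Xb: "norm (X (r1 n) j) \<le> B" if "j \<in> {1..N}" for n j using psi(4)[of "r1 n"] that by (intro B) (auto simp: PiE_def)
  obtain r2 where r2: "strict_mono (r2::nat\<Rightarrow>nat)" "\<And>j. j \<in> {1..N} \<Longrightarrow> \<exists>l. (\<lambda>n. X (r1 (r2 n)) j) \<longlonglongrightarrow> l"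
  proof (rule function_convergent_subsequence[of "{1..N}" "\<lambda>n. X (r1 n)" B])
    fix k :: "nat \<Rightarrow> nat"
    assume "strict_mono k" "\<And>j. j \<in> {1..N} \<Longrightarrow> \<exists>l. (\<lambda>n. X (r1 (k n)) j) \<longlonglongrightarrow> l"
    then show thesis by (rule that)
  qed (rule countable_finite, rule finite_atLeastAtMost, erule Xb)
  define r where "r n = r1 (r2 n)" for n
  have rn: "n \<le> r n" for n
    unfolding r_def by (rule le_trans[OF seq_suble[OF r2(1)] seq_suble[OF r1(1)]])
  have "\<forall>k\<in>Q. \<exists>l. (\<lambda>n. fc (\<psi> (r n)) k) \<longlonglongrightarrow> l"
    using r1(2) LIMSEQ_subseq_LIMSEQ[OF _ r2(1)] unfolding r_def o_def by blast
  then obtain c where c: "\<And>k. k \<in> Q \<Longrightarrow> (\<lambda>n. fc (\<psi> (r n)) k) \<longlonglongrightarrow> c k" by metis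
  obtain Y where Y: "\<And>j. j \<in> {1..N} \<Longrightarrow> (\<lambda>n. X (r n) j) \<longlonglongrightarrow> Y j" using r2(2) unfolding r_def by metis
  define \<phi> where "\<phi> n = \<psi> (r n)" for n
  have phi: "\<phi> n \<in> Sobolev a 1" "\<phi> n \<in> Lp a 2" "(LINT x|M. (cmod (\<phi> n x))\<^sup>2) = Z" for n
    using psi by (auto simp: \<phi>_def)
  have c: "k \<in> Q \<Longrightarrow> (\<lambda>n. fc (\<phi> n) k) \<longlonglongrightarrow> c k" for k using c by (simp add: \<phi>_def)
  have En: "energ (\<phi> n) (X (r n)) \<le> I + 1 / (real n + 1)" for n
  proof -
    have "energ (\<phi> n) (X (r n)) \<le> I + 1 / (real (r n) + 1)" using seq(2)[of "r n"] by (simp add: \<phi>_def)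
    also have "\<dots> \<le> I + 1 / (real n + 1)" using rn[of n] by (simp add: frac_le)
    finally show ?thesis .
  qed
  \<comment> \<open>\<open>Z\<close> bounds the unweighted part by normalisation, and
    \<open>(I + 1) / A\<close> the kinetic part, since the energies along the sequence are at most
    \<open>I + 1\<close>.\<close>
  define W where "W = Z + (I + 1) / A"
  have wb: "(\<Sum>k\<in>F. (1 + k \<bullet> k) * (norm (fc (\<phi> n) k))\<^sup>2) \<le> W" if F: "finite F" "F \<subseteq> Q" for F n
  proof -
    have "A * (\<Sum>k\<in>F. (k \<bullet> k) * (norm (fc (\<phi> n) k))\<^sup>2) \<le> (\<Sum>k\<in>F. ens (\<phi> n) (X (r n)) k)"
      unfolding sum_distrib_left by (intro sum_mono) (simp add: ens_def)
    also have "\<dots> \<le> energ (\<phi> n) (X (r n))"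
      by (rule finite_sum_le_has_sum[OF energy_ens[OF phi(1)] F]) (rule ens_nonneg)
    also have "\<dots> \<le> I + 1"
      using En[of n] by (smt (verit) divide_le_eq_1 of_nat_0_le_iff)
    finally have "(\<Sum>k\<in>F. (k \<bullet> k) * (norm (fc (\<phi> n) k))\<^sup>2) \<le> (I + 1) / A"
      using A_pos by (simp add: pos_le_divide_eq mult.commute)
    moreover have "(\<Sum>k\<in>F. (norm (fc (\<phi> n) k))\<^sup>2) \<le> Z" using cb[OF F] by (simp add: \<phi>_def)
    ultimately show ?thesis by (simp add: W_def distrib_right sum.distrib)
  qed
  have wc: "(\<Sum>k\<in>F. (1 + k \<bullet> k) * (norm (c k))\<^sup>2) \<le> W" if F: "finite F" "F \<subseteq> Q" for F
  proof (rule LIMSEQ_le_const2)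
    show "(\<lambda>n. \<Sum>k\<in>F. (1 + k \<bullet> k) * (norm (fc (\<phi> n) k))\<^sup>2) \<longlonglongrightarrow> (\<Sum>k\<in>F. (1 + k \<bullet> k) * (norm (c k))\<^sup>2)"
      using F by (intro tendsto_intros c) auto
  qed (use wb[OF F] in auto)
  have W0: "W \<ge> 0" using wc[of "{}"] by simp
  have s1: "(\<lambda>k. (1 + k \<bullet> k) * (norm (c k))\<^sup>2) summable_on Q"
    by (rule nonneg_bdd_above_summable_on) (auto intro!: bdd_aboveI2[of _ _ W] wc)
  have "(\<lambda>k. (norm (c k))\<^sup>2) summable_on Q"
    by (rule summable_on_comparison_test[OF s1]) (auto simp: distrib_right)
  then obtain \<psi>0 where p0: "\<psi>0 \<in> Lp a 2" "\<And>k. k \<in> Q \<Longrightarrow> fc \<psi>0 k = c k" using riesz_fischer by blast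
  have "(\<lambda>k. (k \<bullet> k) * (norm (fc \<psi>0 k))\<^sup>2) summable_on Q"
    by (rule summable_on_comparison_test[OF s1]) (auto simp: distrib_right p0)
  then have p1: "\<psi>0 \<in> Sobolev a 1" using p0 by (simp add: Sobolev_1_iff)
  define P where "P n = (LINT x|M. (norm (\<phi> n x - \<psi>0 x))\<^sup>2)" for n
  have P0: "P \<longlonglongrightarrow> 0"
  proof (rule LIMSEQ_I)
    fix \<epsilon> :: real assume \<epsilon>: "\<epsilon> > 0"
    \<comment> \<open>The finite part will be below \<open>\<delta>\<close> and the tail at most
      \<open>4 * W * \<delta>\<close>; together they stay below \<open>\<epsilon>\<close>.\<close>
    define \<delta> where "\<delta> = \<epsilon> / (4 * W + 2)"
    have \<delta>: "\<delta> > 0" using \<epsilon> W0 by (simp add: \<delta>_def)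
    \<comment> \<open>Summability of the weights makes \<open>F\<close> finite, while outside
      \<open>F\<close> the factor \<open>\<delta> * (1 + k \<bullet> k)\<close> is at least
      \<open>1\<close> and can be inserted into the tail.\<close>
    define F where "F = {k \<in> Q. 1 / (1 + k \<bullet> k)\<^sup>2 \<ge> \<delta>\<^sup>2}"
    have F: "finite F" "F \<subseteq> Q"
      using finite_superlevel_summable[OF summable_Q_weight, of "\<delta>\<^sup>2"] \<delta> by (auto simp: F_def)
    have small: "1 / (1 + k \<bullet> k) \<le> \<delta>" if "k \<in> Q" "k \<notin> F" for k
    proof -
      have "(1 / (1 + k \<bullet> k))\<^sup>2 \<le> \<delta>\<^sup>2" using that by (simp add: F_def power_divide)
      then show ?thesis by (rule power2_le_imp_le) (use \<delta> in simp)
    qed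
    define d where "d n k = (norm (fc (\<phi> n) k - c k))\<^sup>2" for n k
    have bound: "P n \<le> sum (d n) F + 4 * W * \<delta>" for n
    proof (rule has_sum_le_finite_sums)
      have "((\<lambda>k. (norm (fc (\<lambda>x. \<phi> n x - \<psi>0 x) k))\<^sup>2) has_sum P n) Q"
        unfolding P_def by (intro parseval_norm Lp2_diff phi p0)
      moreover have "(norm (fc (\<lambda>x. \<phi> n x - \<psi>0 x) k))\<^sup>2 = d n k" if "k \<in> Q" for k
        using that by (simp add: d_def fc_diff Lp2_imp_Lp1 phi p0)
      ultimately show "(d n has_sum P n) Q" by (metis (no_types, lifting) has_sum_cong)
      fix G assume G: "finite G" "G \<subseteq> Q"
      have "sum (d n) G \<le> sum (d n) (F \<union> (G - F))"
        using F G by (intro sum_mono2) (auto simp: d_def)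
      also have "\<dots> = sum (d n) F + sum (d n) (G - F)" using F G by (intro sum.union_disjoint) auto
      also have "sum (d n) (G - F) \<le> (\<Sum>k\<in>G - F. 2 * \<delta> * ((1 + k \<bullet> k) * (norm (fc (\<phi> n) k))\<^sup>2 + (1 + k \<bullet> k) * (norm (c k))\<^sup>2))"
      proof (rule sum_mono)
        fix k assume "k \<in> G - F"
        then have k: "1 \<le> \<delta> * (1 + k \<bullet> k)" using small[of k] G
          by (auto simp: pos_divide_le_eq add_pos_nonneg)
        define p q where "p = norm (fc (\<phi> n) k)" and "q = norm (c k)"
        have "d n k \<le> (p + q)\<^sup>2" unfolding d_def p_def q_def by (intro power_mono norm_triangle_ineq4) auto
        also have "\<dots> \<le> 2 * (p\<^sup>2 + q\<^sup>2)" using sum_squares_bound[of p q] by (simp add: power2_sum)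
        also have "\<dots> = 1 * (2 * (p\<^sup>2 + q\<^sup>2))" by simp
        also have "\<dots> \<le> (\<delta> * (1 + k \<bullet> k)) * (2 * (p\<^sup>2 + q\<^sup>2))" by (intro mult_right_mono k) auto
        finally show "d n k \<le> 2 * \<delta> * ((1 + k \<bullet> k) * p\<^sup>2 + (1 + k \<bullet> k) * q\<^sup>2)" by (simp add: algebra_simps)
      qed
      also have "\<dots> = 2 * \<delta> * ((\<Sum>k\<in>G - F. (1 + k \<bullet> k) * (norm (fc (\<phi> n) k))\<^sup>2) + (\<Sum>k\<in>G - F. (1 + k \<bullet> k) * (norm (c k))\<^sup>2))"
        by (simp only: sum_distrib_left[symmetric] sum.distrib)
      also have "\<dots> \<le> 2 * \<delta> * (W + W)" using G \<delta> by (intro mult_left_mono add_mono wb wc) auto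
      finally show "sum (d n) G \<le> sum (d n) F + 4 * W * \<delta>" by (simp add: mult_ac)
    qed
    have "(\<lambda>n. sum (d n) F) \<longlonglongrightarrow> (\<Sum>k\<in>F. (norm (c k - c k))\<^sup>2)"
      unfolding d_def using F by (intro tendsto_intros c) auto
    then have "eventually (\<lambda>n. sum (d n) F < \<delta>) sequentially" using \<delta> by (intro order_tendstoD) auto
    then obtain n0 where n0: "\<And>n. n \<ge> n0 \<Longrightarrow> sum (d n) F < \<delta>" by (auto simp: eventually_sequentially)
    have "norm (P n - 0) < \<epsilon>" if "n \<ge> n0" for n
    proof -
      have "P n < \<delta> * (4 * W + 1)" using bound[of n] n0[OF that] by (simp add: algebra_simps)
      also have "\<dots> \<le> \<delta> * (4 * W + 2)" using \<delta> by simp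
      also have "\<dots> = \<epsilon>" using W0 by (simp add: \<delta>_def)
      finally show ?thesis by (simp add: P_def)
    qed
    then show "\<exists>n0. \<forall>n\<ge>n0. norm (P n - 0) < \<epsilon>" by blast
  qed
  have dens: "(\<lambda>n. fc (dens (\<phi> n)) k) \<longlonglongrightarrow> fc (dens \<psi>0) k" if k: "k \<in> Q" for k
  proof -
    define C where "C = (2 + Z + (LINT x|M. (norm (\<psi>0 x))\<^sup>2)) / sqrt V"
    have "(\<lambda>n. sqrt (P n) * C) \<longlonglongrightarrow> sqrt 0 * C"
      by (intro tendsto_intros P0)
    then have l: "(\<lambda>n. sqrt (P n) * C) \<longlonglongrightarrow> 0" by simp
    have b: "norm (fc (dens (\<phi> n)) k - fc (dens \<psi>0) k) \<le> sqrt (P n) * C" for n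
      using fc_dens_diff[OF p0(1) phi(2) k, of n] by (simp add: P_def C_def phi(3))
    have "(\<lambda>n. fc (dens (\<phi> n)) k - fc (dens \<psi>0) k) \<longlonglongrightarrow> 0"
      by (rule Lim_null_comparison[OF always_eventually[OF allI[OF b]] l])
    then show ?thesis by (simp add: LIM_zero_iff)
  qed
  \<comment> \<open>The zeroth coefficient of a density is the squared norm up to a constant, so
    convergence of that coefficient preserves the constraint.\<close>
  have fc0: "fc (dens f) 0 = of_real ((LINT x|M. (norm (f x))\<^sup>2) / sqrt V)" for f
  proof -
    have "(LINT x|M. dens f x) = of_real (LINT x|M. (norm (f x))\<^sup>2)"
      unfolding dens_def by (rule integral_complex_of_real)
    then show ?thesis by (simp add: fc_eq)
  qed
  have "(\<lambda>n::nat. complex_of_real (Z / sqrt V)) \<longlonglongrightarrow> of_real ((LINT x|M. (norm (\<psi>0 x))\<^sup>2) / sqrt V)"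
    using dens[OF Q_closed(1)] unfolding fc0 phi(3) .
  then have "complex_of_real (Z / sqrt V) = of_real ((LINT x|M. (norm (\<psi>0 x))\<^sup>2) / sqrt V)"
    by (simp only: LIMSEQ_const_iff)
  then have Z0: "(LINT x|M. (norm (\<psi>0 x))\<^sup>2) = Z" using V_pos by (simp only: of_real_eq_iff) simp
  have rho: "(\<lambda>n. fc (rho (\<phi> n) (X (r n))) k) \<longlonglongrightarrow> fc (rho \<psi>0 Y) k" if k: "k \<in> Q" for k
    unfolding fc_rho[OF phi(2)] fc_rho[OF p0(1)] fc_sig[OF k]
    by (intro tendsto_intros dens k Y)
  have "energ \<psi>0 Y \<le> I"
  proof (rule has_sum_le_finite_sums[OF energy_ens[OF p1]])
    fix F assume F: "finite F" "F \<subseteq> Q"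
    have l1: "(\<lambda>n. \<Sum>k\<in>F. ens (\<phi> n) (X (r n)) k) \<longlonglongrightarrow> (\<Sum>k\<in>F. ens \<psi>0 Y k)"
    proof (rule tendsto_sum)
      fix k assume "k \<in> F"
      then have k: "k \<in> Q" using F by auto
      have "(\<lambda>n. fc (\<phi> n) k) \<longlonglongrightarrow> fc \<psi>0 k" using c[OF k] p0(2)[OF k] by simp
      moreover note rho[OF k]
      ultimately show "(\<lambda>n. ens (\<phi> n) (X (r n)) k) \<longlonglongrightarrow> ens \<psi>0 Y k"
        \<comment> \<open>Written as multiplication by a constant inverse, the quotient also
          converges at \<open>k = 0\<close>, where the divisor vanishes.\<close>
        unfolding ens_def divide_inverse[of "_\<^sup>2"] by (intro tendsto_intros)
    qed
    have "(\<lambda>n. 1 / (real n + 1)) \<longlonglongrightarrow> 0" using LIMSEQ_inverse_real_of_nat by (simp add: inverse_eq_divide add.commute)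
    then have l2: "(\<lambda>n. I + 1 / (real n + 1)) \<longlonglongrightarrow> I + 0" by (intro tendsto_intros)
    have "(\<Sum>k\<in>F. ens (\<phi> n) (X (r n)) k) \<le> I + 1 / (real n + 1)" for n
      using finite_sum_le_has_sum[OF energy_ens[OF phi(1)] F ens_nonneg] En[of n] by (rule order_trans)
    then show "(\<Sum>k\<in>F. ens \<psi>0 Y k) \<le> I" using LIMSEQ_le[OF l1 l2] by auto
  qed
  moreover have "I \<le> energ \<psi>' X'" if "(\<psi>', X') \<in> configurations a e N \<mu>" for \<psi>' X'
    unfolding I_def using S(2) that by (intro cInf_lower) (auto simp: S_def)
  ultimately have "energ \<psi>0 (cellify Y) \<le> energ \<psi>' X'" if "(\<psi>', X') \<in> configurations a e N \<mu>" for \<psi>' X'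
    using that by (metis cellify(2) order_trans)
  moreover have "(\<psi>0, cellify Y) \<in> configurations a e N \<mu>" using p1 Z0 cellify(1) by (simp add: config_iff)
  ultimately show ?thesis by blast
qed

end

section \<open>Euler--Lagrange equations\<close>

text \<open>Separates the powers of \<open>t\<close> in the squared modulus of a charge coefficient;
  \<open>c\<close> will carry the electron charge and the normalising factor.\<close>

lemma norm_quadratic_expand:
  fixes s h0 h1 :: complex
  shows "(cmod (s + of_real c * (h0 + of_real t * h1)))\<^sup>2 =
    Re (s * cnj s) + 2 * c * (Re (s * cnj h0) + t * Re (s * cnj h1))
    + c\<^sup>2 * (Re (h0 * cnj h0) + 2 * t * Re (h0 * cnj h1) + t\<^sup>2 * Re (h1 * cnj h1))"
  by (simp only: cmod_power2) (simp add: power2_eq_square algebra_simps)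

lemma cis_taylor: "norm (cis s - 1 - \<i> * of_real s) \<le> s\<^sup>2"
  using Taylor_exp[of "\<i> * of_real s" 1]
  by (simp add: cis_conv_exp norm_mult diff_diff_eq One_nat_def power2_eq_square)

text \<open>For a small \<open>t\<close> of the same sign as \<open>G\<close> the linear term would
  win over the quadratic one. The denominator \<open>C + 1\<close> stays positive when
  \<open>C = 0\<close>.\<close>

lemma quadratic_nonneg_imp_zero:
  fixes G C :: real
  assumes "\<And>t. t * G \<le> t\<^sup>2 * C" "C \<ge> 0" shows "G = 0"
proof (rule ccontr)
  assume G: "G \<noteq> 0"
  define s where "s = G / (C + 1)"
  have s: "G = s * (C + 1)" using assms(2) by (simp add: s_def)
  have "s * G \<le> s\<^sup>2 * C" by (rule assms)
  then have "s\<^sup>2 \<le> 0" unfolding s by (simp add: power2_eq_square algebra_simps)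
  then show False using G s by simp
qed

context torus begin

text \<open>The summand of the Coulomb pairing of two densities; the zero mode contributes nothing
  because division by zero is zero.\<close>

definition coulomb :: "(real^3 \<Rightarrow> complex) \<Rightarrow> (real^3 \<Rightarrow> complex) \<Rightarrow> real^3 \<Rightarrow> real" where
  "coulomb f g k = Re (fc f k * cnj (fc g k)) / (k \<bullet> k)"

lemma D_has_sum:
  assumes "f \<in> Lp a 2" "g \<in> Lp a 2"
  shows "(coulomb f g has_sum Re (LINT x|M. pot f x * cnj (g x))) Q"
proof -
  have "((\<lambda>k. Re (fc (pot f) k * cnj (fc g k))) has_sum Re (LINT x|M. pot f x * cnj (g x))) Q"
    by (intro has_sum_Re parseval pot assms)
  moreover have "Re (fc (pot f) k * cnj (fc g k)) = coulomb f g k" if "k \<in> Q" for k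
  proof -
    have "fc (pot f) k * cnj (fc g k) = (fc f k * cnj (fc g k)) / of_real (k \<bullet> k)"
      using pot(2)[OF assms(1) that] by simp
    then show ?thesis by (simp only: Re_divide_of_real coulomb_def)
  qed
  ultimately show ?thesis by (metis (no_types, lifting) has_sum_cong)
qed

lemma fc_const: "k \<in> Q \<Longrightarrow> k \<noteq> 0 \<Longrightarrow> fc (\<lambda>x. c) k = 0"
  using fc_cmult[of c "\<lambda>x. cis (- (0 \<bullet> x))" k] fc_cis[of k 0] Q_closed(1) by simp

lemma has_sum_single:
  fixes f :: "real^3 \<Rightarrow> real"
  assumes "k0 \<in> Q" "\<And>k. k \<in> Q \<Longrightarrow> k \<noteq> k0 \<Longrightarrow> f k = 0"
  shows "(f has_sum f k0) Q"
proof -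
  have "(f has_sum f k0) {k0}" by (rule has_sum_finiteI) auto
  then show ?thesis by (rule has_sum_cong_neutral[THEN iffD1, rotated -1]) (use assms in auto)
qed

end

section \<open>Schroedinger and Poisson equations for a minimizer\<close>

locale minimizer = crystal +
  fixes \<psi>0 :: "real^3 \<Rightarrow> complex" and X0 :: "nat \<Rightarrow> real^3"
  assumes config: "(\<psi>0, X0) \<in> configurations a e N \<mu>"
    and minimal: "\<And>\<psi> X. (\<psi>, X) \<in> configurations a e N \<mu> \<Longrightarrow> energ \<psi>0 X0 \<le> energ \<psi> X"
begin

lemma psi0: "\<psi>0 \<in> Sobolev a 1" "\<psi>0 \<in> Lp a 2" "(LINT x|M. (cmod (\<psi>0 x))\<^sup>2) = Z"
  using config Sobolev_1D(1) by (auto simp: config_iff)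

lemma minimal_any: "\<psi> \<in> Sobolev a 1 \<Longrightarrow> (LINT x|M. (cmod (\<psi> x))\<^sup>2) = Z \<Longrightarrow> energ \<psi>0 X0 \<le> energ \<psi> X"
  using minimal[of \<psi> "cellify X"] cellify by (simp add: config_iff)

definition R0 :: "real^3 \<Rightarrow> complex" where "R0 = rho \<psi>0 X0"
definition \<Phi> :: "real^3 \<Rightarrow> complex" where "\<Phi> = pot R0"

lemma R0: "R0 \<in> Lp a 2" unfolding R0_def by (rule rho_Lp2[OF psi0(1)])

lemma fc_R0: "fc R0 k = fc (sig X0) k + of_real e * fc (dens \<psi>0) k"
  unfolding R0_def by (rule fc_rho[OF psi0(2)])

lemma Phi: "\<Phi> \<in> Lp a 2" "k \<in> Q \<Longrightarrow> fc \<Phi> k = fc R0 k / of_real (k \<bullet> k)"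
  unfolding \<Phi>_def by (intro pot R0)+

lemma Phi_real: "of_real (Re (\<Phi> x)) = \<Phi> x"
  using pot_real[of "charge_density e N \<mu> \<psi>0 X0" x] by (simp add: \<Phi>_def R0_def rho_def[abs_def])

lemma Phi_psi0: "(\<lambda>x. \<Phi> x * \<psi>0 x) \<in> Lp a 2"
proof -
  obtain B where "\<And>x. norm (\<Phi> x) \<le> B" using pot(3)[OF R0] by (auto simp: \<Phi>_def)
  then have "(\<lambda>x. \<psi>0 x * \<Phi> x) \<in> Lp a 2" by (rule Lp2_mult_bounded[OF psi0(2) Lp2D(1,2)[OF Phi(1)]])
  then show ?thesis by (simp add: mult.commute)
qed

text \<open>Neutrality is built into \<open>Z\<close>: the ions carry the charge
  \<open>- e * Z\<close> and the electrons \<open>e * Z\<close>. The Poisson equation requires this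
  at the zero mode, where the Laplacian of the potential has coefficient zero.\<close>

lemma R0_mean_zero: "fc R0 0 = 0"
proof -
  have "fc (sig X0) 0 = (\<Sum>j\<in>{1..N}. of_real ((LINT x|M. \<mu> j x) / sqrt V))"
    unfolding fc_sig[OF Q_closed(1)] by (simp add: fc_eq muc_def)
  also have "\<dots> = of_real ((\<Sum>j\<in>{1..N}. (LINT x|M. \<mu> j x)) / sqrt V)"
    by (simp only: of_real_sum sum_divide_distrib)
  also have "(\<Sum>j\<in>{1..N}. (LINT x|M. \<mu> j x)) = - e * Z"
  proof -
    have "Z = (\<Sum>j\<in>{1..N}. (LINT x|M. \<mu> j x)) / \<bar>e\<bar>" by (simp only: total_ion_number_def sum_divide_distrib)
    then show ?thesis using e by simp
  qed
  finally have 1: "fc (sig X0) 0 = of_real (- e * Z / sqrt V)" .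
  have "(LINT x|M. dens \<psi>0 x) = of_real (LINT x|M. (cmod (\<psi>0 x))\<^sup>2)"
    unfolding dens_def by (rule integral_complex_of_real)
  then have "fc (dens \<psi>0) 0 = of_real (Z / sqrt V)" by (simp add: fc_eq psi0(3))
  then show ?thesis by (simp add: fc_R0 1)
qed

definition K0 :: real where "K0 = (\<Sum>\<^sub>\<infinity>k\<in>Q. (k \<bullet> k) * (norm (fc \<psi>0 k))\<^sup>2)"
definition DD :: "(real^3 \<Rightarrow> complex) \<Rightarrow> (real^3 \<Rightarrow> complex) \<Rightarrow> real" where
  "DD f g = Re (LINT x|M. pot f x * cnj (g x))"
text \<open>The mean of the one-particle Hamiltonian, kinetic energy plus \<open>e * \<Phi>\<close>,
  in the state \<open>\<psi>0\<close>. It is the Lagrange multiplier of the norm constraint and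
  enters \<open>first_variation\<close> through the derivative of the normalising factor.\<close>

definition \<Lambda> :: real where
  "\<Lambda> = (A * K0 + e * DD (sig X0) (dens \<psi>0) + e\<^sup>2 * DD (dens \<psi>0) (dens \<psi>0)) / Z"

lemma DD_has_sum: "f \<in> Lp a 2 \<Longrightarrow> g \<in> Lp a 2 \<Longrightarrow>
    (coulomb f g has_sum DD f g) Q"
  unfolding DD_def by (rule D_has_sum)

text \<open>The energy of the normalised variation \<open>\<psi>0 + t z e\<^sub>k\<close> is a rational function of \<open>t\<close>.\<close>

lemma first_variation:
  fixes z :: complex
  assumes k0: "k0 \<in> Q"
  shows "Re (cnj z * (of_real (A * (k0 \<bullet> k0)) * fc \<psi>0 k0 + of_real e * fc (\<lambda>x. \<Phi> x * \<psi>0 x) k0 - of_real \<Lambda> * fc \<psi>0 k0)) = 0"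
proof -
  define v where "v x = z * cis (- (k0 \<bullet> x))" for x
  have vL: "v \<in> Lp a 2" unfolding v_def[abs_def] by (intro Lp2_cmult Lp2_cis_minus k0)
  have fcv: "fc v k = (if k = k0 then z * sqrt V else 0)" if "k \<in> Q" for k
    unfolding v_def[abs_def] fc_cmult using fc_cis[OF that k0] by simp
  define h0 h1 h2 where "h0 = dens \<psi>0" and "h1 x = complex_of_real (2 * Re (\<psi>0 x * cnj (v x)))" and "h2 = dens v" for x
  have h0L: "h0 \<in> Lp a 2" unfolding h0_def by (rule dens_Lp2[OF psi0(1)])
  have vb: "norm (v x) \<le> norm z" for x by (simp add: v_def norm_mult)
  have pv: "(\<lambda>x. \<psi>0 x * cnj (v x)) \<in> Lp a 2"
    using Lp2_mult_bounded[OF psi0(2) Lp2D(1,2)[OF Lp2_cnj[OF vL]], of "norm z"] vb by simp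
  have h1_eq: "h1 x = \<psi>0 x * cnj (v x) + cnj (\<psi>0 x * cnj (v x))" for x
    unfolding h1_def by (rule complex_add_cnj[symmetric])
  have h1L: "h1 \<in> Lp a 2" unfolding h1_eq[abs_def] by (intro Lp2_add pv Lp2_cnj[OF pv])
  \<comment> \<open>The density of a single mode is constant, so the term of order
    \<open>t\<^sup>2\<close> in the density affects only the zero mode and has no Coulomb
    energy.\<close>
  have h2_eq: "h2 = (\<lambda>x. of_real ((norm z)\<^sup>2))" by (auto simp: h2_def dens_def v_def norm_mult)
  have h2L: "h2 \<in> Lp a 2" unfolding h2_eq by (rule Lp2_const)
  have fch2: "fc h2 k = 0" if "k \<in> Q" "k \<noteq> 0" for k unfolding h2_eq by (rule fc_const[OF that])
  define I1 where "I1 = (LINT x|M. \<psi>0 x * cnj (v x))"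
  have I1: "I1 = cnj z * (sqrt V * fc \<psi>0 k0)"
  proof -
    have "I1 = (LINT x|M. cnj z * (cis (k0 \<bullet> x) * \<psi>0 x))" by (simp add: I1_def v_def cis_cnj mult_ac)
    then show ?thesis using V_pos by (simp add: fc_eq)
  qed
  define n1 n2 where "n1 = 2 * Re I1" and "n2 = (norm z)\<^sup>2 * V"
  define n where "n t = Z + t * n1 + t\<^sup>2 * n2" for t
  \<comment> \<open>\<open>n t\<close> will be the squared norm of the unnormalised variation, so
    scaling its density by \<open>\<eta> t\<close> restores the constraint.\<close>
  define \<eta> where "\<eta> t = Z / n t" for t
  have dens_u: "(cmod (\<psi>0 x + of_real t * v x))\<^sup>2 = (cmod (\<psi>0 x))\<^sup>2 + t * (2 * Re (\<psi>0 x * cnj (v x))) + t\<^sup>2 * (norm z)\<^sup>2" for x t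
  proof -
    have "(norm z)\<^sup>2 = (cmod (v x))\<^sup>2" by (simp add: v_def norm_mult)
    then show ?thesis by (simp only: cmod_power2) (simp add: power2_eq_square algebra_simps)
  qed
  have int_u: "(LINT x|M. (cmod (\<psi>0 x + of_real t * v x))\<^sup>2) = n t" for t
  proof -
    define w where "w x = Re (\<psi>0 x * cnj (v x))" for x
    have wi: "integrable M w" "(LINT x|M. w x) = Re I1"
      unfolding w_def I1_def using Lp2D(4)[OF pv] by (rule integrable_Re, intro integral_Re Lp2D(4)[OF pv])
    have "(LINT x|M. (cmod (\<psi>0 x + of_real t * v x))\<^sup>2) = (LINT x|M. ((cmod (\<psi>0 x))\<^sup>2 + t * (2 * w x)) + t\<^sup>2 * (norm z)\<^sup>2)"
      by (simp only: dens_u w_def)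
    also have "\<dots> = (LINT x|M. (cmod (\<psi>0 x))\<^sup>2 + t * (2 * w x)) + (LINT x|M. t\<^sup>2 * (norm z)\<^sup>2)"
      by (intro Bochner_Integration.integral_add Bochner_Integration.integrable_add integrable_mult_right
        wi(1) Lp2D(5)[OF psi0(2)] finite_measure.integrable_const[OF finite_M])
    also have "(LINT x|M. (cmod (\<psi>0 x))\<^sup>2 + t * (2 * w x)) = (LINT x|M. (cmod (\<psi>0 x))\<^sup>2) + (LINT x|M. t * (2 * w x))"
      by (intro Bochner_Integration.integral_add integrable_mult_right wi(1) Lp2D(5)[OF psi0(2)])
    also have "(LINT x|M. t\<^sup>2 * (norm z)\<^sup>2) = V * (t\<^sup>2 * (norm z)\<^sup>2)" by (simp add: measure_M)
    also have "(LINT x|M. t * (2 * w x)) = t * (2 * (LINT x|M. w x))" by simp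
    finally show ?thesis by (simp add: psi0(3) wi(2) n_def n1_def n2_def mult_ac)
  qed
  define K1 K2 where "K1 = (k0 \<bullet> k0) * (2 * Re (fc \<psi>0 k0 * cnj (z * sqrt V)))" and "K2 = (k0 \<bullet> k0) * (norm (z * sqrt V))\<^sup>2"
  have K0s: "((\<lambda>k. (k \<bullet> k) * (norm (fc \<psi>0 k))\<^sup>2) has_sum K0) Q"
    unfolding K0_def by (rule has_sum_infsum[OF Sobolev_1D(2)[OF psi0(1)]])
  have K1s: "((\<lambda>k. (k \<bullet> k) * (2 * Re (fc \<psi>0 k * cnj (fc v k)))) has_sum K1) Q"
    using has_sum_single[OF k0, of "\<lambda>k. (k \<bullet> k) * (2 * Re (fc \<psi>0 k * cnj (fc v k)))"] fcv k0 by (simp add: K1_def)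
  have K2s: "((\<lambda>k. (k \<bullet> k) * (norm (fc v k))\<^sup>2) has_sum K2) Q"
    using has_sum_single[OF k0, of "\<lambda>k. (k \<bullet> k) * (norm (fc v k))\<^sup>2"] fcv k0 by (simp add: K2_def)
  have fcu: "fc (\<lambda>x. \<psi>0 x + of_real t * v x) k = fc \<psi>0 k + of_real t * fc v k" for t k
    by (simp add: fc_add fc_cmult Lp2_imp_Lp1 Lp2_cmult psi0(2) vL)
  have Ku: "((\<lambda>k. (k \<bullet> k) * (norm (fc \<psi>0 k + of_real t * fc v k))\<^sup>2) has_sum (K0 + t * K1 + t\<^sup>2 * K2)) Q" for t
  proof -
    have "(k \<bullet> k) * (norm (fc \<psi>0 k + of_real t * fc v k))\<^sup>2 =
      ((k \<bullet> k) * (norm (fc \<psi>0 k))\<^sup>2 + t * ((k \<bullet> k) * (2 * Re (fc \<psi>0 k * cnj (fc v k))))) + t\<^sup>2 * ((k \<bullet> k) * (norm (fc v k))\<^sup>2)" for k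
      by (simp only: cmod_power2) (simp add: power2_eq_square algebra_simps)
    then show ?thesis by (simp only:) (intro has_sum_add has_sum_cmult_right K0s K1s K2s)
  qed
  define F where "F t = A * (\<eta> t * (K0 + t * K1 + t\<^sup>2 * K2)) + 1/2 * (DD (sig X0) (sig X0) +
      (2 * (e * \<eta> t)) * (DD (sig X0) h0 + t * DD (sig X0) h1) + (e * \<eta> t)\<^sup>2 * (DD h0 h0 + (2 * t) * DD h0 h1 + t\<^sup>2 * DD h1 h1))" for t
  define \<xi> where "\<xi> t x = of_real (sqrt (\<eta> t)) * (\<psi>0 x + of_real t * v x)" for t x
  have energy_F: "energ (\<xi> t) X0 = F t \<and> energ \<psi>0 X0 \<le> F t" if nt: "n t > 0" for t
  proof -
    have lt: "\<eta> t > 0" using nt Zpos by (simp add: \<eta>_def)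
    have chiL: "\<xi> t \<in> Lp a 2" unfolding \<xi>_def by (intro Lp2_cmult Lp2_add psi0(2) vL)
    have fchi: "fc (\<xi> t) k = of_real (sqrt (\<eta> t)) * (fc \<psi>0 k + of_real t * fc v k)" for k
      unfolding \<xi>_def fc_cmult fcu ..
    have Kchi: "((\<lambda>k. (k \<bullet> k) * (norm (fc (\<xi> t) k))\<^sup>2) has_sum (\<eta> t * (K0 + t * K1 + t\<^sup>2 * K2))) Q"
    proof -
      have "(k \<bullet> k) * (norm (fc (\<xi> t) k))\<^sup>2 = \<eta> t * ((k \<bullet> k) * (norm (fc \<psi>0 k + of_real t * fc v k))\<^sup>2)" for k
        using lt by (simp add: fchi norm_mult power_mult_distrib)
      then show ?thesis by (simp only:) (intro has_sum_cmult_right Ku)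
    qed
    then have chiS: "\<xi> t \<in> Sobolev a 1" using chiL unfolding Sobolev_1_iff summable_on_def by blast
    have nchi: "(cmod (\<xi> t x))\<^sup>2 = \<eta> t * (cmod (\<psi>0 x + of_real t * v x))\<^sup>2" for x
      using lt by (simp add: \<xi>_def norm_mult power_mult_distrib)
    have "(LINT x|M. (cmod (\<xi> t x))\<^sup>2) = Z" unfolding nchi using nt by (simp add: int_u \<eta>_def)
    then have le: "energ \<psi>0 X0 \<le> energ (\<xi> t) X0" by (rule minimal_any[OF chiS])
    have dchi: "dens (\<xi> t) = (\<lambda>x. of_real (\<eta> t) * ((h0 x + of_real t * h1 x) + of_real (t\<^sup>2) * h2 x))"
    proof
      fix x
      have "dens (\<xi> t) x = of_real (\<eta> t * ((cmod (\<psi>0 x))\<^sup>2 + t * (2 * Re (\<psi>0 x * cnj (v x))) + t\<^sup>2 * (norm z)\<^sup>2))"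
        unfolding dens_def nchi dens_u ..
      then show "dens (\<xi> t) x = of_real (\<eta> t) * ((h0 x + of_real t * h1 x) + of_real (t\<^sup>2) * h2 x)"
        by (simp only: h0_def dens_def h1_def h2_eq of_real_mult of_real_add)
    qed
    have fdchi: "fc (dens (\<xi> t)) k = of_real (\<eta> t) * ((fc h0 k + of_real t * fc h1 k) + of_real (t\<^sup>2) * fc h2 k)" for k
      unfolding dchi fc_cmult
      by (simp only: fc_add fc_cmult Lp2_imp_Lp1 Lp2_add Lp2_cmult h0L h1L h2L)
    have frho: "(norm (fc (rho (\<xi> t) X0) k))\<^sup>2 / (k \<bullet> k) =
       (coulomb (sig X0) (sig X0) k +
        (2 * (e * \<eta> t)) * (coulomb (sig X0) h0 k + t * coulomb (sig X0) h1 k)) +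
        (e * \<eta> t)\<^sup>2 * ((coulomb h0 h0 k + (2 * t) * coulomb h0 h1 k) + t\<^sup>2 * coulomb h1 h1 k)"
      if k: "k \<in> Q" for k
    proof (cases "k = 0")
      case False
      have "fc (rho (\<xi> t) X0) k = fc (sig X0) k + of_real (e * \<eta> t) * (fc h0 k + of_real t * fc h1 k)"
        unfolding fc_rho[OF chiL] fdchi fch2[OF k False] by simp
      then show ?thesis by (simp only: norm_quadratic_expand coulomb_def) (simp add: add_divide_distrib distrib_left)
    qed (simp add: coulomb_def)
    have "(ens (\<xi> t) X0 has_sum F t) Q"
    proof -
      have "((\<lambda>k. A * ((k \<bullet> k) * (norm (fc (\<xi> t) k))\<^sup>2) + 1/2 * ((coulomb (sig X0) (sig X0) k +
        (2 * (e * \<eta> t)) * (coulomb (sig X0) h0 k + t * coulomb (sig X0) h1 k)) +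
        (e * \<eta> t)\<^sup>2 * ((coulomb h0 h0 k + (2 * t) * coulomb h0 h1 k) + t\<^sup>2 * coulomb h1 h1 k)))
        has_sum F t) Q"
        unfolding F_def by (intro has_sum_add has_sum_cmult_right Kchi DD_has_sum sig_Lp2 h0L h1L)
      then show ?thesis by (rule has_sum_cong[THEN iffD1, rotated]) (simp only: ens_def frho)
    qed
    then have "energ (\<xi> t) X0 = F t" using has_sum_unique energy_ens[OF chiS] by blast
    with le show ?thesis by simp
  qed
  have n0: "n 0 = Z" and l0: "\<eta> 0 = 1" using Zpos by (simp_all add: \<eta>_def n_def)
  have F0: "F 0 = energ \<psi>0 X0"
    using energy_F[of 0] Zpos by (simp add: \<xi>_def[abs_def] n0 l0)
  \<comment> \<open>The derivative of \<open>F\<close> at \<open>0\<close>, computed with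
    \<open>\<eta> 0 = 1\<close> and the derivative \<open>- (n1 / Z)\<close> of
    \<open>\<eta>\<close>.\<close>
  define L where "L = A * (K1 - n1 / Z * K0) + e * (DD (sig X0) h1 - n1 / Z * DD (sig X0) h0) + e\<^sup>2 * (DD h0 h1 - n1 / Z * DD h0 h0)"
  have Z0: "Z \<noteq> 0" using Zpos by simp
  have dl: "(\<eta> has_real_derivative - (n1 / Z)) (at 0)"
    unfolding \<eta>_def[abs_def] n_def by (auto intro!: derivative_eq_intros simp: Z0 power2_eq_square)
  have dF: "(F has_real_derivative L) (at 0)"
    unfolding F_def[abs_def] L_def
    by (auto intro!: derivative_eq_intros dl simp: l0) (simp add: algebra_simps power2_eq_square)
  have "L = 0"
  proof (rule DERIV_local_min[OF dF])
    \<comment> \<open>Within this radius \<open>t * n1\<close> is smaller than \<open>Z\<close> in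
      modulus, so \<open>n t\<close> stays positive and the normalisation makes sense.\<close>
    show "0 < Z / (\<bar>n1\<bar> + 1)" using Zpos by simp
    show "\<forall>t. \<bar>0 - t\<bar> < Z / (\<bar>n1\<bar> + 1) \<longrightarrow> F 0 \<le> F t"
    proof (intro allI impI)
      fix t assume "\<bar>0 - t\<bar> < Z / (\<bar>n1\<bar> + 1)"
      then have "\<bar>t\<bar> * (\<bar>n1\<bar> + 1) < Z" by (simp add: pos_less_divide_eq)
      then have "\<bar>t * n1\<bar> < Z" using abs_ge_zero[of t] by (simp add: abs_mult distrib_left)
      moreover have "t\<^sup>2 * n2 \<ge> 0" using V_pos by (simp add: n2_def)
      ultimately have "n t > 0" unfolding n_def by linarith
      then show "F 0 \<le> F t" using energy_F F0 by simp
    qed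
  qed
  \<comment> \<open>By linearity the pairings with the ions and with the electrons combine into the
    pairing with the total charge \<open>R0\<close>, whose potential is
    \<open>\<Phi>\<close>.\<close>
  moreover have "DD (sig X0) h1 + e * DD h0 h1 = Re (LINT x|M. \<Phi> x * cnj (h1 x))"
  proof -
    have "((\<lambda>k. coulomb (sig X0) h1 k + e * coulomb h0 h1 k) has_sum (DD (sig X0) h1 + e * DD h0 h1)) Q"
      by (intro has_sum_add has_sum_cmult_right DD_has_sum sig_Lp2 h0L h1L)
    moreover have "coulomb (sig X0) h1 k + e * coulomb h0 h1 k = coulomb R0 h1 k" for k
      unfolding coulomb_def fc_R0 h0_def by (simp add: distrib_right distrib_left right_diff_distrib add_divide_distrib diff_divide_distrib)
    ultimately have "(coulomb R0 h1 has_sum (DD (sig X0) h1 + e * DD h0 h1)) Q"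
      by simp
    then show ?thesis using has_sum_unique D_has_sum[OF R0 h1L] unfolding \<Phi>_def by blast
  qed
  moreover have "Re (LINT x|M. \<Phi> x * cnj (h1 x)) = 2 * Re (cnj z * (sqrt V * fc (\<lambda>x. \<Phi> x * \<psi>0 x) k0))"
  proof -
    have i: "integrable M (\<lambda>x. cnj z * (cis (k0 \<bullet> x) * (\<Phi> x * \<psi>0 x)))"
      by (intro integrable_mult_right integrable_cis_mult Lp2_imp_Lp1 Phi_psi0)
    have i2: "integrable M (\<lambda>x. \<Phi> x * cnj (h1 x))"
      by (rule Lp1D(4)[OF Lp2_mult_Lp2[OF Phi(1) Lp2_cnj[OF h1L]]])
    have "Re (\<Phi> x * cnj (h1 x)) = 2 * Re (cnj z * (cis (k0 \<bullet> x) * (\<Phi> x * \<psi>0 x)))" for x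
    proof -
      have v': "cnj (v x) = cnj z * cis (k0 \<bullet> x)" by (simp add: v_def cis_cnj)
      have "Re (of_real p * cnj (of_real (2 * Re w))) = 2 * Re (of_real p * w)" for p w by simp
      from this[of "Re (\<Phi> x)" "\<psi>0 x * cnj (v x)"]
      have "Re (\<Phi> x * cnj (h1 x)) = 2 * Re (\<Phi> x * (\<psi>0 x * cnj (v x)))" unfolding Phi_real h1_def .
      also have "\<Phi> x * (\<psi>0 x * cnj (v x)) = cnj z * (cis (k0 \<bullet> x) * (\<Phi> x * \<psi>0 x))"
        unfolding v' by (simp only: mult_ac)
      finally show ?thesis .
    qed
    then have "Re (LINT x|M. \<Phi> x * cnj (h1 x)) = (LINT x|M. 2 * Re (cnj z * (cis (k0 \<bullet> x) * (\<Phi> x * \<psi>0 x))))"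
      using integral_Re[OF i2] by simp
    also have "\<dots> = 2 * Re (LINT x|M. cnj z * (cis (k0 \<bullet> x) * (\<Phi> x * \<psi>0 x)))"
      by (subst integral_mult_right_zero) (simp only: integral_Re[OF i])
    also have "\<dots> = 2 * Re (cnj z * (sqrt V * fc (\<lambda>x. \<Phi> x * \<psi>0 x) k0))"
      using V_pos by (simp add: fc_eq)
    finally show ?thesis .
  qed
  moreover have "L = A * K1 + e * (DD (sig X0) h1 + e * DD h0 h1) - n1 * \<Lambda>"
    unfolding L_def \<Lambda>_def h0_def using Z0 by (simp add: field_simps power2_eq_square)
  ultimately have eq: "A * K1 + e * (2 * Re (cnj z * (sqrt V * fc (\<lambda>x. \<Phi> x * \<psi>0 x) k0))) - n1 * \<Lambda> = 0"
    by simp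
  have "A * K1 + e * (2 * Re (cnj z * (sqrt V * fc (\<lambda>x. \<Phi> x * \<psi>0 x) k0))) - n1 * \<Lambda> = (2 * sqrt V) *
     Re (cnj z * (of_real (A * (k0 \<bullet> k0)) * fc \<psi>0 k0 + of_real e * fc (\<lambda>x. \<Phi> x * \<psi>0 x) k0 - of_real \<Lambda> * fc \<psi>0 k0))"
    unfolding K1_def n1_def I1 by (simp add: algebra_simps)
  then show ?thesis using eq V_pos by simp
qed

text \<open>The real condition of \<open>first_variation\<close> holds for every complex amplitude
  \<open>z\<close>; with the residual itself as \<open>z\<close> it becomes the squared modulus of
  the residual.\<close>

lemma schroedinger_fourier:
  assumes k: "k \<in> Q"
  shows "of_real (A * (k \<bullet> k)) * fc \<psi>0 k + of_real e * fc (\<lambda>x. \<Phi> x * \<psi>0 x) k = of_real \<Lambda> * fc \<psi>0 k"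
proof -
  define w where "w = of_real (A * (k \<bullet> k)) * fc \<psi>0 k + of_real e * fc (\<lambda>x. \<Phi> x * \<psi>0 x) k - of_real \<Lambda> * fc \<psi>0 k"
  have "Re (cnj z * w) = 0" for z unfolding w_def by (rule first_variation[OF k])
  then have "Re (cnj w * w) = 0" .
  moreover have "cnj w * w = of_real ((norm w)\<^sup>2)" unfolding norm_square_cnj by (rule mult.commute)
  ultimately have "(norm w)\<^sup>2 = 0" by (metis Re_complex_of_real)
  then have "w = 0" by simp
  then show ?thesis by (simp add: w_def)
qed

lemma psi0_Sobolev_2: "(\<lambda>k. (k \<bullet> k)\<^sup>2 * (norm (fc \<psi>0 k))\<^sup>2) summable_on Q"
proof -
  define g where "g x = of_real \<Lambda> * \<psi>0 x - of_real e * (\<Phi> x * \<psi>0 x)" for x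
  have gL: "g \<in> Lp a 2" unfolding g_def[abs_def] by (intro Lp2_diff Lp2_cmult psi0(2) Phi_psi0)
  have fcg: "fc g k = of_real (A * (k \<bullet> k)) * fc \<psi>0 k" if "k \<in> Q" for k
  proof -
    have "fc g k = of_real \<Lambda> * fc \<psi>0 k - of_real e * fc (\<lambda>x. \<Phi> x * \<psi>0 x) k"
      unfolding g_def[abs_def]
      by (simp only: fc_diff fc_cmult Lp2_imp_Lp1 Lp2_cmult psi0(2) Phi_psi0)
    then show ?thesis by (simp only: schroedinger_fourier[OF that, symmetric] add_diff_cancel_right')
  qed
  have "(\<lambda>k. (1 / A)\<^sup>2 * (norm (fc g k))\<^sup>2) summable_on Q"
    by (intro summable_on_cmult_right fc_summable gL)
  moreover have "(1 / A)\<^sup>2 * (norm (fc g k))\<^sup>2 = (k \<bullet> k)\<^sup>2 * (norm (fc \<psi>0 k))\<^sup>2" if "k \<in> Q" for k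
    using A_pos by (simp add: fcg[OF that] norm_mult power_mult_distrib power_divide abs_mult)
  ultimately show ?thesis using summable_on_cong[of Q] by (metis (no_types, lifting))
qed

lemma Phi_Sobolev_2: "(\<lambda>k. (k \<bullet> k)\<^sup>2 * (norm (fc \<Phi> k))\<^sup>2) summable_on Q"
proof (rule summable_on_comparison_test[OF fc_summable[OF R0]])
  fix k assume k: "k \<in> Q"
  show "(k \<bullet> k)\<^sup>2 * (norm (fc \<Phi> k))\<^sup>2 \<le> (norm (fc R0 k))\<^sup>2"
    by (cases "k = 0") (auto simp: Phi(2)[OF k] norm_divide power_divide)
qed simp

lemma schroedinger:
  "AE x in lebesgue. of_real \<Lambda> * \<psi>0 x = - of_real A * weak_laplacian a \<psi>0 x + of_real e * (\<Phi> x * \<psi>0 x)"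
proof (rule fc_unique)
  note S = Sobolev_2[OF psi0(2) psi0_Sobolev_2]
  have 1: "(\<lambda>x. - of_real A * weak_laplacian a \<psi>0 x) \<in> Lp a 2" by (intro Lp2_cmult S)
  have 2: "(\<lambda>x. of_real e * (\<Phi> x * \<psi>0 x)) \<in> Lp a 2" by (intro Lp2_cmult Phi_psi0)
  show "(\<lambda>x. of_real \<Lambda> * \<psi>0 x) \<in> Lp a 1" by (intro Lp2_imp_Lp1 Lp2_cmult psi0)
  show "(\<lambda>x. - of_real A * weak_laplacian a \<psi>0 x + of_real e * (\<Phi> x * \<psi>0 x)) \<in> Lp a 1"
    by (intro Lp2_imp_Lp1 Lp2_add 1 2)
  fix k assume k: "k \<in> Q"
  have "fc (\<lambda>x. - of_real A * weak_laplacian a \<psi>0 x + of_real e * (\<Phi> x * \<psi>0 x)) k =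
    - of_real A * (- of_real (k \<bullet> k) * fc \<psi>0 k) + of_real e * fc (\<lambda>x. \<Phi> x * \<psi>0 x) k"
    by (simp only: fc_add[OF Lp2_imp_Lp1[OF 1] Lp2_imp_Lp1[OF 2]] fc_cmult S(4)[OF k])
  then show "fc (\<lambda>x. of_real \<Lambda> * \<psi>0 x) k = fc (\<lambda>x. - of_real A * weak_laplacian a \<psi>0 x + of_real e * (\<Phi> x * \<psi>0 x)) k"
    by (simp only: fc_cmult schroedinger_fourier[OF k, symmetric]) simp
qed

lemma poisson: "AE x in lebesgue. - weak_laplacian a \<Phi> x = R0 x"
proof -
  note S = Sobolev_2[OF Phi(1) Phi_Sobolev_2]
  have "AE x in lebesgue. (-1) * weak_laplacian a \<Phi> x = R0 x"
  proof (rule fc_unique)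
    show "(\<lambda>x. (-1) * weak_laplacian a \<Phi> x) \<in> Lp a 1" "R0 \<in> Lp a 1"
      by (intro Lp2_imp_Lp1 Lp2_cmult S R0)+
    fix k assume k: "k \<in> Q"
    show "fc (\<lambda>x. (-1) * weak_laplacian a \<Phi> x) k = fc R0 k"
      unfolding fc_cmult S(4)[OF k] by (cases "k = 0") (auto simp: Phi(2)[OF k] R0_mean_zero)
  qed
  then show ?thesis by simp
qed

section \<open>Vanishing force on each ion\<close>

lemma R0_real: "fc R0 (- k) = cnj (fc R0 k)"
  unfolding R0_def rho_def[abs_def] by (rule fc_real)

text \<open>Moving the \<open>j\<close>-th ion by \<open>t\<close> in direction \<open>l\<close> multiplies its Fourier coefficients by
  \<open>cis (t * (k $ l))\<close>; the energy is quadratically close to its linearisation in \<open>t\<close>.\<close>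

lemma ion_variation:
  assumes j: "j \<in> {1..N}"
  defines "q \<equiv> fc (\<lambda>x. muc j (x - X0 j))"
  shows "((\<lambda>k. (k $ l) * Im (q k * cnj (fc R0 k)) / (k \<bullet> k)) has_sum 0) Q"
proof -
  define m0 where "m0 = (\<lambda>x. muc j (x - X0 j))"
  have m0L: "m0 \<in> Lp a 2" unfolding m0_def by (intro Lp_translate muc_Lp2 j)
  have q: "q = fc m0" by (simp add: q_def m0_def)
  \<comment> \<open>The charge of everything except the moved ion: the other ions and the electrons.
    Only its interaction with the ion changes under the shift.\<close>
  define r where "r k = fc R0 k - q k" for k
  have rL: "(\<lambda>x. R0 x - m0 x) \<in> Lp a 2" by (intro Lp2_diff R0 m0L)
  have rfc: "r k = fc (\<lambda>x. R0 x - m0 x) k" for k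
    by (simp add: r_def q fc_diff Lp2_imp_Lp1 R0 m0L)
  define C where "C = (\<Sum>\<^sub>\<infinity>k\<in>Q. norm (q k) * norm (r k))"
  have Cs: "(\<lambda>k. norm (q k) * norm (r k)) summable_on Q"
  proof (rule summable_on_comparison_test)
    show "(\<lambda>k. (norm (q k))\<^sup>2 + (norm (r k))\<^sup>2) summable_on Q"
      unfolding q rfc by (intro summable_on_add fc_summable m0L rL)
    show "norm (q k) * norm (r k) \<le> (norm (q k))\<^sup>2 + (norm (r k))\<^sup>2" for k by (simp add: mult_le_sum_squares)
  qed simp
  define g where "g k = (k $ l) * Im (q k * cnj (fc R0 k)) / (k \<bullet> k)" for k
  \<comment> \<open>The self-interaction term \<open>q k * cnj (q k)\<close> is real, so it drops
    out of the imaginary part.\<close>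
  have gr: "g k = (k $ l) * Im (q k * cnj (r k)) / (k \<bullet> k)" for k
    by (simp add: g_def r_def algebra_simps)
  obtain c where c: "c > 0" "\<And>k. k \<in> Q \<Longrightarrow> 1 / (k \<bullet> k) \<le> c * (1 / (1 + k \<bullet> k))" using Q_gap by blast
  \<comment> \<open>Nonzero dual vectors are bounded away from zero, so
    \<open>\<bar>k $ l\<bar> / (k \<bullet> k)\<close> is bounded.\<close>
  have gb: "norm (g k) \<le> c * (norm (q k) * norm (r k))" if k: "k \<in> Q" for k
  proof (cases "k = 0")
    case False
    have kk: "\<bar>k $ l\<bar> \<le> 1 + k \<bullet> k"
    proof -
      have "\<bar>k $ l\<bar> \<le> 1 + \<bar>k $ l\<bar>\<^sup>2" using zero_le_power2[of "\<bar>k $ l\<bar> - 1/2"] by (simp add: power2_eq_square algebra_simps)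
      also have "\<dots> \<le> 1 + k \<bullet> k" using component_le_inner[of k l] by simp
      finally show ?thesis .
    qed
    have "\<bar>k $ l\<bar> / (k \<bullet> k) \<le> (1 + k \<bullet> k) * (1 / (k \<bullet> k))" using kk by (simp add: divide_right_mono)
    also have "\<dots> \<le> (1 + k \<bullet> k) * (c * (1 / (1 + k \<bullet> k)))" by (intro mult_left_mono c k) simp
    also have "\<dots> = c"
    proof -
      have "1 + k \<bullet> k > 0" by (intro add_pos_nonneg) auto
      then show ?thesis by simp
    qed
    finally have 1: "\<bar>k $ l\<bar> / (k \<bullet> k) \<le> c" .
    have "norm (g k) = (\<bar>k $ l\<bar> / (k \<bullet> k)) * \<bar>Im (q k * cnj (r k))\<bar>" by (simp add: gr abs_mult)
    also have "\<dots> \<le> c * (norm (q k) * norm (r k))"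
      using abs_Im_le_cmod[of "q k * cnj (r k)"] 1 c(1) by (intro mult_mono) (auto simp: norm_mult)
    finally show ?thesis .
  qed (use c in \<open>auto simp: g_def\<close>)
  have gs: "g summable_on Q"
  proof (rule abs_summable_summable)
    show "(\<lambda>k. norm (g k)) summable_on Q"
      by (rule summable_on_comparison_test[OF summable_on_cmult_right[OF Cs, of c]]) (use gb in auto)
  qed
  define G where "G = infsum g Q"
  have Gh: "(g has_sum G) Q" unfolding G_def by (rule has_sum_infsum[OF gs])
  have Ch: "((\<lambda>k. norm (q k) * norm (r k)) has_sum C) Q" unfolding C_def by (rule has_sum_infsum[OF Cs])
  have C0: "C \<ge> 0" unfolding C_def by (intro infsum_nonneg) auto
  have main: "t * G \<le> t\<^sup>2 * C" for t
  proof -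
    define X where "X = X0(j := X0 j + t *\<^sub>R axis l 1)"
    have fcX: "fc (rho \<psi>0 X) k = r k + cis (t * (k $ l)) * q k" if k: "k \<in> Q" for k
    proof -
      have "fc (sig X) k - fc (sig X0) k = (\<Sum>i\<in>{1..N}. (cis (k \<bullet> X i) - cis (k \<bullet> X0 i)) * fc (muc i) k)"
        unfolding fc_sig[OF k] by (simp add: sum_subtractf left_diff_distrib)
      also have "\<dots> = (\<Sum>i\<in>{j}. (cis (k \<bullet> X i) - cis (k \<bullet> X0 i)) * fc (muc i) k)"
        by (rule sum.mono_neutral_right) (use j in \<open>auto simp: X_def\<close>)
      also have "\<dots> = (cis (t * (k $ l)) - 1) * q k"
        unfolding q_def fc_translate[OF k Lp2_imp_Lp1[OF muc_Lp2[OF j]]]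
        by (simp add: X_def inner_add_right inner_axis left_diff_distrib mult.assoc[symmetric] cis_mult add.commute)
      finally have "fc (sig X) k = fc (sig X0) k + (cis (t * (k $ l)) - 1) * q k" by (simp add: algebra_simps)
      then show ?thesis unfolding fc_rho[OF psi0(2)] r_def fc_R0 by (simp add: algebra_simps)
    qed
    have pw: "ens \<psi>0 X k \<le> ens \<psi>0 X0 k + (- t * g k + t\<^sup>2 * (norm (q k) * norm (r k)))" if k: "k \<in> Q" for k
    proof (cases "k = 0")
      case False
      define s where "s = t * (k $ l)"
      define z where "z = q k * cnj (r k)"
      have eq: "(norm (r k + cis s * q k))\<^sup>2 = (norm (r k + q k))\<^sup>2 + 2 * Re ((cis s - 1) * z)"
      proof -
        have "norm (cis s * q k) = norm (q k)" by (simp add: norm_mult)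
        then have n: "(norm (cis s * q k))\<^sup>2 = (norm (q k))\<^sup>2" by simp
        have ex: "(norm (x + y))\<^sup>2 = (norm x)\<^sup>2 + (norm y)\<^sup>2 + 2 * Re (y * cnj x)" for x y :: complex
          by (simp only: cmod_power2) (simp add: power2_eq_square algebra_simps)
        show ?thesis unfolding ex n z_def by (simp only: mult.assoc left_diff_distrib mult_1 minus_complex.simps(1)) simp
      qed
      have "(cis s - 1) * z = (cis s - 1 - \<i> * of_real s) * z + \<i> * of_real s * z" by (simp add: algebra_simps)
      moreover have "Re (\<i> * of_real s * z) = - s * Im z" by simp
      moreover have "Re ((cis s - 1 - \<i> * of_real s) * z) \<le> s\<^sup>2 * norm z"
      proof -
        have "Re ((cis s - 1 - \<i> * of_real s) * z) \<le> norm ((cis s - 1 - \<i> * of_real s) * z)" by (rule complex_Re_le_cmod)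
        also have "\<dots> \<le> s\<^sup>2 * norm z" unfolding norm_mult by (intro mult_right_mono cis_taylor) simp
        finally show ?thesis .
      qed
      ultimately have "Re ((cis s - 1) * z) \<le> s\<^sup>2 * norm z - s * Im z" by simp
      then have "Re ((cis s - 1) * z) / (k \<bullet> k) \<le> (s\<^sup>2 * norm z - s * Im z) / (k \<bullet> k)" by (intro divide_right_mono) auto
      also have "\<dots> = s\<^sup>2 / (k \<bullet> k) * norm z - t * g k"
        by (simp add: diff_divide_distrib gr z_def s_def)
      \<comment> \<open>The Taylor remainder contains two powers of \<open>k\<close>, exactly
        compensated by the Coulomb weight; what is left is summable by \<open>Cs\<close>.\<close>
      also have "\<dots> \<le> t\<^sup>2 * norm z - t * g k"
      proof -
        have "s\<^sup>2 = t\<^sup>2 * (k $ l)\<^sup>2" by (simp add: s_def power_mult_distrib)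
        also have "\<dots> \<le> t\<^sup>2 * (k \<bullet> k)" by (intro mult_left_mono component_le_inner) simp
        finally have "s\<^sup>2 / (k \<bullet> k) \<le> t\<^sup>2" using False by (simp add: pos_divide_le_eq)
        then show ?thesis by (intro diff_right_mono mult_right_mono) auto
      qed
      finally have *: "Re ((cis s - 1) * z) / (k \<bullet> k) \<le> t\<^sup>2 * norm z - t * g k" .
      have rq: "r k + q k = fc (rho \<psi>0 X0) k" by (simp add: r_def R0_def)
      have al: "u + 1 / 2 * ((x + 2 * y) / d) = (u + 1 / 2 * (x / d)) + y / d" for u x y d :: real
        by (simp add: add_divide_distrib)
      have "ens \<psi>0 X k = ens \<psi>0 X0 k + Re ((cis s - 1) * z) / (k \<bullet> k)"
        by (simp only: ens_def fcX[OF k] s_def[symmetric] eq rq al)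
      then show ?thesis using * by (simp add: z_def norm_mult)
    qed (simp add: ens_def g_def)
    have "((\<lambda>k. ens \<psi>0 X0 k + (- t * g k + t\<^sup>2 * (norm (q k) * norm (r k)))) has_sum (energ \<psi>0 X0 + (- t * G + t\<^sup>2 * C))) Q"
      by (intro has_sum_add has_sum_cmult_right Gh Ch energy_ens psi0)
    with energy_ens[OF psi0(1)] have "energ \<psi>0 X \<le> energ \<psi>0 X0 + (- t * G + t\<^sup>2 * C)"
      by (rule has_sum_mono) (rule pw)
    \<comment> \<open>The shifted ion may leave the cell, which \<open>minimal_any\<close>
      allows.\<close>
    moreover have "energ \<psi>0 X0 \<le> energ \<psi>0 X" by (rule minimal_any[OF psi0(1,3)])
    ultimately show ?thesis by simp
  qed
  have "G = 0" by (rule quadratic_nonneg_imp_zero[OF main C0])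
  then show ?thesis using Gh by (simp add: g_def[abs_def])
qed

text \<open>The real part vanishes by the stationarity condition \<open>ion_variation\<close>. The
  imaginary part is the sum of an odd function of \<open>k\<close>, because both densities are real,
  and vanishes by the symmetry of \<open>Q\<close>.\<close>

lemma force_zero:
  assumes j: "j \<in> {1..N}"
  shows "(LINT x|M. complex_of_real (\<mu> j (x - X0 j)) * weak_deriv a l \<Phi> x) = 0"
proof -
  define m0 where "m0 = (\<lambda>x. muc j (x - X0 j))"
  have m0L: "m0 \<in> Lp a 2" unfolding m0_def by (intro Lp_translate muc_Lp2 j)
  note d = Sobolev_1D[OF Sobolev_2(2)[OF Phi(1) Phi_Sobolev_2]]
  define S where "S = (LINT x|M. weak_deriv a l \<Phi> x * cnj (m0 x))"
  define p where "p k = fc R0 k * cnj (fc m0 k)" for k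
  have s1: "((\<lambda>k. fc (weak_deriv a l \<Phi>) k * cnj (fc m0 k)) has_sum S) Q"
    unfolding S_def by (intro parseval d m0L)
  have s2: "fc (weak_deriv a l \<Phi>) k * cnj (fc m0 k) = - \<i> * of_real (k $ l / (k \<bullet> k)) * p k" if k: "k \<in> Q" for k
    unfolding d(5)[OF k] Phi(2)[OF k] p_def by simp
  have hs: "((\<lambda>k. - \<i> * of_real (k $ l / (k \<bullet> k)) * p k) has_sum S) Q"
    by (rule has_sum_cong[THEN iffD1, OF _ s1]) (rule s2)
  have "Re S = 0"
  proof -
    have "((\<lambda>k. Re (- \<i> * of_real (k $ l / (k \<bullet> k)) * p k)) has_sum Re S) Q" by (rule has_sum_Re[OF hs])
    moreover have "Re (- \<i> * of_real (k $ l / (k \<bullet> k)) * p k) = - ((k $ l) * Im (fc m0 k * cnj (fc R0 k)) / (k \<bullet> k))" for k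
      by (simp add: p_def algebra_simps diff_divide_distrib)
    moreover have "((\<lambda>k. - ((k $ l) * Im (fc m0 k * cnj (fc R0 k)) / (k \<bullet> k))) has_sum - 0) Q"
      unfolding m0_def by (intro has_sum_uminusI ion_variation j)
    ultimately show ?thesis using has_sum_unique by simp
  qed
  moreover have "Im S = 0"
  proof -
    define h where "h k = Im (- \<i> * of_real (k $ l / (k \<bullet> k)) * p k)" for k
    have h: "(h has_sum Im S) Q" unfolding h_def by (rule has_sum_Im[OF hs])
    have "fc m0 (- k) = cnj (fc m0 k)" for k unfolding m0_def muc_def by (rule fc_real)
    then have "p (- k) = cnj (p k)" for k by (simp add: p_def R0_real)
    then have hm: "h (- k) = - h k" for k by (simp add: h_def)
    have "((\<lambda>k. h (- k)) has_sum Im S) Q" using has_sum_reindex_bij_betw[OF Q_uminus_bij, of h] h by simp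
    moreover have "((\<lambda>k. h (- k)) has_sum - Im S) Q" unfolding hm by (rule has_sum_uminusI[OF h])
    ultimately have "Im S = - Im S" by (rule has_sum_unique)
    then show ?thesis by simp
  qed
  ultimately have "S = 0" by (simp add: complex_eq_iff)
  then show ?thesis by (simp add: S_def m0_def muc_def mult.commute)
qed

end

theorem theorem2p1:
  fixes a :: "3 \<Rightarrow> real^3" and hbar m e :: real and N :: nat
    and \<mu> :: "nat \<Rightarrow> real^3 \<Rightarrow> real"
  assumes "inj a" and "independent (range a)"
    and "hbar > 0" and "m > 0" and "e < 0" and "N \<ge> 1"
    and "\<And>j. j \<in> {1..N} \<Longrightarrow> \<mu> j \<in> Lp a 1 \<inter> Lp a 2"
    and "total_ion_number a e N \<mu> > 0"
  shows "\<exists>(\<psi>0, X0) \<in> configurations a e N \<mu>.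
    ereal (energy a hbar m e N \<mu> \<psi>0 X0) =
      (INF (\<psi>, X) \<in> configurations a e N \<mu>. ereal (energy a hbar m e N \<mu> \<psi> X)) \<and>
    \<psi>0 \<in> Sobolev a 2 \<and>
    (\<exists>(\<phi>0 :: real^3 \<Rightarrow> real) (\<omega>0 :: real).
      (\<lambda>x. complex_of_real (\<phi>0 x)) \<in> Sobolev a 2 \<and>
      (AE x in lebesgue.
         complex_of_real (hbar * \<omega>0) * \<psi>0 x =
           - complex_of_real (hbar\<^sup>2 / (2 * m)) * weak_laplacian a \<psi>0 x
           + complex_of_real (e * \<phi>0 x) * \<psi>0 x) \<and>
      (AE x in lebesgue.
         - weak_laplacian a (\<lambda>y. complex_of_real (\<phi>0 y)) x =
           complex_of_real (ion_density N \<mu> X0 x + e * (cmod (\<psi>0 x))\<^sup>2)) \<and>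
      (\<forall>j\<in>{1..N}.
         (LINT x|lebesgue_on (cell a).
            \<mu> j (x - X0 j) *\<^sub>R weak_grad a (\<lambda>y. complex_of_real (\<phi>0 y)) x) = 0))"
proof -
  interpret crystal a hbar m e N \<mu>
    by unfold_locales (use assms in auto)
  obtain \<psi>0 X0 where cfg: "(\<psi>0, X0) \<in> configurations a e N \<mu>"
    and min: "\<forall>(\<psi>, X)\<in>configurations a e N \<mu>. energ \<psi>0 X0 \<le> energ \<psi> X"
    using minimizer_exists by blast
  interpret minimizer a hbar m e N \<mu> \<psi>0 X0
    by unfold_locales (use cfg min in auto)
  have "ereal (energ \<psi>0 X0) = (INF (\<psi>, X) \<in> configurations a e N \<mu>. ereal (energ \<psi> X))"
  proof (rule antisym)
    show "ereal (energ \<psi>0 X0) \<le> (INF (\<psi>, X) \<in> configurations a e N \<mu>. ereal (energ \<psi> X))"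
      by (rule INF_greatest) (use min in auto)
    show "(INF (\<psi>, X) \<in> configurations a e N \<mu>. ereal (energ \<psi> X)) \<le> ereal (energ \<psi>0 X0)"
      using INF_lower[OF cfg, of "\<lambda>(\<psi>, X). ereal (energ \<psi> X)"] by simp
  qed
  moreover have "\<psi>0 \<in> Sobolev a 2" by (rule Sobolev_2(1)[OF psi0(2) psi0_Sobolev_2])
  moreover have "\<exists>(\<phi>0 :: real^3 \<Rightarrow> real) (\<omega>0 :: real).
      (\<lambda>x. complex_of_real (\<phi>0 x)) \<in> Sobolev a 2 \<and>
      (AE x in lebesgue.
         complex_of_real (hbar * \<omega>0) * \<psi>0 x =
           - complex_of_real (hbar\<^sup>2 / (2 * m)) * weak_laplacian a \<psi>0 x
           + complex_of_real (e * \<phi>0 x) * \<psi>0 x) \<and>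
      (AE x in lebesgue.
         - weak_laplacian a (\<lambda>y. complex_of_real (\<phi>0 y)) x =
           complex_of_real (ion_density N \<mu> X0 x + e * (cmod (\<psi>0 x))\<^sup>2)) \<and>
      (\<forall>j\<in>{1..N}.
         (LINT x|lebesgue_on (cell a).
            \<mu> j (x - X0 j) *\<^sub>R weak_grad a (\<lambda>y. complex_of_real (\<phi>0 y)) x) = 0)"
  \<comment> \<open>\<open>\<Lambda>\<close> is an energy, so the frequency is
    \<open>\<Lambda> / hbar\<close>. Taking \<open>Re\<close> only changes the type, by
    \<open>Phi_real\<close>.\<close>
  proof (intro exI[of _ "\<lambda>x. Re (\<Phi> x)"] exI[of _ "\<Lambda> / hbar"] conjI ballI)
    show "(\<lambda>x. complex_of_real (Re (\<Phi> x))) \<in> Sobolev a 2"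
      unfolding Phi_real by (rule Sobolev_2(1)[OF Phi(1) Phi_Sobolev_2])
    show "AE x in lebesgue. complex_of_real (hbar * (\<Lambda> / hbar)) * \<psi>0 x =
           - complex_of_real (hbar\<^sup>2 / (2 * m)) * weak_laplacian a \<psi>0 x
           + complex_of_real (e * Re (\<Phi> x)) * \<psi>0 x"
      using schroedinger hbar unfolding of_real_mult Phi_real A_def by (simp add: mult.assoc)
    show "AE x in lebesgue. - weak_laplacian a (\<lambda>y. complex_of_real (Re (\<Phi> y))) x =
           complex_of_real (ion_density N \<mu> X0 x + e * (cmod (\<psi>0 x))\<^sup>2)"
      using poisson unfolding Phi_real R0_def rho_def charge_density_def .
    fix j assume j: "j \<in> {1..N}"
    let ?f = "\<lambda>x. \<mu> j (x - X0 j) *\<^sub>R weak_grad a \<Phi> x"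
    have "(LINT x|M. ?f x) = 0"
    \<comment> \<open>Components may be taken inside the integral only for an integrable vector
      field. This is the actual case, as both factors are square integrable; the other one is closed
      by the convention that the integral is then zero.\<close>
    proof (cases "integrable M ?f")
      case True
      have "(LINT x|M. ?f x) $ l = 0" for l
      proof -
        have "(LINT x|M. ?f x) $ l = (LINT x|M. ?f x $ l)"
          by (rule integral_bounded_linear[OF bounded_linear_vec_nth True, symmetric])
        also have "\<dots> = (LINT x|M. complex_of_real (\<mu> j (x - X0 j)) * weak_deriv a l \<Phi> x)"
          by (simp only: vector_scaleR_component weak_grad_def vec_lambda_beta) (simp only: scaleR_conv_of_real)
        finally show ?thesis using force_zero[OF j] by simp
      qed
      then show ?thesis by (simp add: vec_eq_iff)
    qed (rule not_integrable_integral_eq)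
    then show "(LINT x|M. \<mu> j (x - X0 j) *\<^sub>R weak_grad a (\<lambda>y. complex_of_real (Re (\<Phi> y))) x) = 0"
      unfolding Phi_real .
  qed
  ultimately show ?thesis using cfg by blast
qed

end
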